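(* Let $\alpha,\tau\in C^{\log}_{\mathrm{loc}}$ with $\tau^->0$, and let $p,q\in\mathcal{P}^{\log}_0$ with $q^+<\infty$. Then $$\mathcal{S}(\mathbb{R}^n)\hookrightarrow\mathfrak{B}^{\alpha(\cdot),\tau(\cdot)}_{p(\cdot),q(\cdot)}\hookrightarrow\mathcal{S}'(\mathbb{R}^n),$$ i.e. both inclusions hold and are continuous.
   Context: $g^\pm$: essential sup/inf. $\mathcal{P}_0$: measurable $p:\mathbb{R}^n\to(0,\infty)$ with $p^->0$. $g\in C^{\log}_{\mathrm{loc}}$: $|g(x)-g(y)|\le c/\log(e+1/|x-y|)$; $g\in C^{\log}$: additionally $|g(x)-g_\infty|\le c/\log(e+|x|)$. $\mathcal{P}_0^{\log}=\{p\in\mathcal{P}_0:1/p\in C^{\log}\}$. $\|f\|_{p(\cdot)}=\inf\{\lambda>0:\int|f/\lambda|^{p(x)}dx\le1\}$; $\|(f_v)\|_{\ell^{q(\cdot)}(L^{p(\cdot)})}=\inf\{\mu>0:\sum_v\inf\{\lambda_v>0:\int|f_v(x)/(\mu\lambda_v^{1/q(x)})|^{p(x)}dx\le1\}\le1\}$. Dyadic cubes $Q_{v,m}=\{x:m_i\le2^vx_i<m_i+1\}$ ($v\in\mathbb{Z}$) form $\mathcal{Q}$; $v_P=-\log_2l(P)$, $v_P^+=\max(v_P,0)$. Fix $\Phi,\varphi\in\mathcal{S}$ with $\operatorname{supp}\mathcal{F}\Phi\subset\overline{B(0,2)}$, $|\mathcal{F}\Phi(\xi)|\ge c>0$ for $|\xi|\le5/3$,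 $\operatorname{supp}\mathcal{F}\varphi\subset\overline{B(0,2)}\setminus B(0,1/2)$, $|\mathcal{F}\varphi(\xi)|\ge c>0$ for $3/5\le|\xi|\le5/3$; $\varphi_v=2^{vn}\varphi(2^v\cdot)$ ($v\ge1$), $\varphi_0:=\Phi$. $\mathfrak{B}^{\alpha(\cdot),\tau(\cdot)}_{p(\cdot),q(\cdot)}$ is the set of $f\in\mathcal{S}'$ with $\|f\|=\sup_{P\in\mathcal{Q}}\|(2^{v\alpha(\cdot)}\varphi_v\ast f\,|P|^{-\tau(\cdot)}\chi_P)_{v\ge v_P^+}\|_{\ell^{q(\cdot)}(L^{p(\cdot)})}<\infty$. *)

theory Defs
  imports "HOL-Analysis.Analysis"
begin

definition ess_sup :: "('a::euclidean_space \<Rightarrow> real) \<Rightarrow> ereal" where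
  "ess_sup g = Inf {c::ereal. AE x in lebesgue. ereal (g x) \<le> c}"

definition ess_inf :: "('a::euclidean_space \<Rightarrow> real) \<Rightarrow> ereal" where
  "ess_inf g = Sup {c::ereal. AE x in lebesgue. c \<le> ereal (g x)}"

definition Clog_loc :: "('a::euclidean_space \<Rightarrow> real) \<Rightarrow> bool" where
  "Clog_loc g \<longleftrightarrow> (\<exists>c. \<forall>x y. \<bar>g x - g y\<bar> \<le> c / ln (exp 1 + 1 / norm (x - y)))"

definition Clog :: "('a::euclidean_space \<Rightarrow> real) \<Rightarrow> bool" where
  "Clog g \<longleftrightarrow> Clog_loc g \<and>
     (\<exists>g_inf c. \<forall>x. \<bar>g x - g_inf\<bar> \<le> c / ln (exp 1 + norm x))"

definition P0 :: "('a::euclidean_space \<Rightarrow> real) set" where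
  "P0 = {p. p \<in> borel_measurable lebesgue \<and> (\<forall>x. 0 < p x) \<and> ess_inf p > 0}"

definition P0log :: "('a::euclidean_space \<Rightarrow> real) set" where
  "P0log = {p. p \<in> P0 \<and> Clog (\<lambda>x. 1 / p x)}"

fun partials :: "'a::euclidean_space list \<Rightarrow> ('a \<Rightarrow> complex) \<Rightarrow> 'a \<Rightarrow> complex" where
  "partials [] f = f"
| "partials (b # bs) f = (\<lambda>x. frechet_derivative (partials bs f) (at x) b)"

definition schwartz :: "('a::euclidean_space \<Rightarrow> complex) \<Rightarrow> bool" where
  "schwartz f \<longleftrightarrow>
     (\<forall>bs. set bs \<subseteq> Basis \<longrightarrow> (\<forall>x. partials bs f differentiable (at x))) \<and>
     (\<forall>bs (k::nat). set bs \<subseteq> Basis \<longrightarrow>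
        (\<exists>C. \<forall>x. (1 + norm x) ^ k * cmod (partials bs f x) \<le> C))"

definition schwartz_seminorm :: "nat \<Rightarrow> ('a::euclidean_space \<Rightarrow> complex) \<Rightarrow> real" where
  "schwartz_seminorm M f =
     Sup {(1 + norm x) ^ M * cmod (partials bs f x) | x bs. set bs \<subseteq> Basis \<and> length bs \<le> M}"

text \<open>Tempered distributions: continuous linear functionals on the Schwartz space
  (only their values on Schwartz functions are relevant).\<close>
definition tempered :: "(('a::euclidean_space \<Rightarrow> complex) \<Rightarrow> complex) \<Rightarrow> bool" where
  "tempered T \<longleftrightarrow>
     (\<forall>f g (a::complex) b. schwartz f \<longrightarrow> schwartz g \<longrightarrow>
        T (\<lambda>x. a * f x + b * g x) = a * T f + b * T g) \<and>
     (\<exists>C M. \<forall>f. schwartz f \<longrightarrow> cmod (T f) \<le> C * schwartz_seminorm M f)"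

definition dist_of :: "('a::euclidean_space \<Rightarrow> complex) \<Rightarrow> ('a \<Rightarrow> complex) \<Rightarrow> complex" where
  "dist_of f = (\<lambda>\<psi>. \<integral>x. f x * \<psi> x \<partial>lebesgue)"

definition fourier :: "('a::euclidean_space \<Rightarrow> complex) \<Rightarrow> 'a \<Rightarrow> complex" where
  "fourier f \<xi> = (\<integral>x. f x * cis (- 2 * pi * (x \<bullet> \<xi>)) \<partial>lebesgue)"

definition admissible_pair :: "('a::euclidean_space \<Rightarrow> complex) \<Rightarrow> ('a \<Rightarrow> complex) \<Rightarrow> bool" where
  "admissible_pair \<Phi> \<phi> \<longleftrightarrow> schwartz \<Phi> \<and> schwartz \<phi> \<and>
     closure {\<xi>. fourier \<Phi> \<xi> \<noteq> 0} \<subseteq> cball 0 2 \<and>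
     (\<exists>c>0. \<forall>\<xi>. norm \<xi> \<le> 5/3 \<longrightarrow> cmod (fourier \<Phi> \<xi>) \<ge> c) \<and>
     closure {\<xi>. fourier \<phi> \<xi> \<noteq> 0} \<subseteq> cball 0 2 - ball 0 (1/2) \<and>
     (\<exists>c>0. \<forall>\<xi>. 3/5 \<le> norm \<xi> \<and> norm \<xi> \<le> 5/3 \<longrightarrow> cmod (fourier \<phi> \<xi>) \<ge> c)"

definition phi_seq :: "('a::euclidean_space \<Rightarrow> complex) \<Rightarrow> ('a \<Rightarrow> complex) \<Rightarrow> nat \<Rightarrow> 'a \<Rightarrow> complex" where
  "phi_seq \<Phi> \<phi> v = (if v = 0 then \<Phi>
      else (\<lambda>x. of_real (2 ^ (v * DIM('a))) * \<phi> ((2 ^ v) *\<^sub>R x)))"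

definition conv_dist :: "('a::euclidean_space \<Rightarrow> complex) \<Rightarrow> (('a \<Rightarrow> complex) \<Rightarrow> complex) \<Rightarrow> 'a \<Rightarrow> complex" where
  "conv_dist \<psi> T x = T (\<lambda>y. \<psi> (x - y))"

definition modular :: "('a::euclidean_space \<Rightarrow> real) \<Rightarrow> ('a \<Rightarrow> real) \<Rightarrow> ennreal" where
  "modular p g = (\<integral>\<^sup>+ x. ennreal (\<bar>g x\<bar> powr p x) \<partial>lebesgue)"

text \<open>The l^{q(.)}(L^{p(.)}) quasi-norm of a sequence (f_v)_{v >= v0}
  (terms with v < v0 are not part of the sequence).  Infima of empty sets are infinity.\<close>
definition lq_Lp :: "('a::euclidean_space \<Rightarrow> real) \<Rightarrow> ('a \<Rightarrow> real) \<Rightarrow> nat \<Rightarrow> (nat \<Rightarrow> 'a \<Rightarrow> real) \<Rightarrow> ennreal" where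
  "lq_Lp p q v0 f =
     Inf {ennreal \<mu> | \<mu>. \<mu> > 0 \<and>
       (\<Sum>v. if v0 \<le> v then
              Inf {ennreal lam | lam. lam > 0 \<and>
                 modular p (\<lambda>x. f v x / (\<mu> * lam powr (1 / q x))) \<le> 1}
            else 0) \<le> 1}"

definition dyadic_cube :: "int \<Rightarrow> ('a::euclidean_space \<Rightarrow> int) \<Rightarrow> 'a set" where
  "dyadic_cube v m = {x. \<forall>i\<in>Basis. of_int (m i) \<le> 2 powr v * (x \<bullet> i) \<and>
                                      2 powr v * (x \<bullet> i) < of_int (m i) + 1}"

text \<open>Quasi-norm of the space B^{alpha,tau}_{p,q}; for the cube P = Q_{v_P,m}:
  l(P) = 2^{-v_P}, |P| = 2^{-v_P n}, v_P^+ = max(v_P,0).\<close>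
definition besov_norm ::
  "('a::euclidean_space \<Rightarrow> real) \<Rightarrow> ('a \<Rightarrow> real) \<Rightarrow> ('a \<Rightarrow> real) \<Rightarrow> ('a \<Rightarrow> real) \<Rightarrow>
   ('a \<Rightarrow> complex) \<Rightarrow> ('a \<Rightarrow> complex) \<Rightarrow> (('a \<Rightarrow> complex) \<Rightarrow> complex) \<Rightarrow> ennreal" where
  "besov_norm \<alpha> \<tau> p q \<Phi> \<phi> T =
     (SUP (vP, m) \<in> (UNIV :: (int \<times> ('a \<Rightarrow> int)) set).
        lq_Lp p q (nat vP)
          (\<lambda>v x. 2 powr (real v * \<alpha> x) * cmod (conv_dist (phi_seq \<Phi> \<phi> v) T x)
                 * (2 powr (- real_of_int vP * real DIM('a))) powr (- \<tau> x)
                 * indicator (dyadic_cube vP m) x))"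

definition besov_space ::
  "('a::euclidean_space \<Rightarrow> real) \<Rightarrow> ('a \<Rightarrow> real) \<Rightarrow> ('a \<Rightarrow> real) \<Rightarrow> ('a \<Rightarrow> real) \<Rightarrow>
   ('a \<Rightarrow> complex) \<Rightarrow> ('a \<Rightarrow> complex) \<Rightarrow> (('a \<Rightarrow> complex) \<Rightarrow> complex) set" where
  "besov_space \<alpha> \<tau> p q \<Phi> \<phi> = {T. tempered T \<and> besov_norm \<alpha> \<tau> p q \<Phi> \<phi> T < \<infinity>}"

end

(* The Schwartz space embeds because f * phi_v decays like every power of 2^(-v): the Fourier
   transform of phi vanishes near 0, so phi is an iterated Laplacian of a Schwartz function, and
   the Laplacians fall on f. Since tau is positive and bounded, the factor |P|^(-tau) costs at
   most 2^(vC).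

   For the second embedding only the unit cubes are needed. The norm bounds phi_v * T in L^r
   over unit cubes, uniformly, for some r < 1. Reproducing the band-limited phi_v * T by
   convolution with a Schwartz function and splitting |g| = |g|^r |g|^(1-r) improves its a priori
   polynomial growth to growth of order at most 1, with a constant of the form 2^(vC) times the
   Besov norm. A telescoping Calderon formula writes a test function psi as the sum of
   phi_v(-.) * theta_v * psi; as theta_v * psi decays rapidly in v, pairing with T converges.

   Fourier inversion is needed only up to a nonzero constant, which makes Gaussians superfluous;
   convolutions are controlled through it instead of by further uses of Fubini's theorem. *)

theory Submission
  imports Defs
begin

section \<open>Schwartz calculus\<close>

text \<open>A tempered T has an order and a constant of its own, and every bound on phi_v * T drawn
  from temperedness alone depends on them. Such a bound can only tell that a supremum is finite; the
  supremum is then absorbed into itself. The iteration aims at order 1 because the exponents K (1 -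
  r)^j never reach 0 for K > 0, and linear growth is harmless against Schwartz functions. Since p is
  variable and may be smaller than 1, Holder's inequality does not lead from the Besov norm to
  values of phi_v * T. After normalisation by the norm, u^r <= 1 + u^p with r below the lower bound
  of p trades the variable exponent for a fixed one; log-Holder continuity supplies the pointwise
  bounds on alpha, 1/p and 1/q that this takes. T is linear for finite sums only, while the
  reproducing formula and the Calderon formula both need T to pass through an integral. This is
  obtained from Riemann sums that converge in a Schwartz seminorm.\<close>

definition pd :: "'a::euclidean_space \<Rightarrow> ('a \<Rightarrow> complex) \<Rightarrow> 'a \<Rightarrow> complex" where
  "pd b f = (\<lambda>x. frechet_derivative f (at x) b)"

definition smooth :: "('a::euclidean_space \<Rightarrow> complex) \<Rightarrow> bool" where
  "smooth f \<longleftrightarrow> (\<forall>bs. set bs \<subseteq> Basis \<longrightarrow> partials bs f differentiable_on UNIV)"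

definition rapid :: "('a::euclidean_space \<Rightarrow> complex) \<Rightarrow> bool" where
  "rapid f \<longleftrightarrow> (\<forall>k::nat. \<exists>C. \<forall>x. (1 + norm x) ^ k * cmod (f x) \<le> C)"

lemma schwartz_iff:
  "schwartz f \<longleftrightarrow> (\<forall>bs. set bs \<subseteq> Basis \<longrightarrow> partials bs f differentiable_on UNIV \<and> rapid (partials bs f))"
  unfolding schwartz_def rapid_def differentiable_on_def by auto

lemma partials_Cons: "partials (b # bs) f = pd b (partials bs f)"
  by (simp add: pd_def)

lemma partials_append: "partials (bs @ cs) f = partials bs (partials cs f)"
  by (induction bs) auto

lemma partials_snoc: "partials (bs @ [b]) f = partials bs (pd b f)"
  by (simp add: partials_append pd_def)

lemma partials_closed:
  assumes "P f" "\<And>g b. P g \<Longrightarrow> b \<in> Basis \<Longrightarrow> P (pd b g)" "set bs \<subseteq> Basis"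
  shows "P (partials bs f)"
  using assms(3) by (induction bs) (auto simp: assms partials_Cons simp del: partials.simps(2))

text \<open>Closure results are proved by exhibiting a class stable under one coordinate derivative,
  in place of a Leibniz or chain rule for a whole list \<open>bs\<close>.\<close>

lemma schwartz_coinduct:
  assumes "P f" "\<And>g b. P g \<Longrightarrow> b \<in> Basis \<Longrightarrow> P (pd b g)"
    and "\<And>g. P g \<Longrightarrow> g differentiable_on UNIV" "\<And>g. P g \<Longrightarrow> rapid g"
  shows "schwartz f"
  unfolding schwartz_iff using partials_closed[of P f, OF assms(1,2)] assms(3,4) by blast

lemma smooth_coinduct:
  assumes "P f" "\<And>g b. P g \<Longrightarrow> b \<in> Basis \<Longrightarrow> P (pd b g)"
    and "\<And>g. P g \<Longrightarrow> g differentiable_on UNIV"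
  shows "smooth f"
  unfolding smooth_def using partials_closed[of P f, OF assms(1,2)] assms(3) by blast

lemma schwartz_partials: "schwartz f \<Longrightarrow> set bs \<subseteq> Basis \<Longrightarrow> schwartz (partials bs f)"
  unfolding schwartz_iff by (metis partials_append set_append le_sup_iff)

lemma schwartz_pd: "schwartz f \<Longrightarrow> b \<in> Basis \<Longrightarrow> schwartz (pd b f)"
  using schwartz_partials[of f "[b]"] by (simp add: pd_def)

lemma smooth_pd: "smooth f \<Longrightarrow> b \<in> Basis \<Longrightarrow> smooth (pd b f)"
  unfolding smooth_def by (metis Un_insert_right empty_set insert_subset list.simps(15)
      partials_snoc set_append sup_bot_right)

lemma schwartz_smooth: "schwartz f \<Longrightarrow> smooth f"
  unfolding schwartz_iff smooth_def by auto

lemma smooth_differentiable: "smooth f \<Longrightarrow> f differentiable_on UNIV"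
  unfolding smooth_def by (metis empty_set empty_subsetI partials.simps(1))

lemma schwartz_differentiable: "schwartz f \<Longrightarrow> f differentiable_on UNIV"
  by (simp add: schwartz_smooth smooth_differentiable)

lemma schwartz_rapid: "schwartz f \<Longrightarrow> rapid f"
  unfolding schwartz_iff by (metis empty_set empty_subsetI partials.simps(1))

lemma smooth_cont: "smooth f \<Longrightarrow> continuous_on UNIV f"
  by (simp add: differentiable_imp_continuous_on smooth_differentiable)

lemma schwartz_cont: "schwartz f \<Longrightarrow> continuous_on UNIV f"
  by (simp add: schwartz_smooth smooth_cont)

lemma has_frechet_derivative:
  assumes "f differentiable_on UNIV"
  shows "(f has_derivative frechet_derivative f (at x)) (at x)"
  using assms by (metis UNIV_I differentiable_on_def frechet_derivative_works)

section \<open>Rules for coordinate derivatives\<close>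

lemma pd_eq: "(\<And>x. (f has_derivative f' x) (at x)) \<Longrightarrow> pd b f = (\<lambda>x. f' x b)"
  unfolding pd_def using frechet_derivative_at by metis

lemma pd_const: "pd b (\<lambda>x. c) = (\<lambda>x. 0)"
  by (rule pd_eq[where f'="\<lambda>x h. 0"]) auto

lemma pd_add:
  assumes "f differentiable_on UNIV" "g differentiable_on UNIV"
  shows "pd b (\<lambda>x. f x + g x) = (\<lambda>x. pd b f x + pd b g x)"
  unfolding pd_def[of _ f] pd_def[of _ g]
  by (rule pd_eq[OF has_derivative_add[OF has_frechet_derivative[OF assms(1)] has_frechet_derivative[OF assms(2)]]])

lemma pd_mult:
  assumes "f differentiable_on UNIV" "g differentiable_on UNIV"
  shows "pd b (\<lambda>x. f x * g x) = (\<lambda>x. f x * pd b g x + pd b f x * g x)"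
  unfolding pd_def[of _ f] pd_def[of _ g]
  by (rule pd_eq[OF has_derivative_mult[OF has_frechet_derivative[OF assms(1)] has_frechet_derivative[OF assms(2)]]])

lemma pd_cmult:
  assumes "f differentiable_on UNIV"
  shows "pd b (\<lambda>x. c * f x) = (\<lambda>x. c * pd b f x)"
  using pd_mult[of "\<lambda>x. c", OF _ assms] by (simp add: pd_const)

text \<open>Covers translations, dilations and reflections at once.\<close>

lemma pd_affine:
  assumes "f differentiable_on UNIV"
  shows "pd b (\<lambda>x. f (t + a *\<^sub>R x)) = (\<lambda>x. of_real a * pd b f (t + a *\<^sub>R x))"
    and "(\<lambda>x. f (t + a *\<^sub>R x)) differentiable_on UNIV"
proof -
  have *: "((\<lambda>x. f (t + a *\<^sub>R x)) has_derivative (\<lambda>h. frechet_derivative f (at (t + a *\<^sub>R x)) (a *\<^sub>R h))) (at x)" for x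
    by (rule has_derivative_compose[of "\<lambda>x. t + a *\<^sub>R x" "\<lambda>h. a *\<^sub>R h" x UNIV f, OF _ has_frechet_derivative[OF assms]])
       (auto intro!: derivative_eq_intros)
  show "(\<lambda>x. f (t + a *\<^sub>R x)) differentiable_on UNIV"
    using * by (auto simp: differentiable_on_def differentiable_def)
  have "frechet_derivative f (at (t + a *\<^sub>R x)) (a *\<^sub>R b) = of_real a * frechet_derivative f (at (t + a *\<^sub>R x)) b" for x
    using linear_scale[OF has_derivative_linear[OF has_frechet_derivative[OF assms]]] by (simp add: scaleR_conv_of_real)
  then show "pd b (\<lambda>x. f (t + a *\<^sub>R x)) = (\<lambda>x. of_real a * pd b f (t + a *\<^sub>R x))"
    using pd_eq[OF *, of b] by (simp add: pd_def)
qed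

lemma pd_cnj:
  assumes "f differentiable_on UNIV"
  shows "pd b (\<lambda>x. cnj (f x)) = (\<lambda>x. cnj (pd b f x))"
    and "(\<lambda>x. cnj (f x)) differentiable_on UNIV"
proof -
  have *: "((\<lambda>x. cnj (f x)) has_derivative (\<lambda>h. cnj (frechet_derivative f (at x) h))) (at x)" for x
    using bounded_linear.has_derivative[OF bounded_linear_cnj has_frechet_derivative[OF assms]] .
  show "(\<lambda>x. cnj (f x)) differentiable_on UNIV"
    using * by (auto simp: differentiable_on_def differentiable_def)
  show "pd b (\<lambda>x. cnj (f x)) = (\<lambda>x. cnj (pd b f x))"
    using pd_eq[OF *, of b] by (simp add: pd_def)
qed

text \<open>For smoothness it is enough that the derivatives of the generators lie in the algebra
  generated by them.\<close>

inductive_set alg :: "('a::euclidean_space \<Rightarrow> complex) set \<Rightarrow> ('a \<Rightarrow> complex) set" for A where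
  gen: "f \<in> A \<Longrightarrow> f \<in> alg A"
| add: "f \<in> alg A \<Longrightarrow> g \<in> alg A \<Longrightarrow> (\<lambda>x. f x + g x) \<in> alg A"
| mult: "f \<in> alg A \<Longrightarrow> g \<in> alg A \<Longrightarrow> (\<lambda>x. f x * g x) \<in> alg A"

lemma smooth_alg:
  assumes d: "\<And>g. g \<in> A \<Longrightarrow> g differentiable_on UNIV"
    and p: "\<And>g b. g \<in> A \<Longrightarrow> b \<in> Basis \<Longrightarrow> pd b g \<in> alg A"
    and f: "f \<in> alg A"
  shows "smooth f"
proof -
  have D: "g differentiable_on UNIV" if "g \<in> alg A" for g
    using that by induction (auto intro: d)
  have "pd b g \<in> alg A" if "g \<in> alg A" "b \<in> Basis" for g b
    using that
  proof induction
    case (add f g)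
    then show ?case by (simp add: pd_add D alg.add)
  next
    case (mult f g)
    then show ?case by (simp add: pd_mult D alg.add alg.mult)
  qed (rule p)
  from smooth_coinduct[of "\<lambda>g. g \<in> alg A", OF f this D] show ?thesis by blast
qed

section \<open>Closure properties of smooth functions\<close>

lemma smooth_const: "smooth (\<lambda>x. c)"
  by (rule smooth_coinduct[of "\<lambda>g. \<exists>c. g = (\<lambda>x. c)"]) (auto simp: pd_const)

lemma smooth_of_alg: "f \<in> alg (Collect smooth) \<Longrightarrow> smooth f"
  by (rule smooth_alg) (auto intro: smooth_differentiable smooth_pd alg.gen)

lemma smooth_add: "smooth f \<Longrightarrow> smooth g \<Longrightarrow> smooth (\<lambda>x. f x + g x)"
  by (rule smooth_of_alg) (auto intro: alg.intros)

lemma smooth_mult: "smooth f \<Longrightarrow> smooth g \<Longrightarrow> smooth (\<lambda>x. f x * g x)"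
  by (rule smooth_of_alg) (auto intro: alg.intros)

lemma smooth_sum: "(\<And>i. i \<in> I \<Longrightarrow> smooth (f i)) \<Longrightarrow> smooth (\<lambda>x. \<Sum>i\<in>I. f i x)"
  by (induction I rule: infinite_finite_induct) (auto intro: smooth_add smooth_const)

lemma smooth_cnj: "smooth f \<Longrightarrow> smooth (\<lambda>x. cnj (f x))"
  by (rule smooth_coinduct[of "\<lambda>g. \<exists>h. smooth h \<and> g = (\<lambda>x. cnj (h x))"])
     (auto simp: pd_cnj smooth_differentiable intro: smooth_pd)

text \<open>1/w joins the smooth functions as one extra generator: its derivative -(1/w)^2 w' is
  again a polynomial in 1/w and smooth functions, although 1/w is not yet known to be
  smooth.\<close>

lemma smooth_inverse:
  assumes w: "smooth w" "\<And>x. w x \<noteq> 0"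
  shows "smooth (\<lambda>x. inverse (w x))"
proof (rule smooth_alg[of "insert (\<lambda>x. inverse (w x)) (Collect smooth)"])
  have *: "((\<lambda>x. inverse (w x)) has_derivative
      (\<lambda>h. - (inverse (w x) * frechet_derivative w (at x) h * inverse (w x)))) (at x)" for x
    by (rule Deriv.has_derivative_inverse[OF w(2) has_frechet_derivative[OF smooth_differentiable[OF w(1)]]])
  have e: "pd b (\<lambda>x. inverse (w x)) = (\<lambda>x. (inverse (w x) * inverse (w x)) * (- 1 * pd b w x))" for b
    using pd_eq[OF *, of b] by (simp add: pd_def algebra_simps)
  let ?A = "insert (\<lambda>x. inverse (w x)) (Collect smooth)"
  show "pd b g \<in> alg ?A" if "g \<in> ?A" "b \<in> Basis" for g b
  proof (cases "smooth g")
    case True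
    then show ?thesis using that by (auto intro!: alg.gen smooth_pd)
  next
    case False
    with that have [simp]: "g = (\<lambda>x. inverse (w x))" by auto
    show ?thesis unfolding \<open>g = _\<close> e
      by (intro alg.mult alg.gen insertI1 insertI2) (use that in \<open>auto intro!: smooth_mult[OF smooth_const, of _ "-1", simplified] smooth_pd w\<close>)
  qed
  show "g differentiable_on UNIV" if "g \<in> ?A" for g
  proof -
    have "(\<lambda>x. inverse (w x)) differentiable_on UNIV"
      using * by (auto simp: differentiable_on_def differentiable_def)
    then show ?thesis using that by (auto simp: smooth_differentiable)
  qed
qed (rule alg.gen, simp)

lemma smooth_inner: "smooth (\<lambda>x. of_real (x \<bullet> b))"
proof (rule smooth_alg[of "insert (\<lambda>x. of_real (x \<bullet> b)) (Collect smooth)"])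
  have *: "((\<lambda>x. complex_of_real (x \<bullet> b)) has_derivative (\<lambda>h. of_real (h \<bullet> b))) (at x)" for x
    by (auto intro!: derivative_eq_intros)
  fix g :: "'a \<Rightarrow> complex" and c :: 'a
  assume g: "g \<in> insert (\<lambda>x. of_real (x \<bullet> b)) (Collect smooth)"
  have "(\<lambda>x. complex_of_real (x \<bullet> b)) differentiable_on UNIV"
    using * by (auto simp: differentiable_on_def differentiable_def)
  then show "g differentiable_on UNIV" using g by (auto simp: smooth_differentiable)
  show "c \<in> Basis \<Longrightarrow> pd c g \<in> alg (insert (\<lambda>x. of_real (x \<bullet> b)) (Collect smooth))"
    using g pd_eq[OF *, of c] by (auto intro!: alg.gen intro: smooth_pd smooth_const)
qed (rule alg.gen, simp)

lemma smooth_norm_square: "smooth (\<lambda>x. of_real ((norm x)\<^sup>2))"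
proof -
  have "(\<lambda>x::'a. complex_of_real ((norm x)\<^sup>2)) = (\<lambda>x. \<Sum>b\<in>Basis. of_real (x \<bullet> b) * of_real (x \<bullet> b))"
    by (simp add: power2_norm_eq_inner euclidean_inner[of x x for x::'a])
  then show ?thesis by (auto intro!: smooth_sum smooth_mult smooth_inner)
qed

section \<open>Rapid decay and closure properties of the Schwartz space\<close>

lemma rapid_bound:
  assumes "rapid f" obtains C where "0 \<le> C" "\<And>x. cmod (f x) \<le> C / (1 + norm x) ^ k"
proof -
  obtain C where C: "\<And>x. (1 + norm x) ^ k * cmod (f x) \<le> C" using assms unfolding rapid_def by blast
  have "0 \<le> C" using order_trans[OF _ C[of 0]] by simp
  moreover have "cmod (f x) \<le> C / (1 + norm x) ^ k" for x
    using C[of x] by (simp add: field_simps add_pos_nonneg)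
  ultimately show ?thesis using that by blast
qed

lemma rapidI:
  assumes "\<And>k. \<exists>C. \<forall>x. cmod (f x) \<le> C / (1 + norm x) ^ k"
  shows "rapid f"
  unfolding rapid_def
proof
  fix k
  obtain C where "\<And>x. cmod (f x) \<le> C / (1 + norm x) ^ k" using assms by blast
  then show "\<exists>C. \<forall>x. (1 + norm x) ^ k * cmod (f x) \<le> C"
    by (intro exI[of _ C]) (simp add: field_simps add_pos_nonneg)
qed

lemma rapid_add:
  assumes "rapid f" "rapid g" shows "rapid (\<lambda>x. f x + g x)"
proof (rule rapidI)
  fix k
  obtain C D where "\<And>x. cmod (f x) \<le> C / (1 + norm x) ^ k" "\<And>x. cmod (g x) \<le> D / (1 + norm x) ^ k"
    using rapid_bound assms by metis
  then have "cmod (f x + g x) \<le> (C + D) / (1 + norm x) ^ k" for x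
    by (metis add_divide_distrib add_mono norm_triangle_le)
  then show "\<exists>C. \<forall>x. cmod (f x + g x) \<le> C / (1 + norm x) ^ k" by blast
qed

lemma rapid_mult:
  assumes "rapid f" "\<And>x. cmod (g x) \<le> D * (1 + norm x) ^ d" "0 \<le> D"
  shows "rapid (\<lambda>x. f x * g x)"
proof (rule rapidI)
  fix k
  \<comment> \<open>The d extra powers of decay of \<open>f\<close> pay for the growth of
    \<open>g\<close>.\<close>
  obtain C where C: "0 \<le> C" "\<And>x. cmod (f x) \<le> C / (1 + norm x) ^ (k + d)"
    using rapid_bound assms(1) by metis
  have "cmod (f x * g x) \<le> C * D / (1 + norm x) ^ k" for x
  proof -
    have "cmod (f x * g x) \<le> C / (1 + norm x) ^ (k + d) * (D * (1 + norm x) ^ d)"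
      unfolding norm_mult by (intro mult_mono C assms divide_nonneg_nonneg) auto
    also have "\<dots> = C * D / (1 + norm x) ^ k"
      by (simp add: power_add field_simps add_nonneg_eq_0_iff)
    finally show ?thesis .
  qed
  then show "\<exists>C. \<forall>x. cmod (f x * g x) \<le> C / (1 + norm x) ^ k" by blast
qed

lemma rapid_mult_rapid:
  assumes "rapid f" "rapid g" shows "rapid (\<lambda>x. f x * g x)"
proof -
  obtain D where "0 \<le> D" "\<And>x. cmod (g x) \<le> D / (1 + norm x) ^ 0"
    using rapid_bound assms(2) by metis
  then show ?thesis using rapid_mult[OF assms(1), of g D 0] by simp
qed

text \<open>The Leibniz rule turns a product into a sum of two products, so products alone are not
  stable under \<open>pd\<close>, but finite sums of products of two Schwartz functions are. The
  rule \<open>single\<close> lets the same induction give closure under sums.\<close>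

inductive prods :: "('a::euclidean_space \<Rightarrow> complex) \<Rightarrow> bool" where
  single: "schwartz f \<Longrightarrow> prods f"
| prod: "schwartz f \<Longrightarrow> schwartz g \<Longrightarrow> prods (\<lambda>x. f x * g x)"
| add: "prods f \<Longrightarrow> prods g \<Longrightarrow> prods (\<lambda>x. f x + g x)"

lemma schwartz_prods:
  assumes "prods h" shows "schwartz h"
proof (rule schwartz_coinduct[of prods])
  show d: "h differentiable_on UNIV" if "prods h" for h
    using that by induction (simp_all add: differentiable_on_mult differentiable_on_add schwartz_differentiable)
  show "prods (pd b h)" if "prods h" "b \<in> Basis" for h b
    using that
  proof induction
    case (single f)
    then show ?case by (simp add: prods.single schwartz_pd)
  next
    case (prod f g)
    then show ?case by (simp add: pd_mult schwartz_differentiable prods.add prods.prod schwartz_pd)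
  next
    case (add f g)
    then show ?case by (simp add: pd_add d prods.add)
  qed
  show "rapid h" if "prods h" for h
    using that by induction (simp_all add: rapid_mult_rapid rapid_add schwartz_rapid)
qed (rule assms)

lemma schwartz_add: "schwartz f \<Longrightarrow> schwartz g \<Longrightarrow> schwartz (\<lambda>x. f x + g x)"
  using schwartz_prods[OF prods.add[OF prods.single prods.single]] by blast

lemma schwartz_mult: "schwartz f \<Longrightarrow> schwartz g \<Longrightarrow> schwartz (\<lambda>x. f x * g x)"
  using schwartz_prods[OF prods.prod] by blast

lemma schwartz_cmult:
  fixes f :: "'a::euclidean_space \<Rightarrow> complex"
  assumes "schwartz f" shows "schwartz (\<lambda>x. c * f x)"
proof (rule schwartz_coinduct[of "\<lambda>h. \<exists>f. schwartz f \<and> h = (\<lambda>x. c * f x)"])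
  fix h assume "\<exists>f. schwartz f \<and> h = (\<lambda>x. c * f x)"
  then obtain f where f: "schwartz f" "h = (\<lambda>x. f x * c)" by (auto simp: mult.commute)
  show "rapid h" unfolding f(2) by (rule rapid_mult[OF schwartz_rapid[OF f(1)], of _ "cmod c" 0]) auto
next
  fix h :: "'a \<Rightarrow> complex" and b :: 'a assume "\<exists>f. schwartz f \<and> h = (\<lambda>x. c * f x)" "b \<in> Basis"
  then show "\<exists>f. schwartz f \<and> pd b h = (\<lambda>x. c * f x)"
    by (auto simp: pd_cmult schwartz_differentiable intro: schwartz_pd)
qed (use assms in \<open>auto intro!: differentiable_on_mult differentiable_on_const intro: schwartz_differentiable\<close>)

lemma schwartz_0: "schwartz (\<lambda>x. 0)"
  by (rule schwartz_coinduct[of "\<lambda>h. h = (\<lambda>x. 0)"]) (auto simp: pd_const rapid_def)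

lemma schwartz_minus: "schwartz f \<Longrightarrow> schwartz (\<lambda>x. - f x)"
  using schwartz_cmult[of f "-1"] by simp

lemma schwartz_diff: "schwartz f \<Longrightarrow> schwartz g \<Longrightarrow> schwartz (\<lambda>x. f x - g x)"
  using schwartz_add[of f "\<lambda>x. - g x"] schwartz_minus[of g] by simp

lemma schwartz_sum: "(\<And>i. i \<in> I \<Longrightarrow> schwartz (f i)) \<Longrightarrow> schwartz (\<lambda>x. \<Sum>i\<in>I. f i x)"
  by (induction I rule: infinite_finite_induct) (auto intro: schwartz_add schwartz_0)

lemma schwartz_cnj:
  fixes f :: "'a::euclidean_space \<Rightarrow> complex"
  shows "schwartz f \<Longrightarrow> schwartz (\<lambda>x. cnj (f x))"
proof (rule schwartz_coinduct[of "\<lambda>g. \<exists>h. schwartz h \<and> g = (\<lambda>x. cnj (h x))"])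
  fix h :: "'a \<Rightarrow> complex" assume "\<exists>f. schwartz f \<and> h = (\<lambda>x. cnj (f x))"
  then show "rapid h" unfolding rapid_def using schwartz_rapid[unfolded rapid_def] by fastforce
qed (auto simp: pd_cnj schwartz_differentiable intro: schwartz_pd)

text \<open>The affine map is inverted here: decay in t + a x has to be read as decay in x, with a
  loss depending only on t and a.\<close>

lemma norm_affine_le:
  "a \<noteq> 0 \<Longrightarrow> 1 + norm x \<le> (1 + norm (t::'a::euclidean_space)) * (1 + 1 / \<bar>a\<bar>) * (1 + norm (t + a *\<^sub>R x))"
proof -
  assume a: "a \<noteq> 0"
  have "\<bar>a\<bar> * norm x = norm ((t + a *\<^sub>R x) - t)" by simp
  also have "\<dots> \<le> norm (t + a *\<^sub>R x) + norm t" by (rule norm_triangle_ineq4)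
  finally have "norm x \<le> (norm (t + a *\<^sub>R x) + norm t) / \<bar>a\<bar>" using a by (simp add: field_simps)
  moreover have "(1 + norm t) * (1 + norm (t + a *\<^sub>R x)) \<ge> norm (t + a *\<^sub>R x) + norm t" 
    "(1 + norm t) * (1 + norm (t + a *\<^sub>R x)) \<ge> 1"
    by (simp_all add: algebra_simps)
  ultimately have "norm x \<le> (1 + norm t) * (1 + norm (t + a *\<^sub>R x)) / \<bar>a\<bar>"
    by (meson divide_right_mono abs_ge_zero order_trans)
  with \<open>(1 + norm t) * (1 + norm (t + a *\<^sub>R x)) \<ge> 1\<close>
  have "1 + norm x \<le> (1 + norm t) * (1 + norm (t + a *\<^sub>R x)) + (1 + norm t) * (1 + norm (t + a *\<^sub>R x)) / \<bar>a\<bar>"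
    by linarith
  also have "\<dots> = (1 + norm t) * (1 + 1 / \<bar>a\<bar>) * (1 + norm (t + a *\<^sub>R x))"
    using a by (simp add: field_simps)
  finally show ?thesis .
qed

lemma rapid_affine:
  assumes "rapid f" "a \<noteq> 0" shows "rapid (\<lambda>x. f (t + a *\<^sub>R x))"
proof (rule rapidI)
  fix k
  obtain C where C: "0 \<le> C" "\<And>x. cmod (f x) \<le> C / (1 + norm x) ^ k" using rapid_bound assms(1) by metis
  define D where "D = (1 + norm t) * (1 + 1 / \<bar>a\<bar>)"
  have D: "D > 0" unfolding D_def by (simp add: add_pos_nonneg)
  have "cmod (f (t + a *\<^sub>R x)) \<le> C * D ^ k / (1 + norm x) ^ k" for x
  proof -
    have "(1 + norm x) ^ k \<le> (D * (1 + norm (t + a *\<^sub>R x))) ^ k"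
      unfolding D_def using norm_affine_le[OF assms(2), of x t] by (intro power_mono) auto
    then have "C * (1 + norm x) ^ k \<le> C * D ^ k * (1 + norm (t + a *\<^sub>R x)) ^ k"
      using C(1) by (simp add: power_mult_distrib mult_left_mono mult.assoc)
    then have "C / (1 + norm (t + a *\<^sub>R x)) ^ k \<le> C * D ^ k / (1 + norm x) ^ k"
      by (simp add: field_simps add_pos_nonneg)
    then show ?thesis using C(2) order_trans by blast
  qed
  then show "\<exists>C. \<forall>x. cmod (f (t + a *\<^sub>R x)) \<le> C / (1 + norm x) ^ k" by blast
qed

lemma schwartz_affine: "schwartz f \<Longrightarrow> a \<noteq> 0 \<Longrightarrow> schwartz (\<lambda>x. f (t + a *\<^sub>R x))"
proof (rule schwartz_coinduct[of "\<lambda>g. \<exists>h. schwartz h \<and> g = (\<lambda>x. h (t + a *\<^sub>R x))"])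
  fix g and b :: 'a assume "\<exists>h. schwartz h \<and> g = (\<lambda>x. h (t + a *\<^sub>R x))" "b \<in> Basis"
  then obtain h where h: "schwartz h" "g = (\<lambda>x. h (t + a *\<^sub>R x))" by auto
  then show "\<exists>h. schwartz h \<and> pd b g = (\<lambda>x. h (t + a *\<^sub>R x))"
    by (intro exI[of _ "\<lambda>x. of_real a * pd b h x"])
       (simp add: pd_affine schwartz_differentiable schwartz_cmult schwartz_pd \<open>b \<in> Basis\<close>)
qed (auto simp: pd_affine schwartz_differentiable intro: rapid_affine schwartz_rapid)

lemma schwartz_shift: "schwartz f \<Longrightarrow> schwartz (\<lambda>x. f (x + t))"
  using schwartz_affine[of f 1 t] by (simp add: add.commute)

lemma schwartz_reflect: "schwartz f \<Longrightarrow> schwartz (\<lambda>x. f (t - x))"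
  using schwartz_affine[of f "-1" t] by simp

text \<open>Differentiating the coordinate leaves a multiple of f without its coordinate factor, so
  the invariant class consists of coordinate multiples plus an arbitrary Schwartz function.\<close>

lemma schwartz_coord:
  fixes f :: "'a::euclidean_space \<Rightarrow> complex"
  assumes "schwartz f" shows "schwartz (\<lambda>x. of_real (x \<bullet> c) * f x)"
proof (rule schwartz_coinduct[of "\<lambda>h. \<exists>f g. schwartz f \<and> schwartz g \<and> h = (\<lambda>x. of_real (x \<bullet> c) * f x + g x)"])
  have d: "((\<lambda>x. complex_of_real (x \<bullet> c)) has_derivative (\<lambda>h. of_real (h \<bullet> c))) (at x)" for x
    by (auto intro!: derivative_eq_intros)
  have D: "(\<lambda>x. complex_of_real (x \<bullet> c)) differentiable_on UNIV"
    using d by (auto simp: differentiable_on_def differentiable_def)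
  fix h assume "\<exists>f g. schwartz f \<and> schwartz g \<and> h = (\<lambda>x. of_real (x \<bullet> c) * f x + g x)"
  then obtain f g where h: "schwartz f" "schwartz g" "h = (\<lambda>x. of_real (x \<bullet> c) * f x + g x)" by auto
  have D2: "(\<lambda>x. complex_of_real (x \<bullet> c) * f x) differentiable_on UNIV"
    by (rule differentiable_on_mult[OF D schwartz_differentiable[OF h(1)]])
  then show "h differentiable_on UNIV" unfolding h(3) by (rule differentiable_on_add[OF _ schwartz_differentiable[OF h(2)]])
  have "rapid (\<lambda>x. f x * of_real (x \<bullet> c))"
  proof (rule rapid_mult[OF schwartz_rapid[OF h(1)], of _ "norm c" 1])
    fix x :: 'a
    have "\<bar>x \<bullet> c\<bar> \<le> norm x * norm c" by (rule Cauchy_Schwarz_ineq2)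
    also have "\<dots> \<le> (1 + norm x) * norm c" by (intro mult_right_mono) auto
    finally show "cmod (of_real (x \<bullet> c)) \<le> norm c * (1 + norm x) ^ 1" by (simp add: mult.commute)
  qed simp
  then show "rapid h" unfolding h(3) using rapid_add[OF _ schwartz_rapid[OF h(2)]] by (simp add: mult.commute)
  fix b :: 'a assume b: "b \<in> Basis"
  have "pd b h = (\<lambda>x. of_real (x \<bullet> c) * pd b f x + (of_real (b \<bullet> c) * f x + pd b g x))"
    unfolding h(3) by (subst pd_add[OF D2 schwartz_differentiable[OF h(2)]], subst pd_mult[OF D schwartz_differentiable[OF h(1)]])
      (simp add: pd_eq[OF d] algebra_simps)
  then show "\<exists>f g. schwartz f \<and> schwartz g \<and> pd b h = (\<lambda>x. of_real (x \<bullet> c) * f x + g x)"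
    using schwartz_pd[OF h(1) b] schwartz_add[OF schwartz_cmult[OF h(1)] schwartz_pd[OF h(2) b]] by blast
next
  show "\<exists>fa g. schwartz fa \<and> schwartz g \<and> (\<lambda>x. complex_of_real (x \<bullet> c) * f x) = (\<lambda>x. of_real (x \<bullet> c) * fa x + g x)"
    by (intro exI[of _ f] exI[of _ "\<lambda>x. 0"]) (simp add: assms schwartz_0)
qed

text \<open>The strict inequality makes the exterior region open, so vanishing there passes to all
  derivatives. The weighted bounds come from compactness of the closed ball.\<close>

lemma schwartz_compact_support:
  assumes "smooth f" "\<And>x. R < norm x \<Longrightarrow> f x = 0"
  shows "schwartz f"
proof (rule schwartz_coinduct[of "\<lambda>g. smooth g \<and> (\<forall>x. R < norm x \<longrightarrow> g x = 0)"])
  fix g :: "'a \<Rightarrow> complex" assume g: "smooth g \<and> (\<forall>x. R < norm x \<longrightarrow> g x = 0)"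
  then show "g differentiable_on UNIV" by (simp add: smooth_differentiable)
  have "open {x::'a. R < norm x}" by (intro open_Collect_less continuous_intros)
  then have z: "(g has_derivative (\<lambda>h. 0)) (at x)" if "R < norm x" for x
    using g that has_derivative_transform_within_open[of "\<lambda>x. 0" "\<lambda>h. 0" x UNIV "{x. R < norm x}" g] by auto
  fix b :: 'a assume "b \<in> Basis"
  then show "smooth (pd b g) \<and> (\<forall>x. R < norm x \<longrightarrow> pd b g x = 0)"
    using g frechet_derivative_at[OF z, symmetric] by (simp add: smooth_pd) (simp add: pd_def)
next
  fix g :: "'a \<Rightarrow> complex" assume g: "smooth g \<and> (\<forall>x. R < norm x \<longrightarrow> g x = 0)"
  have "compact (g ` cball 0 R)"
    by (intro compact_continuous_image continuous_on_subset[OF smooth_cont]) (use g in auto)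
  then obtain B where "\<And>y. y \<in> g ` cball 0 R \<Longrightarrow> cmod y \<le> B" using compact_imp_bounded bounded_iff by metis
  then have B: "cmod (g x) \<le> max B 0" for x
    using g by (cases "norm x \<le> R") fastforce+
  \<comment> \<open>The absolute value keeps the bound meaningful for negative R, where
    \<open>g\<close> vanishes everywhere.\<close>
  have "cmod (g x) \<le> max B 0 * (1 + \<bar>R\<bar>) ^ k / (1 + norm x) ^ k" for x k
  proof (cases "norm x \<le> R")
    case True
    then have "cmod (g x) * (1 + norm x) ^ k \<le> max B 0 * (1 + \<bar>R\<bar>) ^ k"
      by (intro mult_mono B power_mono) auto
    then show ?thesis by (simp add: field_simps add_pos_nonneg)
  qed (use g in auto)
  then show "rapid g" by (intro rapidI) blast
qed (use assms in auto)

section \<open>The Fourier transform on the Schwartz space\<close>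

text \<open>On the shell k <= |x| < 1 + k the integrand is at most (1 + k)^-(n+2), and the shell
  lies in a ball of volume proportional to (1 + k)^n. The dominating series has terms of size (1 +
  k)^-2; this crude comparison is the origin of the exponent n + 2 used throughout.\<close>

lemma decay_integrable:
  "integrable lborel (\<lambda>x::'a::euclidean_space. 1 / (1 + norm x) ^ (DIM('a) + 2))"
proof (rule integrableI_bounded)
  let ?n = "DIM('a)"
  let ?f = "\<lambda>k x::'a. ennreal (1 / (1 + real k) ^ (?n + 2)) * indicator (ball 0 (1 + real k)) x"
  have le: "ennreal (norm (1 / (1 + norm x) ^ (?n + 2))) \<le> (\<Sum>k. ?f k x)" for x :: 'a
  proof -
    define k where "k = nat \<lfloor>norm x\<rfloor>"
    have k: "real k \<le> norm x" "norm x < 1 + real k" unfolding k_def using norm_ge_zero[of x] by (auto simp: of_nat_nat intro: floor_correct[THEN conjunct1]) linarith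
    have "ennreal (norm (1 / (1 + norm x) ^ (?n + 2))) \<le> ?f k x"
      using k by (auto intro!: ennreal_leI divide_left_mono power_mono mult_pos_pos zero_less_power
          simp: add_pos_nonneg simp del: power_Suc)
    also have "\<dots> = (\<Sum>i\<in>{k}. ?f i x)"
      by (simp only: sum.insert finite.emptyI empty_iff sum.empty add_0_right not_False_eq_True)
    also have "\<dots> \<le> (\<Sum>k. ?f k x)" by (rule sum_le_suminf) auto
    finally show ?thesis .
  qed
  have "(\<integral>\<^sup>+x. ennreal (norm (1 / (1 + norm x) ^ (?n + 2))) \<partial>(lborel :: 'a measure)) \<le> (\<integral>\<^sup>+x. (\<Sum>k. ?f k x) \<partial>lborel)"
    by (intro nn_integral_mono le)
  also have "\<dots> = (\<Sum>k. \<integral>\<^sup>+x. ?f k x \<partial>lborel)"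
    by (rule nn_integral_suminf) (intro borel_measurable_times_ennreal borel_measurable_const borel_measurable_indicator, simp)
  also have "\<dots> = (\<Sum>k. ennreal (unit_ball_vol ?n * (1 / (1 + real k) ^ 2)))"
  proof (intro suminf_cong)
    fix k
    have "(\<integral>\<^sup>+x. ?f k x \<partial>lborel) = ennreal (1 / (1 + real k) ^ (?n + 2)) * ennreal (unit_ball_vol ?n * (1 + real k) ^ ?n)"
      by (subst nn_integral_cmult_indicator) (simp_all only: sets_lborel, simp_all only: borel_open open_ball, simp add: emeasure_ball)
    also have "\<dots> = ennreal (1 / (1 + real k) ^ (?n + 2) * (unit_ball_vol ?n * (1 + real k) ^ ?n))"
      by (rule ennreal_mult[symmetric]) auto
    also have "1 / (1 + real k) ^ (?n + 2) * (unit_ball_vol ?n * (1 + real k) ^ ?n) = unit_ball_vol ?n * (1 / (1 + real k) ^ 2)"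
      by (simp only: power_add) (simp add: add_nonneg_eq_0_iff)
    finally show "(\<integral>\<^sup>+x. ?f k x \<partial>lborel) = ennreal (unit_ball_vol ?n * (1 / (1 + real k) ^ 2))" .
  qed
  also have "\<dots> < \<infinity>"
  proof -
    have "summable (\<lambda>k. 1 / (1 + real k) ^ 2)"
      using inverse_power_summable[of 2, where 'a=real] summable_Suc_iff[of "\<lambda>n. inverse (real n ^ 2)"]
      by (simp add: field_simps)
    then have "summable (\<lambda>k. unit_ball_vol ?n * (1 / (1 + real k) ^ 2))" by (rule summable_mult)
    then show ?thesis
      by (subst suminf_ennreal2) auto
  qed
  finally show "(\<integral>\<^sup>+x. ennreal (norm (1 / (1 + norm (x::'a)) ^ (?n + 2))) \<partial>lborel) < \<infinity>" .
qed measurable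

lemma cont_measurable: "continuous_on UNIV f \<Longrightarrow> f \<in> borel_measurable borel"
  by (rule borel_measurable_continuous_onI)

lemma decay_bound_integrable:
  fixes f :: "'a::euclidean_space \<Rightarrow> 'b::{banach, second_countable_topology}"
  assumes "f \<in> borel_measurable borel" "\<And>x. norm (f x) \<le> C / (1 + norm x) ^ (DIM('a) + 2)"
  shows "integrable lborel f"
proof (rule Bochner_Integration.integrable_bound[OF integrable_mult_right[OF decay_integrable, of C]])
  show "AE x in lborel. norm (f x) \<le> norm (C * (1 / (1 + norm x) ^ (DIM('a) + 2)))"
    using order_trans[OF assms(2) abs_ge_self] by simp
qed (use assms in simp)

lemma rapid_integrable:
  fixes f :: "'a::euclidean_space \<Rightarrow> complex"
  assumes "continuous_on UNIV f" "rapid f"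
  shows "integrable lborel (\<lambda>x. (1 + norm x) ^ k * cmod (f x))" "integrable lborel f"
proof -
  obtain C where C: "\<And>x. cmod (f x) \<le> C / (1 + norm x) ^ (k + (DIM('a) + 2))"
    using rapid_bound[OF assms(2)] by metis
  show "integrable lborel (\<lambda>x. (1 + norm x) ^ k * cmod (f x))"
  proof (rule decay_bound_integrable)
    show "(\<lambda>x. (1 + norm x) ^ k * cmod (f x)) \<in> borel_measurable borel"
      by (intro cont_measurable continuous_intros assms)
    fix x :: 'a
    have "norm ((1 + norm x) ^ k * cmod (f x)) \<le> (1 + norm x) ^ k * (C / (1 + norm x) ^ (k + (DIM('a) + 2)))"
      using mult_left_mono[OF C, of "(1 + norm x) ^ k"] by (simp add: abs_mult)
    also have "\<dots> = C / (1 + norm x) ^ (DIM('a) + 2)"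
      by (simp add: power_add add_nonneg_eq_0_iff)
    finally show "norm ((1 + norm x) ^ k * cmod (f x)) \<le> C / (1 + norm x) ^ (DIM('a) + 2)" .
  qed
  obtain D where D: "\<And>x. cmod (f x) \<le> D / (1 + norm x) ^ (DIM('a) + 2)"
    using rapid_bound[OF assms(2)] by metis
  show "integrable lborel f"
    by (rule decay_bound_integrable[OF cont_measurable[OF assms(1)] D])
qed

lemma schwartz_integrable: "schwartz f \<Longrightarrow> integrable lborel f"
  by (rule rapid_integrable(2)[OF schwartz_cont schwartz_rapid])

lemma integral_affine:
  fixes f :: "'a::euclidean_space \<Rightarrow> 'b::{banach, second_countable_topology}"
  assumes "f \<in> borel_measurable borel" "a \<noteq> 0"
  shows "(\<integral>x. f x \<partial>lborel) = \<bar>a\<bar> ^ DIM('a) *\<^sub>R (\<integral>x. f (t + a *\<^sub>R x) \<partial>lborel)"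
proof -
  have "(\<integral>x. f x \<partial>lborel) = (\<integral>x. f x \<partial>(density (distr lborel borel (\<lambda>x. t + a *\<^sub>R x)) (\<lambda>_. \<bar>a\<bar>^DIM('a))))"
    using lborel_affine[OF assms(2), of t] by simp
  also have "\<dots> = (\<integral>x. \<bar>a\<bar>^DIM('a) *\<^sub>R f x \<partial>distr lborel borel (\<lambda>x. t + a *\<^sub>R x))"
    by (rule integral_density) (use assms in auto)
  also have "\<dots> = (\<integral>x. \<bar>a\<bar>^DIM('a) *\<^sub>R f (t + a *\<^sub>R x) \<partial>lborel)"
    by (rule integral_distr) (use assms in auto)
  also have "\<dots> = \<bar>a\<bar> ^ DIM('a) *\<^sub>R (\<integral>x. f (t + a *\<^sub>R x) \<partial>lborel)" by simp
  finally show ?thesis .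
qed

lemma integral_shift:
  fixes f :: "'a::euclidean_space \<Rightarrow> 'b::{banach, second_countable_topology}"
  assumes "f \<in> borel_measurable borel"
  shows "(\<integral>x. f (x + t) \<partial>lborel) = (\<integral>x. f x \<partial>lborel)"
  using integral_affine[OF assms, of 1 t] by (simp add: add.commute)

lemma integral_reflect:
  fixes f :: "'a::euclidean_space \<Rightarrow> 'b::{banach, second_countable_topology}"
  assumes "f \<in> borel_measurable borel"
  shows "(\<integral>x. f (t - x) \<partial>lborel) = (\<integral>x. f x \<partial>lborel)"
  using integral_affine[OF assms, of "-1" t] by simp

section \<open>Peetre's inequality and mean value estimates\<close>

lemma peetre: "(1 + norm (x::'a::real_normed_vector)) ^ k \<le> (1 + norm y) ^ k * (1 + norm (x - y)) ^ k"
proof -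
  have "1 + norm x \<le> (1 + norm y) * (1 + norm (x - y))"
    using norm_triangle_sub[of x y] mult_nonneg_nonneg[OF norm_ge_zero[of y] norm_ge_zero[of "x - y"]]
    unfolding distrib_left distrib_right by linarith
  then show ?thesis by (metis power_mono power_mult_distrib add_nonneg_nonneg norm_ge_zero zero_le_one)
qed

lemma diff_norm_le_partials:
  fixes f :: "'a::euclidean_space \<Rightarrow> complex"
  assumes f: "f differentiable_on UNIV"
    and B: "\<And>b z. b \<in> Basis \<Longrightarrow> z \<in> closed_segment x y \<Longrightarrow> cmod (pd b f z) \<le> B"
  shows "cmod (f x - f y) \<le> real DIM('a) * B * norm (x - y)"
proof (rule differentiable_bound[OF convex_closed_segment _ _ ends_in_segment])
  fix z assume z: "z \<in> closed_segment x y"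
  show "(f has_derivative frechet_derivative f (at z)) (at z within closed_segment x y)"
    by (rule has_derivative_at_withinI[OF has_frechet_derivative[OF f]])
  have lin: "linear (frechet_derivative f (at z))" by (rule has_derivative_linear[OF has_frechet_derivative[OF f]])
  show "onorm (frechet_derivative f (at z)) \<le> real DIM('a) * B"
  proof (rule onorm_le)
    fix h :: 'a
    have "frechet_derivative f (at z) h = frechet_derivative f (at z) (\<Sum>b\<in>Basis. (h \<bullet> b) *\<^sub>R b)"
      by (simp add: euclidean_representation)
    also have "\<dots> = (\<Sum>b\<in>Basis. (h \<bullet> b) *\<^sub>R pd b f z)"
      by (simp add: linear_sum[OF lin] linear_scale[OF lin] pd_def)
    also have "cmod \<dots> \<le> (\<Sum>b\<in>(Basis::'a set). norm h * B)"
    proof (rule sum_norm_le)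
      fix b :: 'a assume "b \<in> Basis"
      then have "\<bar>h \<bullet> b\<bar> \<le> norm h" by (rule Basis_le_norm)
      then show "cmod ((h \<bullet> b) *\<^sub>R pd b f z) \<le> norm h * B"
        using B[OF \<open>b \<in> Basis\<close> z] by (auto intro!: mult_mono)
    qed
    finally show "cmod (frechet_derivative f (at z) h) \<le> real DIM('a) * B * norm h" by (simp add: mult_ac)
  qed
qed

text \<open>For |x - y| <= 1 the weight at every point of the segment is comparable to the weight at
  x, up to 2^k, so the mean value bound keeps the full decay.\<close>

lemma schwartz_lipschitz:
  fixes f :: "'a::euclidean_space \<Rightarrow> complex"
  assumes "schwartz f"
  obtains C where "0 \<le> C" "\<And>x y. norm (x - y) \<le> 1 \<Longrightarrow> cmod (f x - f y) \<le> C * norm (x - y) / (1 + norm x) ^ k"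
proof -
  have "\<exists>C. \<forall>b\<in>Basis. \<forall>x. cmod (pd b f x) \<le> C / (1 + norm x) ^ k"
  proof -
    have "\<forall>b\<in>Basis. \<exists>C\<ge>0. \<forall>x. cmod (pd b f x) \<le> C / (1 + norm x) ^ k"
      using assms by (meson rapid_bound schwartz_pd schwartz_rapid)
    then obtain C where C: "\<And>b. b \<in> Basis \<Longrightarrow> 0 \<le> C b" "\<And>b x. b \<in> Basis \<Longrightarrow> cmod (pd b f x) \<le> C b / (1 + norm x) ^ k"
      by metis
    have "cmod (pd b f x) \<le> (\<Sum>b\<in>Basis. C b) / (1 + norm x) ^ k" if "b \<in> Basis" for b x
      using C(2)[OF that, of x] divide_right_mono[OF member_le_sum[of b Basis C], of "(1 + norm x) ^ k"] that C(1)
      by force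
    then show ?thesis by blast
  qed
  then obtain C where C: "\<And>b x. b \<in> Basis \<Longrightarrow> cmod (pd b f x) \<le> C / (1 + norm x) ^ k" by blast
  obtain b0 :: 'a where b0: "b0 \<in> Basis" using nonempty_Basis by blast
  have C0: "0 \<le> C" using order_trans[OF norm_ge_zero C[OF b0, of 0]] by simp
  show thesis
  proof (rule that[of "real DIM('a) * (C * 2 ^ k)"])
    fix x y :: 'a assume xy: "norm (x - y) \<le> 1"
    have "cmod (f x - f y) \<le> real DIM('a) * (C * 2 ^ k / (1 + norm x) ^ k) * norm (x - y)"
    proof (rule diff_norm_le_partials[OF schwartz_differentiable[OF assms]])
      fix b z :: 'a assume b: "b \<in> Basis" and z: "z \<in> closed_segment x y"
      have "norm (x - z) \<le> norm (x - y)" using segment_bound1[OF z] by (simp add: norm_minus_commute)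
      then have zx: "norm (x - z) \<le> 1" using xy by simp
      have "(1 + norm x) ^ k \<le> (1 + norm z) ^ k * (1 + norm (x - z)) ^ k" by (rule peetre)
      also have "\<dots> \<le> (1 + norm z) ^ k * 2 ^ k" using zx by (intro mult_left_mono power_mono) auto
      finally have "C * (1 + norm x) ^ k \<le> C * ((1 + norm z) ^ k * 2 ^ k)" by (rule mult_left_mono[OF _ C0])
      then have "C / (1 + norm z) ^ k \<le> C * 2 ^ k / (1 + norm x) ^ k"
        by (simp add: field_simps add_pos_nonneg)
      with C[OF b, of z] show "cmod (pd b f z) \<le> C * 2 ^ k / (1 + norm x) ^ k" by simp
    qed
    then show "cmod (f x - f y) \<le> real DIM('a) * (C * 2 ^ k) * norm (x - y) / (1 + norm x) ^ k" by simp
  qed (use C0 in simp)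
qed

text \<open>The quadratic remainder controls both the derivative of a Fourier transform and the
  difference quotients in \<open>fourier_pd\<close>.\<close>

lemma cis_diff_bound: "cmod (cis t - 1 - \<i> * of_real t) \<le> t\<^sup>2"
proof -
  have s: "\<bar>sin t - t\<bar> \<le> t\<^sup>2 / 2"
    using Maclaurin_sin_bound[of t 2] by (simp add: numeral_2_eq_2 sin_coeff_def power2_eq_square)
  have "\<bar>sin (t / 2)\<bar>\<^sup>2 \<le> \<bar>t / 2\<bar>\<^sup>2" by (intro power_mono abs_sin_x_le_abs_x) auto
  then have c: "\<bar>cos t - 1\<bar> \<le> t\<^sup>2 / 2"
    using cos_double_sin[of "t / 2"] by (simp add: power2_eq_square)
  have "cmod (cis t - 1 - \<i> * of_real t) \<le> \<bar>cos t - 1\<bar> + \<bar>sin t - t\<bar>"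
    using cmod_le[of "cis t - 1 - \<i> * of_real t"] by simp
  with s c show ?thesis by simp
qed

text \<open>The definition uses the completed measure, while substitution and Fubini are carried out
  over \<open>lborel\<close>; for continuous functions the two integrals agree.\<close>

lemma fourier_lborel:
  assumes "continuous_on UNIV f"
  shows "fourier f \<xi> = (\<integral>x. f x * cis (- 2 * pi * (x \<bullet> \<xi>)) \<partial>lborel)"
  unfolding fourier_def by (rule integral_completion) (simp, intro cont_measurable continuous_intros assms)

lemma integrable_mult_cis:
  fixes f :: "'a::euclidean_space \<Rightarrow> complex"
  assumes "integrable lborel f" "g \<in> borel_measurable borel"
  shows "integrable lborel (\<lambda>x. f x * cis (g x))"
proof (rule Bochner_Integration.integrable_bound[OF assms(1)])
  have "cis \<in> borel_measurable borel"
    by (intro borel_measurable_continuous_onI continuous_intros)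
  then show "(\<lambda>x. f x * cis (g x)) \<in> borel_measurable lborel"
    using assms by (intro borel_measurable_times) (auto intro: measurable_compose)
qed (simp add: norm_mult)

lemma fourier_le: "schwartz f \<Longrightarrow> cmod (fourier f \<xi>) \<le> (\<integral>x. cmod (f x) \<partial>lborel)"
  by (subst fourier_lborel[OF schwartz_cont])
     (auto intro!: order_trans[OF integral_norm_bound] simp: norm_mult)

lemma fourier_shift:
  assumes "continuous_on UNIV f"
  shows "fourier (\<lambda>x. f (x + t)) \<xi> = cis (2 * pi * (t \<bullet> \<xi>)) * fourier f \<xi>"
proof -
  have c: "continuous_on UNIV (\<lambda>x. f (x + t))"
    by (rule continuous_on_compose2[OF assms]) (auto intro!: continuous_intros)
  have "fourier (\<lambda>x. f (x + t)) \<xi> = (\<integral>x. f (x + t) * cis (- 2 * pi * ((x + t) \<bullet> \<xi>)) * cis (2 * pi * (t \<bullet> \<xi>)) \<partial>lborel)"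
    by (simp add: fourier_lborel[OF c] mult.assoc cis_mult inner_add_left algebra_simps)
  also have "\<dots> = (\<integral>x. f x * cis (- 2 * pi * (x \<bullet> \<xi>)) * cis (2 * pi * (t \<bullet> \<xi>)) \<partial>lborel)"
    by (rule integral_shift) (intro cont_measurable continuous_intros assms)
  also have "\<dots> = cis (2 * pi * (t \<bullet> \<xi>)) * fourier f \<xi>"
    by (simp add: fourier_lborel[OF assms] mult.commute)
  finally show ?thesis .
qed

lemma fourier_add: "schwartz f \<Longrightarrow> schwartz g \<Longrightarrow> fourier (\<lambda>x. f x + g x) \<xi> = fourier f \<xi> + fourier g \<xi>"
  by (simp add: fourier_lborel schwartz_cont schwartz_add distrib_right integrable_mult_cis schwartz_integrable)

lemma fourier_cmult: "schwartz f \<Longrightarrow> fourier (\<lambda>x. c * f x) \<xi> = c * fourier f \<xi>"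
  by (simp add: fourier_lborel schwartz_cont schwartz_cmult mult.assoc)

lemma fourier_sum:
  "(\<And>i. i \<in> I \<Longrightarrow> schwartz (f i)) \<Longrightarrow> fourier (\<lambda>x. \<Sum>i\<in>I. f i x) \<xi> = (\<Sum>i\<in>I. fourier (f i) \<xi>)"
proof (induction I rule: infinite_finite_induct)
  case (insert i I)
  then show ?case by (simp add: fourier_add schwartz_sum)
qed (auto simp: fourier_lborel)

lemma fourier_cnj_reflect:
  assumes "schwartz f"
  shows "fourier (\<lambda>x. cnj (f (- x))) \<xi> = cnj (fourier f \<xi>)"
proof -
  have "fourier (\<lambda>x. cnj (f (- x))) \<xi> = (\<integral>x. cnj (f (0 - x)) * cis (2 * pi * ((0 - x) \<bullet> \<xi>)) \<partial>lborel)"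
    using schwartz_cont[OF schwartz_cnj[OF schwartz_reflect[OF assms, of 0]]] by (simp add: fourier_lborel)
  also have "\<dots> = (\<integral>x. cnj (f x) * cis (2 * pi * (x \<bullet> \<xi>)) \<partial>lborel)"
    by (rule integral_reflect) (intro cont_measurable continuous_intros schwartz_cont assms)
  also have "\<dots> = (\<integral>x. cnj (f x * cis (- 2 * pi * (x \<bullet> \<xi>))) \<partial>lborel)"
    by (simp add: cis_cnj)
  also have "\<dots> = cnj (fourier f \<xi>)"
    by (simp add: fourier_lborel[OF schwartz_cont[OF assms]] del: complex_cnj_mult)
  finally show ?thesis .
qed

lemma fourier_affine:
  fixes f :: "'a::euclidean_space \<Rightarrow> complex"
  assumes "schwartz f" "a \<noteq> 0"
  shows "fourier (\<lambda>x. f (a *\<^sub>R x)) \<xi> = fourier f (\<xi> /\<^sub>R a) / of_real (\<bar>a\<bar> ^ DIM('a))"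
proof -
  have "fourier f (\<xi> /\<^sub>R a) = \<bar>a\<bar> ^ DIM('a) *\<^sub>R (\<integral>x. f (0 + a *\<^sub>R x) * cis (- 2 * pi * ((0 + a *\<^sub>R x) \<bullet> (\<xi> /\<^sub>R a))) \<partial>lborel)"
    unfolding fourier_lborel[OF schwartz_cont[OF assms(1)]]
    by (rule integral_affine[OF _ assms(2)]) (intro cont_measurable continuous_intros schwartz_cont assms)
  also have "\<dots> = \<bar>a\<bar> ^ DIM('a) *\<^sub>R fourier (\<lambda>x. f (a *\<^sub>R x)) \<xi>"
    using schwartz_cont[OF schwartz_affine[OF assms, of 0]] assms(2)
    by (simp add: fourier_lborel mult.assoc[symmetric])
  finally show ?thesis using assms(2) by (simp add: scaleR_conv_of_real)
qed

text \<open>By \<open>cis_diff_bound\<close> the linearisation error is at most a weighted second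
  moment of \<open>f\<close> times the squared increment. This gives the total derivative at once
  rather than one partial derivative at a time.\<close>

lemma fourier_has_derivative:
  fixes f :: "'a::euclidean_space \<Rightarrow> complex"
  assumes f: "schwartz f"
  shows "(fourier f has_derivative
    (\<lambda>h. \<integral>x. f x * cis (- 2 * pi * (x \<bullet> \<xi>)) * (\<i> * of_real (- 2 * pi * (x \<bullet> h))) \<partial>lborel)) (at \<xi>)"
    (is "(_ has_derivative ?L) _")
proof -
  have int: "integrable lborel (\<lambda>x. (1 + norm x) ^ k * cmod (f x))" for k
    by (rule rapid_integrable[OF schwartz_cont schwartz_rapid]; fact f)
  have m: "(\<lambda>x. f x * cis (- 2 * pi * (x \<bullet> \<xi>)) * (\<i> * of_real (- 2 * pi * (x \<bullet> h)))) \<in> borel_measurable borel" for h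
    by (intro cont_measurable continuous_intros schwartz_cont f)
  have e: "cmod (f x * cis (- 2 * pi * (x \<bullet> \<xi>)) * (\<i> * of_real (- 2 * pi * (x \<bullet> h))))
         \<le> 2 * pi * norm h * ((1 + norm x) ^ 1 * cmod (f x))" for x h
  proof -
    have "\<bar>x \<bullet> h\<bar> \<le> norm x * norm h" by (rule Cauchy_Schwarz_ineq2)
    also have "\<dots> \<le> (1 + norm x) * norm h" by (intro mult_right_mono) auto
    finally have "(2 * pi * cmod (f x)) * \<bar>x \<bullet> h\<bar> \<le> (2 * pi * cmod (f x)) * ((1 + norm x) * norm h)"
      by (rule mult_left_mono) simp
    also have "\<dots> = 2 * pi * norm h * ((1 + norm x) ^ 1 * cmod (f x))" by simp
    finally show ?thesis by (simp add: norm_mult abs_mult mult_ac)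
  qed
  have ix: "integrable lborel (\<lambda>x. f x * cis (- 2 * pi * (x \<bullet> \<xi>)) * (\<i> * of_real (- 2 * pi * (x \<bullet> h))))" for h
    by (rule Bochner_Integration.integrable_bound[OF integrable_mult_right[OF int[of 1], of "2 * pi * norm h"]])
       (use m order_trans[OF e abs_ge_self] in auto)
  have bl: "bounded_linear ?L"
  proof (rule bounded_linear_intro[where K="2 * pi * (\<integral>x. (1 + norm x) ^ 1 * cmod (f x) \<partial>lborel)"])
    fix h h' :: 'a and r :: real
    show "?L (h + h') = ?L h + ?L h'"
      by (subst Bochner_Integration.integral_add[symmetric, OF ix ix]) (simp add: inner_add_right algebra_simps)
    show "?L (r *\<^sub>R h) = r *\<^sub>R ?L h"
      by (simp add: scaleR_conv_of_real mult_ac flip: integral_mult_right_zero)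
    have "cmod (?L h) \<le> (\<integral>x. cmod (f x * cis (- 2 * pi * (x \<bullet> \<xi>)) * (\<i> * of_real (- 2 * pi * (x \<bullet> h)))) \<partial>lborel)"
      by (rule integral_norm_bound)
    also have "\<dots> \<le> (\<integral>x. 2 * pi * norm h * ((1 + norm x) ^ 1 * cmod (f x)) \<partial>lborel)"
      by (rule integral_mono[OF integrable_norm[OF ix] integrable_mult_right[OF int] e])
    finally show "cmod (?L h) \<le> norm h * (2 * pi * (\<integral>x. (1 + norm x) ^ 1 * cmod (f x) \<partial>lborel))"
      by (simp only: integral_mult_right_zero) (simp only: mult_ac)
  qed
  define D where "D = (2 * pi)\<^sup>2 * (\<integral>x. (1 + norm x) ^ 2 * cmod (f x) \<partial>lborel)"
  have est: "cmod (fourier f y - fourier f \<xi> - ?L (y - \<xi>)) \<le> D * (norm (y - \<xi>))\<^sup>2" for y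
  proof -
    let ?e = "\<lambda>x. cis (- 2 * pi * (x \<bullet> (y - \<xi>))) - 1 - \<i> * of_real (- 2 * pi * (x \<bullet> (y - \<xi>)))"
    have i0: "integrable lborel (\<lambda>x. f x * cis (- 2 * pi * (x \<bullet> y)))" for y
      by (intro integrable_mult_cis schwartz_integrable f) measurable
    have c: "cis (- 2 * pi * (x \<bullet> y)) = cis (- 2 * pi * (x \<bullet> \<xi>)) * cis (- 2 * pi * (x \<bullet> (y - \<xi>)))" for x
      by (simp add: cis_mult algebra_simps)
    have eq: "fourier f y - fourier f \<xi> - ?L (y - \<xi>) = (\<integral>x. f x * cis (- 2 * pi * (x \<bullet> \<xi>)) * ?e x \<partial>lborel)"
      unfolding fourier_lborel[OF schwartz_cont[OF f]]
      by (subst Bochner_Integration.integral_diff[symmetric, OF i0 i0],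
          subst Bochner_Integration.integral_diff[symmetric, OF Bochner_Integration.integrable_diff[OF i0 i0] ix])
         (simp only: c, simp only: right_diff_distrib mult.assoc mult_1_right)
    have bd: "cmod (\<integral>x. f x * cis (- 2 * pi * (x \<bullet> \<xi>)) * ?e x \<partial>lborel)
        \<le> (\<integral>x. (2 * pi)\<^sup>2 * (norm (y - \<xi>))\<^sup>2 * ((1 + norm x) ^ 2 * cmod (f x)) \<partial>lborel)"
    proof (rule Bochner_Integration.integral_norm_bound_integral)
      show 1: "cmod (f x * cis (- 2 * pi * (x \<bullet> \<xi>)) * ?e x) \<le> (2 * pi)\<^sup>2 * (norm (y - \<xi>))\<^sup>2 * ((1 + norm x) ^ 2 * cmod (f x))" for x
      proof -
        have "cmod (?e x) \<le> (- 2 * pi * (x \<bullet> (y - \<xi>)))\<^sup>2" by (rule cis_diff_bound)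
        also have "\<dots> = (2 * pi)\<^sup>2 * \<bar>x \<bullet> (y - \<xi>)\<bar>\<^sup>2" by (simp add: power_mult_distrib)
        also have "\<dots> \<le> (2 * pi)\<^sup>2 * ((1 + norm x) * norm (y - \<xi>))\<^sup>2"
        proof (intro mult_left_mono power_mono)
          have "\<bar>x \<bullet> (y - \<xi>)\<bar> \<le> norm x * norm (y - \<xi>)" by (rule Cauchy_Schwarz_ineq2)
          also have "\<dots> \<le> (1 + norm x) * norm (y - \<xi>)" by (intro mult_right_mono) auto
          finally show "\<bar>x \<bullet> (y - \<xi>)\<bar> \<le> (1 + norm x) * norm (y - \<xi>)" .
        qed auto
        finally have "cmod (f x) * cmod (?e x) \<le> cmod (f x) * ((2 * pi)\<^sup>2 * ((1 + norm x) * norm (y - \<xi>))\<^sup>2)"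
          by (rule mult_left_mono) auto
        then show ?thesis by (simp only: norm_mult norm_cis mult_1_right) (simp add: power_mult_distrib mult_ac)
      qed
      have "integrable lborel (\<lambda>x. (2 * pi)\<^sup>2 * (norm (y - \<xi>))\<^sup>2 * ((1 + norm x) ^ 2 * cmod (f x)))"
        by (intro integrable_mult_right int)
      then show "integrable lborel (\<lambda>x. f x * cis (- 2 * pi * (x \<bullet> \<xi>)) * ?e x)"
      proof (rule Bochner_Integration.integrable_bound)
        show "(\<lambda>x. f x * cis (- 2 * pi * (x \<bullet> \<xi>)) * ?e x) \<in> borel_measurable lborel"
          by (subst measurable_lborel2, intro cont_measurable continuous_intros schwartz_cont f)
        show "AE x in lborel. cmod (f x * cis (- 2 * pi * (x \<bullet> \<xi>)) * ?e x) \<le>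
            norm ((2 * pi)\<^sup>2 * (norm (y - \<xi>))\<^sup>2 * ((1 + norm x) ^ 2 * cmod (f x)))"
          using order_trans[OF 1 abs_ge_self] by (intro AE_I2) (simp only: real_norm_def)
      qed
    qed (intro integrable_mult_right int)
    have "(\<integral>x. (2 * pi)\<^sup>2 * (norm (y - \<xi>))\<^sup>2 * ((1 + norm x) ^ 2 * cmod (f x)) \<partial>lborel) = D * (norm (y - \<xi>))\<^sup>2"
      by (simp only: D_def integral_mult_right_zero) (simp only: mult_ac)
    with bd show ?thesis unfolding eq by (simp only:)
  qed
  show ?thesis
  proof (rule has_derivativeI_sandwich[where e=1 and H="\<lambda>y. D * norm (y - \<xi>)"])
    fix y assume "y \<noteq> \<xi>"
    then show "norm (fourier f y - fourier f \<xi> - ?L (y - \<xi>)) / norm (y - \<xi>) \<le> D * norm (y - \<xi>)"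
      using est[of y] by (simp add: divide_le_eq power2_eq_square mult_ac)
  next
    show "((\<lambda>y. D * norm (y - \<xi>)) \<longlongrightarrow> 0) (at \<xi>)" by (auto intro!: tendsto_eq_intros)
  qed (use bl in auto)
qed

lemma fourier_differentiable: "schwartz f \<Longrightarrow> fourier f differentiable_on UNIV"
  using fourier_has_derivative by (auto simp: differentiable_on_def differentiable_def)

lemma pd_fourier:
  assumes "schwartz f"
  shows "pd b (fourier f) = fourier (\<lambda>x. (- 2 * pi * \<i>) * (of_real (x \<bullet> b) * f x))"
  unfolding pd_eq[OF fourier_has_derivative[OF assms]]
  by (rule ext, subst fourier_lborel[OF schwartz_cont[OF schwartz_cmult[OF schwartz_coord[OF assms]]]])
     (simp add: mult_ac)

text \<open>In place of integration by parts: a translation becomes a phase under the Fourier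
  transform, so the transform of a difference quotient is explicit, and dominated convergence passes
  to the limit under the integral.\<close>

lemma fourier_pd:
  assumes f: "schwartz f" and b: "b \<in> Basis"
  shows "fourier (pd b f) \<xi> = 2 * pi * \<i> * of_real (b \<bullet> \<xi>) * fourier f \<xi>"
proof -
  \<comment> \<open>Increments of length at most 1, as \<open>schwartz_lipschitz\<close> requires;
    its bound is the dominating function.\<close>
  define t where "t n = 1 / real (Suc n)" for n
  have t: "0 < t n" "t n \<le> 1" for n by (auto simp: t_def)
  have t0: "t \<longlonglongrightarrow> 0" unfolding t_def using LIMSEQ_inverse_real_of_nat by (simp add: inverse_eq_divide)
  let ?s = "\<lambda>n x. (f (x + t n *\<^sub>R b) - f x) / t n * cis (- 2 * pi * (x \<bullet> \<xi>))"
  obtain C where C: "0 \<le> C" "\<And>x y. norm (x - y) \<le> 1 \<Longrightarrow> cmod (f x - f y) \<le> C * norm (x - y) / (1 + norm x) ^ (DIM('a) + 2)"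
    using schwartz_lipschitz[OF f] by metis
  have sh: "schwartz (\<lambda>x. f (x + t n *\<^sub>R b))" for n by (rule schwartz_shift[OF f])
  have lim: "(\<lambda>n. \<integral>x. ?s n x \<partial>lborel) \<longlonglongrightarrow> (\<integral>x. pd b f x * cis (- 2 * pi * (x \<bullet> \<xi>)) \<partial>lborel)"
  proof (rule integral_dominated_convergence[where w="\<lambda>x. C * (1 / (1 + norm x) ^ (DIM('a) + 2))"])
    show "integrable lborel (\<lambda>x::'a. C * (1 / (1 + norm x) ^ (DIM('a) + 2)))"
      by (intro integrable_mult_right decay_integrable)
    show "(\<lambda>x. pd b f x * cis (- 2 * pi * (x \<bullet> \<xi>))) \<in> borel_measurable lborel"
      by (simp, intro cont_measurable continuous_intros schwartz_cont schwartz_pd f b)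
    show "(\<lambda>x. ?s n x) \<in> borel_measurable lborel" for n
      using t(1)[of n] by (simp, intro cont_measurable continuous_intros schwartz_cont f sh) auto
    show "AE x in lborel. (\<lambda>n. ?s n x) \<longlonglongrightarrow> pd b f x * cis (- 2 * pi * (x \<bullet> \<xi>))"
    proof (rule AE_I2)
      fix x
      have "((\<lambda>h. f (x + h *\<^sub>R b)) has_derivative (\<lambda>h. frechet_derivative f (at (x + 0 *\<^sub>R b)) (h *\<^sub>R b))) (at 0)"
        by (rule has_derivative_compose[of "\<lambda>h. x + h *\<^sub>R b" "\<lambda>h. h *\<^sub>R b" 0 UNIV f, OF _ has_frechet_derivative[OF schwartz_differentiable[OF f]]])
           (auto intro!: derivative_eq_intros)
      then have "(\<lambda>h. norm (f (x + h *\<^sub>R b) - f x - h *\<^sub>R pd b f x) / norm h) \<midarrow>0\<rightarrow> 0"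
        using linear_scale[OF has_derivative_linear[OF has_frechet_derivative[OF schwartz_differentiable[OF f], of x]], of _ b]
        by (simp add: has_derivative_at pd_def)
      then have "(\<lambda>n. norm (f (x + t n *\<^sub>R b) - f x - t n *\<^sub>R pd b f x) / norm (t n)) \<longlonglongrightarrow> 0"
        by (rule filterlim_compose) (use t t0 in \<open>simp add: filterlim_at less_imp_neq[symmetric]\<close>)
      moreover have "norm (f (x + t n *\<^sub>R b) - f x - t n *\<^sub>R pd b f x) / norm (t n) = norm ((f (x + t n *\<^sub>R b) - f x) /\<^sub>R t n - pd b f x)" for n
      proof -
        have "(f (x + t n *\<^sub>R b) - f x) /\<^sub>R t n - pd b f x = (f (x + t n *\<^sub>R b) - f x - t n *\<^sub>R pd b f x) /\<^sub>R t n"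
          using t(1)[of n] by (simp add: scaleR_diff_right)
        then show ?thesis by (simp add: divide_inverse mult.commute)
      qed
      ultimately have "(\<lambda>n. (f (x + t n *\<^sub>R b) - f x) /\<^sub>R t n) \<longlonglongrightarrow> pd b f x"
        by (simp add: tendsto_norm_zero_iff LIM_zero_iff)
      then show "(\<lambda>n. ?s n x) \<longlonglongrightarrow> pd b f x * cis (- 2 * pi * (x \<bullet> \<xi>))"
        by (intro tendsto_mult tendsto_const) (simp add: scaleR_conv_of_real divide_inverse mult.commute)
    qed
    show "AE x in lborel. norm (?s n x) \<le> C * (1 / (1 + norm x) ^ (DIM('a) + 2))" for n
    proof (rule AE_I2)
      fix x
      have "cmod (f (x + t n *\<^sub>R b) - f x) \<le> C * t n / (1 + norm x) ^ (DIM('a) + 2)"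
        using C(2)[of x "x + t n *\<^sub>R b"] t[of n] b by (simp add: norm_minus_commute)
      then have "cmod (f (x + t n *\<^sub>R b) - f x) / t n \<le> C * t n / (1 + norm x) ^ (DIM('a) + 2) / t n"
        using t(1)[of n] by (intro divide_right_mono) auto
      also have "\<dots> = C * (1 / (1 + norm x) ^ (DIM('a) + 2))" using t(1)[of n] by simp
      finally show "norm (?s n x) \<le> C * (1 / (1 + norm x) ^ (DIM('a) + 2))"
        using t(1)[of n] by (simp add: norm_mult norm_divide)
    qed
  qed
  define \<theta> where "\<theta> = 2 * pi * (b \<bullet> \<xi>)"
  have s: "(\<integral>x. ?s n x \<partial>lborel) = (cis (\<theta> * t n) - 1) / t n * fourier f \<xi>" for n
  proof -
    have "(\<integral>x. ?s n x \<partial>lborel) = (fourier (\<lambda>x. f (x + t n *\<^sub>R b)) \<xi> - fourier f \<xi>) / t n"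
      unfolding fourier_lborel[OF schwartz_cont[OF f]] fourier_lborel[OF schwartz_cont[OF sh]]
      by (subst Bochner_Integration.integral_diff[symmetric, OF integrable_mult_cis integrable_mult_cis])
         (simp_all add: schwartz_integrable f sh diff_divide_distrib left_diff_distrib flip: integral_divide_zero)
    then show ?thesis
      by (simp add: fourier_shift[OF schwartz_cont[OF f]] \<theta>_def algebra_simps diff_divide_distrib)
  qed
  have "(\<lambda>n. (cis (\<theta> * t n) - 1) / t n) \<longlonglongrightarrow> \<i> * \<theta>"
  proof (rule Lim_transform_bound[of "\<lambda>n. (cis (\<theta> * t n) - 1) / t n - \<i> * \<theta>" "\<lambda>n. \<theta>\<^sup>2 * t n", THEN LIM_zero_cancel])
    show "\<forall>\<^sub>F n in sequentially. norm ((cis (\<theta> * t n) - 1) / t n - \<i> * \<theta>) \<le> norm (\<theta>\<^sup>2 * t n)"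
    proof (intro always_eventually allI)
      fix n
      have "(cis (\<theta> * t n) - 1) / t n - \<i> * \<theta> = (cis (\<theta> * t n) - 1 - \<i> * of_real (\<theta> * t n)) / t n"
        using t(1)[of n] by (simp add: field_simps)
      then have "norm ((cis (\<theta> * t n) - 1) / t n - \<i> * \<theta>) \<le> (\<theta> * t n)\<^sup>2 / t n"
        using cis_diff_bound[of "\<theta> * t n"] t(1)[of n] by (simp add: norm_divide divide_right_mono)
      then show "norm ((cis (\<theta> * t n) - 1) / t n - \<i> * \<theta>) \<le> norm (\<theta>\<^sup>2 * t n)"
        using t(1)[of n] by (simp add: power2_eq_square)
    qed
    show "(\<lambda>n. \<theta>\<^sup>2 * t n) \<longlonglongrightarrow> 0" using tendsto_mult_left[OF t0] by force
  qed
  then have "(\<lambda>n. (cis (\<theta> * t n) - 1) / t n * fourier f \<xi>) \<longlonglongrightarrow> \<i> * \<theta> * fourier f \<xi>"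
    by (intro tendsto_mult tendsto_const)
  then have "(\<integral>x. pd b f x * cis (- 2 * pi * (x \<bullet> \<xi>)) \<partial>lborel) = \<i> * \<theta> * fourier f \<xi>"
    using LIMSEQ_unique[OF lim[unfolded s]] by blast
  then show ?thesis
    by (simp add: fourier_lborel[OF schwartz_cont[OF schwartz_pd[OF f b]]] \<theta>_def mult_ac)
qed

text \<open>Each power of |xi| is traded for one derivative of \<open>f\<close>, so the induction
  over the weight quantifies over all Schwartz functions at once.\<close>

lemma fourier_rapid: 
  fixes f :: "'a::euclidean_space \<Rightarrow> complex"
  assumes "schwartz f" shows "rapid (fourier f)"
proof -
  have "\<forall>f::'a \<Rightarrow> complex. schwartz f \<longrightarrow> (\<exists>C. \<forall>\<xi>. (1 + norm \<xi>) ^ k * cmod (fourier f \<xi>) \<le> C)" for k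
  proof (induction k)
    case 0
    then show ?case using fourier_le by auto
  next
    case (Suc k)
    show ?case
    proof (intro allI impI)
      fix f :: "'a \<Rightarrow> complex" assume f: "schwartz f"
      obtain C0 where C0: "\<And>\<xi>. (1 + norm \<xi>) ^ k * cmod (fourier f \<xi>) \<le> C0" using Suc f by blast
      have "\<forall>b\<in>Basis. \<exists>C. \<forall>\<xi>. (1 + norm \<xi>) ^ k * cmod (fourier (pd b f) \<xi>) \<le> C"
        using Suc f schwartz_pd by blast
      then obtain C where C: "\<And>b \<xi>. b \<in> Basis \<Longrightarrow> (1 + norm \<xi>) ^ k * cmod (fourier (pd b f) \<xi>) \<le> C b" by metis
      have "(1 + norm \<xi>) ^ Suc k * cmod (fourier f \<xi>) \<le> C0 + (\<Sum>b\<in>Basis. C b)" for \<xi>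
      proof -
        have nx: "norm \<xi> \<le> (\<Sum>b\<in>Basis. \<bar>\<xi> \<bullet> b\<bar>)" by (rule norm_le_l1)
        have "norm \<xi> * cmod (fourier f \<xi>) \<le> (\<Sum>b\<in>Basis. \<bar>\<xi> \<bullet> b\<bar>) * cmod (fourier f \<xi>)"
          by (intro mult_right_mono nx) auto
        also have "\<dots> \<le> (\<Sum>b\<in>Basis. cmod (fourier (pd b f) \<xi>))"
          unfolding sum_distrib_right
        proof (rule sum_mono)
          fix b :: 'a assume b: "b \<in> Basis"
          \<comment> \<open>The factor 2 pi from \<open>fourier_pd\<close> is at least 1.\<close>
          have "1 * (\<bar>\<xi> \<bullet> b\<bar> * cmod (fourier f \<xi>)) \<le> (2 * pi) * (\<bar>\<xi> \<bullet> b\<bar> * cmod (fourier f \<xi>))"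
            using pi_gt3 by (intro mult_right_mono) auto
          then show "\<bar>\<xi> \<bullet> b\<bar> * cmod (fourier f \<xi>) \<le> cmod (fourier (pd b f) \<xi>)"
            by (simp add: fourier_pd[OF f b] norm_mult mult_ac inner_commute)
        qed
        finally have "(1 + norm \<xi>) ^ k * (norm \<xi> * cmod (fourier f \<xi>)) \<le> (1 + norm \<xi>) ^ k * (\<Sum>b\<in>Basis. cmod (fourier (pd b f) \<xi>))"
          by (intro mult_left_mono) auto
        also have "\<dots> \<le> (\<Sum>b\<in>Basis. C b)" unfolding sum_distrib_left by (intro sum_mono C)
        finally show ?thesis using C0[of \<xi>] by (simp add: algebra_simps)
      qed
      then show "\<exists>C. \<forall>\<xi>. (1 + norm \<xi>) ^ Suc k * cmod (fourier f \<xi>) \<le> C" by blast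
    qed
  qed
  then show ?thesis using assms by (simp add: rapid_def)
qed

lemma schwartz_fourier:
  fixes f :: "'a::euclidean_space \<Rightarrow> complex"
  shows "schwartz f \<Longrightarrow> schwartz (fourier f)"
proof (rule schwartz_coinduct[of "\<lambda>g. \<exists>f. schwartz f \<and> g = fourier f"])
  fix g :: "'a \<Rightarrow> complex" and b :: 'a assume "\<exists>f. schwartz f \<and> g = fourier f" and b: "b \<in> Basis"
  then show "\<exists>f. schwartz f \<and> pd b g = fourier f"
    using schwartz_cmult[OF schwartz_coord] pd_fourier by blast
qed (auto intro: fourier_rapid fourier_differentiable)

section \<open>Cutoff functions, Fourier inversion and convolution\<close>

text \<open>The functions P(1/t) exp(-1/t), continued by 0, contain exp(-1/t) and all its
  derivatives: differentiation replaces P(s) by s^2 (P(s) - P'(s)) with s = 1/t.\<close>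

definition flat :: "real poly \<Rightarrow> real \<Rightarrow> real" where
  "flat P t = (if t > 0 then poly P (1 / t) * exp (- 1 / t) else 0)"

lemma poly_exp_tendsto_0: "((\<lambda>s::real. poly P s * exp (- s)) \<longlongrightarrow> 0) at_top"
proof -
  have "((\<lambda>s. \<Sum>i\<le>degree P. coeff P i * (s ^ i / exp s)) \<longlongrightarrow> (\<Sum>i\<le>degree P. coeff P i * 0)) at_top"
    by (intro tendsto_sum tendsto_mult tendsto_const tendsto_power_div_exp_0)
  then show ?thesis
    by (simp add: poly_altdef sum_distrib_right exp_minus divide_inverse mult.assoc)
qed

lemma flat_deriv: "(flat P has_real_derivative flat ([:0, 0, 1:] * (P - pderiv P)) t) (at t)"
proof -
  let ?Q = "[:0, 0, 1:] * (P - pderiv P)"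
  consider "t > 0" | "t < 0" | "t = 0" by linarith
  then show ?thesis
  proof cases
    case 1
    have "((\<lambda>t. poly P (1 / t) * exp (- 1 / t)) has_real_derivative flat ?Q t) (at t)"
      using 1 by (auto intro!: derivative_eq_intros simp: flat_def field_simps power2_eq_square)
    then show ?thesis
      by (rule has_field_derivative_transform_within_open[where S="{0<..}"]) (use 1 in \<open>auto simp: flat_def\<close>)
  next
    case 2
    have "((\<lambda>t. 0) has_real_derivative flat ?Q t) (at t)" using 2 by (simp add: flat_def)
    then show ?thesis
      by (rule has_field_derivative_transform_within_open[where S="{..<0}"]) (use 2 in \<open>auto simp: flat_def\<close>)
  next
    case 3
    have "((\<lambda>h. flat P h / h) \<longlongrightarrow> 0) (at_right 0)"
    proof (rule Lim_transform_eventually)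
      have "filterlim (\<lambda>h::real. 1 / h) at_top (at_right 0)"
        using filterlim_inverse_at_top_right by (simp add: inverse_eq_divide)
      \<comment> \<open>With s = 1/h the quotient \<open>flat P h / h\<close> is s P(s) exp(-s),
        whence the polynomial \<open>[:0, 1:] * P\<close>.\<close>
      from filterlim_compose[OF poly_exp_tendsto_0[of "[:0, 1:] * P"] this]
      show "((\<lambda>h. poly ([:0, 1:] * P) (1 / h) * exp (- (1 / h))) \<longlongrightarrow> 0) (at_right 0)" .
      show "\<forall>\<^sub>F h in at_right 0. poly ([:0, 1:] * P) (1 / h) * exp (- (1 / h)) = flat P h / h"
        by (auto simp: eventually_at_filter flat_def)
    qed
    moreover have "((\<lambda>h. flat P h / h) \<longlongrightarrow> 0) (at_left 0)"
      by (rule Lim_transform_eventually[OF tendsto_const]) (auto simp: eventually_at_filter flat_def)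
    ultimately have "((\<lambda>h. flat P h / h) \<longlongrightarrow> 0) (at 0)" by (rule filterlim_split_at[rotated])
    then show ?thesis using 3 by (simp add: has_field_derivative_iff flat_def)
  qed
qed

text \<open>All polynomials enter as generators together, because a derivative changes P; the chain
  rule contributes only a smooth factor.\<close>

lemma smooth_flat: "smooth (\<lambda>x. of_real (flat P (a + s * (norm x)\<^sup>2)))"
proof (rule smooth_alg)
  let ?A = "range (\<lambda>P (x::'a). complex_of_real (flat P (a + s * (norm x)\<^sup>2))) \<union> Collect smooth"
  have d: "((\<lambda>x::'a. complex_of_real (flat P (a + s * (norm x)\<^sup>2))) has_derivative
      (\<lambda>h. of_real (flat ([:0, 0, 1:] * (P - pderiv P)) (a + s * (norm x)\<^sup>2) * (2 * s * (x \<bullet> h))))) (at x)" for P x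
  proof -
    have "((\<lambda>x::'a. a + s * (norm x)\<^sup>2) has_derivative (\<lambda>h. 2 * s * (x \<bullet> h))) (at x)"
      unfolding power2_norm_eq_inner by (auto intro!: derivative_eq_intros simp: inner_commute)
    from has_derivative_compose[OF this flat_deriv[unfolded has_field_derivative_def]]
    show ?thesis by (rule has_derivative_of_real)
  qed
  show "(\<lambda>x. complex_of_real (flat P (a + s * (norm x)\<^sup>2))) \<in> alg ?A" by (rule alg.gen) auto
  fix g and b :: 'a assume g: "g \<in> ?A"
  show "g differentiable_on UNIV"
    using g d by (auto simp: smooth_differentiable) (auto simp: differentiable_on_def differentiable_def)
  assume b: "b \<in> Basis"
  show "pd b g \<in> alg ?A"
  proof (cases "smooth g")
    case True
    then show ?thesis using b by (auto intro!: alg.gen smooth_pd)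
  next
    case False
    then obtain P where "g = (\<lambda>x. complex_of_real (flat P (a + s * (norm x)\<^sup>2)))" using g by auto
    then have e: "pd b g = (\<lambda>x. of_real (flat ([:0, 0, 1:] * (P - pderiv P)) (a + s * (norm x)\<^sup>2)) * (of_real (2 * s) * of_real (x \<bullet> b)))"
      using pd_eq[OF d] by simp
    show ?thesis unfolding e
      by (rule alg.mult; rule alg.gen) (auto intro!: smooth_mult smooth_const smooth_inner)
  qed
qed

text \<open>One formula for two cutoffs. For R > 0, the choice a = R^2, s = -1 is positive exactly
  inside the open ball of radius R, and a = -R^2, s = 1 exactly outside the closed ball.\<close>

definition bump :: "real \<Rightarrow> real \<Rightarrow> 'a::euclidean_space \<Rightarrow> complex" where
  "bump a s x = of_real (flat 1 (a + s * (norm x)\<^sup>2))"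

lemma smooth_bump: "smooth (bump a s)"
  unfolding bump_def[abs_def] by (rule smooth_flat)

lemma bump_pos: "a + s * (norm x)\<^sup>2 > 0 \<Longrightarrow> \<exists>r>0. bump a s x = of_real r"
  by (auto simp: bump_def flat_def)

lemma bump_zero: "a + s * (norm x)\<^sup>2 \<le> 0 \<Longrightarrow> bump a s x = 0"
  by (auto simp: bump_def flat_def)

lemma bump_nonneg: "\<exists>r\<ge>0. bump a s x = of_real r"
  by (auto simp: bump_def flat_def)

text \<open>A division u / w in which \<open>w\<close> may have zeros away from \<open>u\<close>.
  The denominator |w|^2 + s never vanishes, since s >= 0 is positive wherever w is zero, and it
  equals |w|^2 where u is nonzero. So u times the conjugate of w over this denominator is a global
  smooth quotient.\<close>

lemma smooth_cutoff_divide: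
  fixes u w s :: "'a::euclidean_space \<Rightarrow> complex"
  assumes u: "smooth u" "\<And>x. R < norm x \<Longrightarrow> u x = 0" and w: "smooth w"
    and s: "smooth s" "\<And>x. \<exists>r\<ge>0. s x = of_real r" "\<And>x. u x \<noteq> 0 \<Longrightarrow> s x = 0" "\<And>x. s x = 0 \<Longrightarrow> w x \<noteq> 0"
  obtains v where "schwartz v" "\<And>x. u x = w x * v x" "\<And>x. u x = 0 \<Longrightarrow> v x = 0"
proof
  define d where "d = (\<lambda>x. w x * cnj (w x) + s x)"
  have d0: "d x \<noteq> 0" for x
  proof -
    obtain r where r: "r \<ge> 0" "s x = of_real r" using s(2) by blast
    have "d x = of_real ((cmod (w x))\<^sup>2 + r)" unfolding d_def r(2) by (simp add: complex_norm_square[symmetric] del: of_real_power)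
    moreover have "(cmod (w x))\<^sup>2 + r \<noteq> 0"
      using r s(4)[of x] by (cases "r = 0") (auto simp: add_nonneg_eq_0_iff)
    ultimately show ?thesis by (metis of_real_eq_0_iff)
  qed
  define v where "v = (\<lambda>x. u x * (cnj (w x) * inverse (d x)))"
  have "smooth d" unfolding d_def by (intro smooth_add smooth_mult smooth_cnj w s)
  then have "smooth v" unfolding v_def by (intro smooth_mult smooth_cnj smooth_inverse u w d0)
  then show "schwartz v" by (rule schwartz_compact_support[where R=R]) (simp add: v_def u)
  show "u x = w x * v x" for x
  proof (cases "u x = 0")
    case False
    then have "d x = w x * cnj (w x)" using s(3) by (simp add: d_def)
    then show ?thesis using d0[of x] by (simp add: v_def field_simps)
  qed (simp add: v_def)
  show "u x = 0 \<Longrightarrow> v x = 0" for x by (simp add: v_def)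
qed

text \<open>The function is u / (u + w) with a bump u inside radius b and a bump w outside radius a;
  as a < b, the two never vanish together.\<close>

lemma plateau_exists:
  assumes "0 < a" "a < b"
  obtains \<eta> :: "'a::euclidean_space \<Rightarrow> complex"
  where "schwartz \<eta>" "\<And>x. norm x \<le> a \<Longrightarrow> \<eta> x = 1" "\<And>x. b \<le> norm x \<Longrightarrow> \<eta> x = 0"
proof
  let ?u = "bump (b\<^sup>2) (-1) :: 'a \<Rightarrow> complex" and ?w = "bump (- a\<^sup>2) 1 :: 'a \<Rightarrow> complex"
  let ?d = "\<lambda>x. ?u x + ?w x"
  have d0: "?d x \<noteq> 0" for x
  proof -
    have ab: "a\<^sup>2 < b\<^sup>2" using assms by (simp add: power_strict_mono)
    obtain p q where pq: "p \<ge> 0" "q \<ge> 0" "?u x = of_real p" "?w x = of_real q" using bump_nonneg by metis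
    have "p > 0 \<or> q > 0"
    proof (cases "(norm x)\<^sup>2 < b\<^sup>2")
      case True
      then show ?thesis using bump_pos[of "b\<^sup>2" "-1" x] pq(3) by auto
    next
      case False
      then show ?thesis using bump_pos[of "- a\<^sup>2" 1 x] pq(4) ab by auto
    qed
    then have "p + q \<noteq> 0" using pq by auto
    then show ?thesis unfolding pq by (metis of_real_add of_real_eq_0_iff)
  qed
  let ?\<eta> = "\<lambda>x. ?u x * inverse (?d x)"
  show z: "?\<eta> x = 0" if "b \<le> norm x" for x
    using that assms by (simp add: bump_zero power_mono)
  show "schwartz ?\<eta>"
    by (rule schwartz_compact_support[where R=b])
       (intro smooth_mult smooth_inverse smooth_add smooth_bump d0, use z in force)
  show "?\<eta> x = 1" if "norm x \<le> a" for x
  proof -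
    have "?w x = 0" using that assms by (simp add: bump_zero power_mono)
    then show ?thesis using d0[of x] by simp
  qed
qed

section \<open>Multiplication formula and Fourier inversion\<close>

lemma fourier_multiplication:
  fixes f g :: "'a::euclidean_space \<Rightarrow> complex"
  assumes f: "schwartz f" and g: "schwartz g"
  shows "(\<integral>\<xi>. fourier f \<xi> * g \<xi> \<partial>lborel) = (\<integral>x. f x * fourier g x \<partial>lborel)"
proof -
  let ?F = "\<lambda>x \<xi>. f x * g \<xi> * cis (- 2 * pi * (x \<bullet> \<xi>))"
  have "continuous_on UNIV (\<lambda>z::'a \<times> 'a. f (fst z) * g (snd z) * cis (- 2 * pi * (fst z \<bullet> snd z)))"
    by (intro continuous_intros continuous_on_compose2[OF schwartz_cont[OF f]] continuous_on_compose2[OF schwartz_cont[OF g]]) auto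
  then have m: "case_prod ?F \<in> borel_measurable (lborel \<Otimes>\<^sub>M lborel)"
    unfolding lborel_prod by (simp add: case_prod_unfold cont_measurable)
  have ig: "integrable lborel (\<lambda>\<xi>. cmod (g \<xi>))" "integrable lborel (\<lambda>\<xi>. cmod (f \<xi>))"
    using schwartz_integrable f g by (auto intro!: integrable_norm)
  have i: "integrable (lborel \<Otimes>\<^sub>M lborel) (case_prod ?F)"
  proof (rule lborel_pair.Fubini_integrable[OF m])
    show "integrable lborel (\<lambda>x. \<integral>y. cmod (case (x, y) of (x, \<xi>) \<Rightarrow> ?F x \<xi>) \<partial>lborel)"
      using ig by (simp add: norm_mult)
    show "AE x in lborel. integrable lborel (\<lambda>y. case (x, y) of (x, \<xi>) \<Rightarrow> ?F x \<xi>)"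
      unfolding prod.case
      by (intro AE_I2 integrable_mult_cis integrable_mult_right schwartz_integrable g) measurable
  qed
  have "(\<integral>\<xi>. fourier f \<xi> * g \<xi> \<partial>lborel) = (\<integral>\<xi>. (\<integral>x. ?F x \<xi> \<partial>lborel) \<partial>lborel)"
    unfolding fourier_lborel[OF schwartz_cont[OF f]] integral_mult_left_zero[symmetric] by (simp add: mult_ac)
  also have "\<dots> = (\<integral>x. (\<integral>\<xi>. ?F x \<xi> \<partial>lborel) \<partial>lborel)"
    by (rule lborel_pair.Fubini_integral[OF i])
  also have "\<dots> = (\<integral>x. f x * fourier g x \<partial>lborel)"
    unfolding fourier_lborel[OF schwartz_cont[OF g]] integral_mult_right_zero[symmetric]
    by (simp add: mult_ac inner_commute)
  finally show ?thesis .
qed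

text \<open>Insert the dilate G(t xi) into the multiplication formula, rescale the other side so
  that the dilation falls on f, and let t tend to 0; dominated convergence applies to both
  sides.\<close>

lemma fourier_inversion_at_0:
  fixes f G :: "'a::euclidean_space \<Rightarrow> complex"
  assumes f: "schwartz f" and G: "schwartz G"
  shows "(\<integral>\<xi>. fourier f \<xi> \<partial>lborel) * G 0 = f 0 * (\<integral>\<xi>. fourier G \<xi> \<partial>lborel)"
proof -
  define t where "t n = 1 / real (Suc n)" for n
  have t: "0 < t n" for n by (auto simp: t_def)
  have t0: "t \<longlonglongrightarrow> 0" unfolding t_def using LIMSEQ_inverse_real_of_nat by (simp add: inverse_eq_divide)
  have tx: "(\<lambda>n. t n *\<^sub>R x) \<longlonglongrightarrow> 0" for x :: 'a using tendsto_scaleR[OF t0 tendsto_const] by force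
  have dom: "(\<lambda>n. \<integral>x. u x * w (t n *\<^sub>R x) \<partial>lborel) \<longlonglongrightarrow> (\<integral>x. u x * w 0 \<partial>lborel)"
    if u: "schwartz u" and w: "schwartz w" for u w :: "'a \<Rightarrow> complex"
  proof -
    obtain C where C: "\<And>x. cmod (w x) \<le> C / (1 + norm x) ^ 0" using rapid_bound[OF schwartz_rapid[OF w]] by metis
    show ?thesis
    proof (rule integral_dominated_convergence[where w="\<lambda>x. C * cmod (u x)"])
      show "integrable lborel (\<lambda>x. C * cmod (u x))"
        by (intro integrable_mult_right integrable_norm schwartz_integrable u)
      show "AE x in lborel. (\<lambda>n. u x * w (t n *\<^sub>R x)) \<longlonglongrightarrow> u x * w 0"
        using continuous_on_tendsto_compose[OF schwartz_cont[OF w] tx]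
        by (intro AE_I2 tendsto_mult tendsto_const) auto
      show "AE x in lborel. norm (u x * w (t n *\<^sub>R x)) \<le> C * cmod (u x)" for n
        using C by (intro AE_I2) (simp add: norm_mult mult_left_mono mult.commute[of C])
      have "continuous_on UNIV (\<lambda>x. u x * w (t n *\<^sub>R x))" for n
        by (intro continuous_intros continuous_on_compose2[OF schwartz_cont[OF w]] schwartz_cont[OF u]) auto
      then show "(\<lambda>x. u x * w (t n *\<^sub>R x)) \<in> borel_measurable lborel" for n by (simp add: cont_measurable)
      show "(\<lambda>x. u x * w 0) \<in> borel_measurable lborel"
        by (simp, intro cont_measurable continuous_intros schwartz_cont u)
    qed
  qed
  have e: "(\<integral>\<xi>. fourier f \<xi> * G (t n *\<^sub>R \<xi>) \<partial>lborel) = (\<integral>y. fourier G y * f (t n *\<^sub>R y) \<partial>lborel)" for n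
  proof -
    have sG: "schwartz (\<lambda>\<xi>. G (t n *\<^sub>R \<xi>))" using schwartz_affine[OF G, of "t n" 0] t[of n] by simp
    have "(\<integral>\<xi>. fourier f \<xi> * G (t n *\<^sub>R \<xi>) \<partial>lborel) = (\<integral>x. f x * fourier (\<lambda>\<xi>. G (t n *\<^sub>R \<xi>)) x \<partial>lborel)"
      by (rule fourier_multiplication[OF f sG])
    also have "\<dots> = (\<integral>x. f x * (fourier G (x /\<^sub>R t n) / of_real (\<bar>t n\<bar> ^ DIM('a))) \<partial>lborel)"
      using t[of n] by (subst fourier_affine[OF G]) auto
    also have "\<dots> = \<bar>t n\<bar> ^ DIM('a) *\<^sub>R (\<integral>x. f (0 + t n *\<^sub>R x) * (fourier G ((0 + t n *\<^sub>R x) /\<^sub>R t n) / of_real (\<bar>t n\<bar> ^ DIM('a))) \<partial>lborel)"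
      using t[of n]
      by (intro integral_affine cont_measurable continuous_intros schwartz_cont f
          continuous_on_compose2[OF schwartz_cont[OF schwartz_fourier[OF G]]]) auto
    also have "\<dots> = (\<integral>y. fourier G y * f (t n *\<^sub>R y) \<partial>lborel)"
      using t[of n] by (simp add: scaleR_conv_of_real mult.commute)
    finally show ?thesis .
  qed
  have "(\<integral>\<xi>. fourier f \<xi> * G 0 \<partial>lborel) = (\<integral>\<xi>. fourier G \<xi> * f 0 \<partial>lborel)"
    using LIMSEQ_unique[OF dom[OF schwartz_fourier[OF f] G, unfolded e] dom[OF schwartz_fourier[OF G] f]] .
  then show ?thesis by (simp add: mult.commute)
qed

lemma integral_zero_imp_zero:
  fixes g :: "'a::euclidean_space \<Rightarrow> real"
  assumes "continuous_on UNIV g" "\<And>x. 0 \<le> g x" "integrable lborel g" "(\<integral>x. g x \<partial>lborel) = 0"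
  shows "g x = 0"
proof (rule ccontr)
  assume "g x \<noteq> 0"
  then have x: "x \<in> {y. 0 < g y}" using assms(2)[of x] by simp
  have "open {y. 0 < g y}" by (intro open_Collect_less continuous_intros assms)
  moreover have "AE y in lborel. g y = 0"
    using integral_nonneg_eq_0_iff_AE[OF assms(3)] assms by simp
  then have "AE y in lborel. y \<notin> {y. 0 < g y}" by eventually_elim auto
  then have "{y. 0 < g y} \<in> null_sets lborel"
    using \<open>open {y. 0 < g y}\<close> by (subst (asm) AE_iff_null_sets[symmetric]) auto
  then have "negligible {y. 0 < g y}" by (simp add: negligible_iff_null_sets null_sets_completionI)
  ultimately show False using open_not_negligible x by blast
qed

text \<open>The value of the constant c (which is 1) is never needed.\<close>

lemma fourier_inversion:
  obtains c :: complex where "c \<noteq> 0"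
    "\<And>f x. schwartz (f :: 'a::euclidean_space \<Rightarrow> complex) \<Longrightarrow> fourier (fourier f) x = c * f (- x)"
proof -
  obtain G :: "'a \<Rightarrow> complex" where G: "schwartz G" "\<And>x. norm x \<le> 1 \<Longrightarrow> G x = 1" "\<And>x. 2 \<le> norm x \<Longrightarrow> G x = 0"
    using plateau_exists[of 1 2] by auto
  define c where "c = (\<integral>\<xi>. fourier G \<xi> \<partial>lborel)"
  have inv: "fourier (fourier f) x = c * f (- x)" if f: "schwartz f" for f :: "'a \<Rightarrow> complex" and x
  proof -
    \<comment> \<open>A translation by -x reduces the claim to the origin.\<close>
    have "(\<integral>\<xi>. fourier (\<lambda>y. f (y + - x)) \<xi> \<partial>lborel) = f (- x) * c"
      using fourier_inversion_at_0[OF schwartz_shift[OF f, of "- x"] G(1)] G(2)[of 0] by (simp add: c_def)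
    moreover have "fourier (fourier f) x = (\<integral>\<xi>. fourier (\<lambda>y. f (y + - x)) \<xi> \<partial>lborel)"
      unfolding fourier_shift[OF schwartz_cont[OF f]] fourier_lborel[OF schwartz_cont[OF schwartz_fourier[OF f]]]
      by (simp add: mult.commute inner_commute)
    ultimately show ?thesis by simp
  qed
  \<comment> \<open>If c were 0, applying the transform twice would give 0, and the multiplication
    formula would make the square integral of every transform vanish. Then the transform of |G|^2
    would be 0 at frequency 0, although G is continuous with G(0) = 1.\<close>
  have "c \<noteq> 0"
  proof
    assume "c = 0"
    then have z: "fourier (fourier f) = (\<lambda>x. 0)" if "schwartz f" for f :: "'a \<Rightarrow> complex"
      using inv[OF that] by auto
    have zero: "g x = 0" if "schwartz g" "\<And>x. \<exists>r\<ge>0. g x = of_real (r::real)" "(\<integral>x. g x \<partial>lborel) = 0" for g :: "'a \<Rightarrow> complex" and x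
    proof -
      have g: "g x = of_real (Re (g x))" "0 \<le> Re (g x)" for x using that(2)[of x] by auto
      have "integrable lborel (\<lambda>x. Re (g x))" using schwartz_integrable[OF that(1)] by (rule integrable_Re)
      moreover have "(\<integral>x. Re (g x) \<partial>lborel) = 0"
        using integral_Re[OF schwartz_integrable[OF that(1)]] that(3) by simp
      moreover have "continuous_on UNIV (\<lambda>x. Re (g x))" by (intro continuous_intros schwartz_cont that(1))
      ultimately have "Re (g x) = 0" using integral_zero_imp_zero g(2) by blast
      then show ?thesis using g(1) by (metis of_real_0)
    qed
    have sq: "g x = 0" if g: "schwartz g" "(\<integral>x. g x * cnj (g x) \<partial>lborel) = 0" for g :: "'a \<Rightarrow> complex" and x
    proof -
      have "g x * cnj (g x) = 0"
      proof (rule zero)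
        show "schwartz (\<lambda>x. g x * cnj (g x))" by (intro schwartz_mult schwartz_cnj g(1))
        show "\<exists>r\<ge>0. g x * cnj (g x) = of_real r" for x
          by (rule exI[of _ "(cmod (g x))\<^sup>2"]) (simp only: complex_norm_square, simp)
      qed (rule g(2))
      then show ?thesis by simp
    qed
    have F0: "fourier g \<xi> = 0" if g: "schwartz g" for g :: "'a \<Rightarrow> complex" and \<xi>
    proof -
      \<comment> \<open>Chosen so that its transform is the conjugate of that of
        \<open>g\<close>.\<close>
      define h where "h = (\<lambda>x. cnj (g (- x)))"
      have h: "schwartz h" unfolding h_def using schwartz_cnj[OF schwartz_reflect[OF g, of 0]] by simp
      have fh: "fourier h = (\<lambda>\<xi>. cnj (fourier g \<xi>))" unfolding h_def using fourier_cnj_reflect[OF g] by blast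
      have "(\<integral>\<xi>. fourier g \<xi> * fourier h \<xi> \<partial>lborel) = (\<integral>x. g x * fourier (fourier h) x \<partial>lborel)"
        by (rule fourier_multiplication[OF g schwartz_fourier[OF h]])
      then have "(\<integral>\<xi>. fourier g \<xi> * cnj (fourier g \<xi>) \<partial>lborel) = 0"
        unfolding z[OF h] unfolding fh by simp
      then show ?thesis by (rule sq[OF schwartz_fourier[OF g]])
    qed
    have "schwartz (\<lambda>x. G x * cnj (G x))" by (intro schwartz_mult schwartz_cnj G)
    from F0[OF this, of 0] fourier_lborel[OF schwartz_cont[OF this], of 0]
    have "(\<integral>x. G x * cnj (G x) \<partial>lborel) = 0" by simp
    from sq[OF G(1) this, of 0] G(2)[of 0] show False by simp
  qed
  with inv that show thesis by blast
qed

lemma fourier_reflect: "schwartz f \<Longrightarrow> fourier (\<lambda>x. f (- x)) \<xi> = fourier f (- \<xi>)"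
  using fourier_affine[of f "-1" \<xi>] by simp

lemma schwartz_minus_arg: "schwartz f \<Longrightarrow> schwartz (\<lambda>x. f (- x))"
  using schwartz_reflect[of f 0] by simp

lemma fourier_inject:
  assumes "schwartz f" "schwartz g" "\<And>\<xi>. fourier f \<xi> = fourier g \<xi>"
  shows "f = g"
proof -
  obtain c :: complex where c: "c \<noteq> 0" "\<And>f x. schwartz (f :: 'a \<Rightarrow> complex) \<Longrightarrow> fourier (fourier f) x = c * f (- x)"
    using fourier_inversion by metis
  have "fourier f = fourier g" using assms by auto
  then have "f (- (- x)) = g (- (- x))" for x using c assms by (metis mult_left_cancel)
  then show ?thesis by auto
qed

text \<open>This turns cutoffs and quotients built on the frequency side into Schwartz
  kernels.\<close>

lemma fourier_surj:
  assumes u: "schwartz (u :: 'a::euclidean_space \<Rightarrow> complex)"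
  obtains f where "schwartz f" "\<And>\<xi>. fourier f \<xi> = u \<xi>"
proof -
  obtain c :: complex where c: "c \<noteq> 0" "\<And>f x. schwartz (f :: 'a \<Rightarrow> complex) \<Longrightarrow> fourier (fourier f) x = c * f (- x)"
    using fourier_inversion by metis
  define f where "f = (\<lambda>x. inverse c * fourier u (- x))"
  have s: "schwartz (\<lambda>x. fourier u (- x))" by (rule schwartz_minus_arg[OF schwartz_fourier[OF u]])
  have "schwartz f" unfolding f_def by (rule schwartz_cmult[OF s])
  moreover have "fourier f \<xi> = u \<xi>" for \<xi>
    unfolding f_def fourier_cmult[OF s] fourier_reflect[OF schwartz_fourier[OF u]] c(2)[OF u] using c(1) by simp
  ultimately show thesis by (rule that)
qed

section \<open>Convolution of Schwartz functions\<close>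

definition conv :: "('a::euclidean_space \<Rightarrow> complex) \<Rightarrow> ('a \<Rightarrow> complex) \<Rightarrow> 'a \<Rightarrow> complex" where
  "conv f g x = (\<integral>y. f y * g (x - y) \<partial>lborel)"

text \<open>Up to the constant c, g(x - y) is the double transform in y of a translate of g. Moving
  one transform onto f shows that c times the convolution at x is the transform of Ff Fg at -x,
  hence Schwartz; inverting once more yields the product formula.\<close>

lemma conv_schwartz_fourier:
  fixes f g :: "'a::euclidean_space \<Rightarrow> complex"
  assumes f: "schwartz f" and g: "schwartz g"
  shows "schwartz (conv f g)" "fourier (conv f g) \<xi> = fourier f \<xi> * fourier g \<xi>"
proof -
  obtain c :: complex where c: "c \<noteq> 0" "\<And>f x. schwartz (f :: 'a \<Rightarrow> complex) \<Longrightarrow> fourier (fourier f) x = c * f (- x)"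
    using fourier_inversion by metis
  let ?p = "\<lambda>\<xi>. fourier f \<xi> * fourier g \<xi>"
  have p: "schwartz ?p" by (intro schwartz_mult schwartz_fourier f g)
  have fp: "schwartz (fourier ?p)" by (rule schwartz_fourier[OF p])
  have e: "c * conv f g x = fourier ?p (- x)" for x
  proof -
    let ?g = "\<lambda>y. g (y + x)"
    have sg: "schwartz ?g" by (rule schwartz_shift[OF g])
    have "c * conv f g x = (\<integral>y. f y * fourier (fourier ?g) y \<partial>lborel)"
      unfolding conv_def c(2)[OF sg] integral_mult_right_zero[symmetric]
      by (simp add: mult_ac)
    also have "\<dots> = (\<integral>\<xi>. fourier f \<xi> * fourier ?g \<xi> \<partial>lborel)"
      by (rule fourier_multiplication[OF f schwartz_fourier[OF sg], symmetric])
    also have "\<dots> = fourier ?p (- x)"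
      unfolding fourier_shift[OF schwartz_cont[OF g]] fourier_lborel[OF schwartz_cont[OF p]]
      by (simp add: mult_ac inner_commute)
    finally show ?thesis .
  qed
  have conv: "conv f g = (\<lambda>x. inverse c * fourier ?p (- x))"
    using e c(1) by (auto simp: field_simps)
  show "schwartz (conv f g)" unfolding conv by (rule schwartz_cmult[OF schwartz_minus_arg[OF fp]])
  show "fourier (conv f g) \<xi> = fourier f \<xi> * fourier g \<xi>"
    unfolding conv fourier_cmult[OF schwartz_minus_arg[OF fp]] fourier_reflect[OF fp] c(2)[OF p]
    using c(1) by simp
qed

text \<open>From here on, identities between convolutions are verified pointwise on the frequency
  side.\<close>

lemma conv_eqI:
  assumes "schwartz f" "schwartz g" "schwartz h" "\<And>\<xi>. fourier f \<xi> * fourier g \<xi> = fourier h \<xi>"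
  shows "conv f g = h"
  by (rule fourier_inject) (simp_all add: conv_schwartz_fourier assms)

lemma conv_commute: "schwartz f \<Longrightarrow> schwartz g \<Longrightarrow> conv f g = conv g f"
  by (rule conv_eqI) (simp_all add: conv_schwartz_fourier mult.commute)

lemma pd_conv: "schwartz f \<Longrightarrow> schwartz g \<Longrightarrow> b \<in> Basis \<Longrightarrow> pd b (conv f g) = conv f (pd b g)"
  by (rule conv_eqI[symmetric]) (simp_all add: conv_schwartz_fourier fourier_pd schwartz_pd mult_ac)

lemma partials_conv:
  assumes "schwartz f" "schwartz g" "set bs \<subseteq> Basis"
  shows "partials bs (conv f g) = conv f (partials bs g)"
  using assms(3)
proof (induction bs)
  case (Cons b bs)
  then show ?case
    using pd_conv[OF assms(1) schwartz_partials[OF assms(2), of bs], of b] by (simp add: pd_def)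
qed simp

section \<open>Seminorm estimates for dilated convolutions\<close>

lemma seminorm_set_finite: "finite {bs. set bs \<subseteq> (Basis :: 'a::euclidean_space set) \<and> length bs \<le> M}"
  by (rule finite_lists_length_le) simp

text \<open>A supremum of reals is informative only for a bounded set; the finitely many derivative
  lists \<open>bs\<close> contribute one bound each.\<close>

lemma seminorm_bdd:
  assumes "schwartz f"
  shows "bdd_above {(1 + norm x) ^ M * cmod (partials bs f x) | x bs. set bs \<subseteq> Basis \<and> length bs \<le> M}"
proof -
  have "\<exists>C. \<forall>x. (1 + norm x) ^ M * cmod (partials bs f x) \<le> C" if "set bs \<subseteq> Basis" for bs
    using assms that unfolding schwartz_def by blast
  then obtain C where C: "\<And>bs x. set bs \<subseteq> Basis \<Longrightarrow> (1 + norm x) ^ M * cmod (partials bs f x) \<le> C bs" by metis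
  show ?thesis
  proof (rule bdd_aboveI[where M="Max (C ` {bs. set bs \<subseteq> Basis \<and> length bs \<le> M})"], clarify)
    fix x bs assume bs: "set bs \<subseteq> (Basis::'a set)" "length bs \<le> M"
    show "(1 + norm x) ^ M * cmod (partials bs f x) \<le> Max (C ` {bs. set bs \<subseteq> Basis \<and> length bs \<le> M})"
      using C[OF bs(1), of x] bs by (intro order_trans[OF _ Max_ge]) (auto intro: finite_imageI seminorm_set_finite)
  qed
qed

lemma seminorm_upper:
  assumes "schwartz f" "set bs \<subseteq> Basis" "length bs \<le> M"
  shows "(1 + norm x) ^ M * cmod (partials bs f x) \<le> schwartz_seminorm M f"
  unfolding schwartz_seminorm_def by (rule cSup_upper[OF _ seminorm_bdd[OF assms(1)]]) (use assms in auto)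

lemma seminorm_least:
  fixes f :: "'a::euclidean_space \<Rightarrow> complex"
  assumes "\<And>x bs. set bs \<subseteq> Basis \<Longrightarrow> length bs \<le> M \<Longrightarrow> (1 + norm x) ^ M * cmod (partials bs f x) \<le> B"
  shows "schwartz_seminorm M f \<le> B"
  unfolding schwartz_seminorm_def
proof (rule cSup_least)
  have "\<exists>bs. set bs \<subseteq> (Basis::'a set) \<and> length bs \<le> M" by (intro exI[of _ "[]"]) auto
  then show "{(1 + norm x) ^ M * cmod (partials bs f x) | x bs. set bs \<subseteq> Basis \<and> length bs \<le> M} \<noteq> {}" by blast
qed (use assms in auto)

lemma seminorm_bound: "schwartz f \<Longrightarrow> cmod (f x) \<le> schwartz_seminorm M f / (1 + norm x) ^ M"
  using seminorm_upper[of f "[]" M x] by (simp add: field_simps add_pos_nonneg)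

lemma seminorm_nonneg: "schwartz f \<Longrightarrow> 0 \<le> schwartz_seminorm M f"
  using order_trans[OF _ seminorm_upper[of f "[]" M 0]] by simp

lemma seminorm_mono:
  assumes "schwartz f" "M \<le> M'"
  shows "schwartz_seminorm M f \<le> schwartz_seminorm M' f"
proof (rule seminorm_least)
  fix x :: 'a and bs assume bs: "set bs \<subseteq> (Basis::'a set)" "length bs \<le> M"
  have "(1 + norm x) ^ M * cmod (partials bs f x) \<le> (1 + norm x) ^ M' * cmod (partials bs f x)"
    by (intro mult_right_mono power_increasing assms) auto
  also have "\<dots> \<le> schwartz_seminorm M' f" using bs assms by (intro seminorm_upper) auto
  finally show "(1 + norm x) ^ M * cmod (partials bs f x) \<le> schwartz_seminorm M' f" .
qed

lemma seminorm_pd: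
  assumes f: "schwartz f" and b: "b \<in> Basis"
  shows "schwartz_seminorm M (pd b f) \<le> schwartz_seminorm (Suc M) f"
proof (rule seminorm_least)
  fix x :: 'a and bs assume bs: "set bs \<subseteq> (Basis::'a set)" "length bs \<le> M"
  have "(1 + norm x) ^ M * cmod (partials bs (pd b f) x) \<le> (1 + norm x) ^ Suc M * cmod (partials (bs @ [b]) f x)"
    unfolding partials_snoc by (intro mult_right_mono power_increasing) auto
  also have "\<dots> \<le> schwartz_seminorm (Suc M) f" using bs b by (intro seminorm_upper f) auto
  finally show "(1 + norm x) ^ M * cmod (partials bs (pd b f) x) \<le> schwartz_seminorm (Suc M) f" .
qed

text \<open>The normalisation preserves the integral, so on the frequency side only the argument is
  rescaled; \<open>phi_seq\<close> uses a = 2^v for v >= 1.\<close>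

definition dil :: "real \<Rightarrow> ('a::euclidean_space \<Rightarrow> complex) \<Rightarrow> 'a \<Rightarrow> complex" where
  "dil a f x = of_real (a ^ DIM('a)) * f (a *\<^sub>R x)"

lemma schwartz_dil: "schwartz f \<Longrightarrow> 0 < a \<Longrightarrow> schwartz (dil a f)"
  unfolding dil_def[abs_def] using schwartz_affine[of f a 0] by (intro schwartz_cmult) simp

lemma fourier_dil:
  assumes "schwartz f" "0 < a"
  shows "fourier (dil a f) \<xi> = fourier f (\<xi> /\<^sub>R a)"
proof -
  have s: "schwartz (\<lambda>x. f (a *\<^sub>R x))" using schwartz_affine[of f a 0] assms by simp
  show ?thesis
    unfolding dil_def[abs_def] using assms by (simp add: fourier_cmult[OF s] fourier_affine)
qed

text \<open>After the substitution the dilation sits in the shift y/a, which for a >= 1 is no longer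
  than y. This makes the later estimates uniform in a.\<close>

lemma conv_dil:
  fixes f g :: "'a::euclidean_space \<Rightarrow> complex"
  assumes f: "schwartz f" and g: "schwartz g" and a: "0 < a"
  shows "conv (dil a f) g x = (\<integral>y. f y * g (x - y /\<^sub>R a) \<partial>lborel)"
proof -
  have "(\<integral>y. f y * g (x - y /\<^sub>R a) \<partial>lborel) = \<bar>a\<bar> ^ DIM('a) *\<^sub>R (\<integral>y. f (0 + a *\<^sub>R y) * g (x - (0 + a *\<^sub>R y) /\<^sub>R a) \<partial>lborel)"
    using a by (intro integral_affine cont_measurable continuous_intros schwartz_cont f continuous_on_compose2[OF schwartz_cont[OF g]]) auto
  also have "\<dots> = conv (dil a f) g x"
    using a by (simp add: conv_def dil_def scaleR_conv_of_real mult.assoc)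
  finally show ?thesis by simp
qed

lemma peetre_le:
  assumes "norm ((x::'a::real_normed_vector) - y) \<le> r"
  shows "(1 + norm x) ^ k \<le> (1 + norm y) ^ k * (1 + r) ^ k"
  by (rule order_trans[OF peetre mult_left_mono[OF power_mono]]) (use assms in auto)

text \<open>Peetre's inequality splits the weight at x into weights at x - y/a and at y; the former
  is paid by the seminorm of g, the latter by the decay of f.\<close>

lemma conv_dil_decay:
  fixes f :: "'a::euclidean_space \<Rightarrow> complex"
  assumes f: "schwartz f"
  obtains C where "0 \<le> C" "\<And>a g x. 1 \<le> a \<Longrightarrow> schwartz g \<Longrightarrow>
    cmod (conv (dil a f) g x) \<le> C * schwartz_seminorm K g / (1 + norm x) ^ K"
proof
  define C where "C = (\<integral>y. (1 + norm y) ^ K * cmod (f y) \<partial>lborel)"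
  have int: "integrable lborel (\<lambda>y. (1 + norm y) ^ K * cmod (f y))"
    by (rule rapid_integrable(1)[OF schwartz_cont schwartz_rapid]; rule f)
  show "0 \<le> C" unfolding C_def by (intro Bochner_Integration.integral_nonneg) simp
  fix a :: real and g :: "'a \<Rightarrow> complex" and x assume a: "1 \<le> a" and g: "schwartz g"
  let ?S = "schwartz_seminorm K g"
  have le: "cmod (f y * g (x - y /\<^sub>R a)) \<le> ?S / (1 + norm x) ^ K * ((1 + norm y) ^ K * cmod (f y))" for y
  proof -
    have "norm (y /\<^sub>R a) \<le> norm y" using a by (simp add: mult_left_le_one_le inverse_le_1_iff)
    then have "(1 + norm x) ^ K \<le> (1 + norm (x - y /\<^sub>R a)) ^ K * (1 + norm y) ^ K"
      by (intro peetre_le) simp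
    then have "?S * (1 + norm x) ^ K \<le> ?S * ((1 + norm (x - y /\<^sub>R a)) ^ K * (1 + norm y) ^ K)"
      by (intro mult_left_mono seminorm_nonneg g)
    then have "?S / (1 + norm (x - y /\<^sub>R a)) ^ K \<le> ?S / (1 + norm x) ^ K * (1 + norm y) ^ K"
      by (simp add: field_simps add_pos_nonneg)
    then have "cmod (g (x - y /\<^sub>R a)) \<le> ?S / (1 + norm x) ^ K * (1 + norm y) ^ K"
      using seminorm_bound[OF g] order_trans by blast
    then have "cmod (f y) * cmod (g (x - y /\<^sub>R a)) \<le> cmod (f y) * (?S / (1 + norm x) ^ K * (1 + norm y) ^ K)"
      by (rule mult_left_mono) simp
    then show ?thesis by (simp add: norm_mult mult_ac)
  qed
  have i2: "integrable lborel (\<lambda>y. ?S / (1 + norm x) ^ K * ((1 + norm y) ^ K * cmod (f y)))"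
    by (intro integrable_mult_right int)
  have "cmod (conv (dil a f) g x) = cmod (\<integral>y. f y * g (x - y /\<^sub>R a) \<partial>lborel)"
    using a by (simp add: conv_dil[OF f g])
  also have "\<dots> \<le> (\<integral>y. ?S / (1 + norm x) ^ K * ((1 + norm y) ^ K * cmod (f y)) \<partial>lborel)"
  proof (rule Bochner_Integration.integral_norm_bound_integral[OF _ i2 le])
    show "integrable lborel (\<lambda>y. f y * g (x - y /\<^sub>R a))"
    proof (rule Bochner_Integration.integrable_bound[OF i2])
      show "(\<lambda>y. f y * g (x - y /\<^sub>R a)) \<in> borel_measurable lborel"
        by (subst measurable_lborel2, intro cont_measurable continuous_intros schwartz_cont f continuous_on_compose2[OF schwartz_cont[OF g]]) auto
    qed (use order_trans[OF le abs_ge_self] in simp)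
  qed
  also have "\<dots> = C * ?S / (1 + norm x) ^ K" by (simp only: integral_mult_right_zero C_def) simp
  finally show "cmod (conv (dil a f) g x) \<le> C * ?S / (1 + norm x) ^ K" .
qed

lemma conv_cmult: "conv f (\<lambda>x. c * g x) x = c * conv f g x"
  unfolding conv_def by (simp add: mult.left_commute)

lemma conv_sum:
  assumes "schwartz f" "\<And>i. i \<in> I \<Longrightarrow> schwartz (g i)"
  shows "conv f (\<lambda>x. \<Sum>i\<in>I. g i x) = (\<lambda>x. \<Sum>i\<in>I. conv f (g i) x)"
  by (rule conv_eqI) (use assms in \<open>auto simp: fourier_sum conv_schwartz_fourier sum_distrib_left intro!: schwartz_sum\<close>)

text \<open>A function whose Fourier transform vanishes near the origin is a Laplacian, and each
  Laplacian moved to the other factor gains two powers of the dilation parameter.\<close>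

lemma vanishing_low_freq_decay:
  fixes f :: "'a::euclidean_space \<Rightarrow> complex"
  assumes "schwartz f" and \<delta>: "0 < \<delta>" and "\<And>\<xi>. norm \<xi> < \<delta> \<Longrightarrow> fourier f \<xi> = 0"
    and "\<And>\<xi>. R < norm \<xi> \<Longrightarrow> fourier f \<xi> = 0"
  shows "\<exists>C M. 0 \<le> C \<and> (\<forall>a g x. 1 \<le> a \<longrightarrow> schwartz g \<longrightarrow>
    cmod (conv (dil a f) g x) \<le> C * schwartz_seminorm M g / (a ^ (2 * N) * (1 + norm x) ^ K))"
  using assms(1,3,4)
proof (induction N arbitrary: f)
  case 0
  show ?case using conv_dil_decay[OF 0(1), of K] by (metis mult_1 mult_zero_right power_0)
next
  case (Suc N f)
  have bz: "(bump (\<delta>\<^sup>2) (-1) x = 0) \<longleftrightarrow> \<delta> \<le> norm x" for x :: 'a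
  proof
    assume "bump (\<delta>\<^sup>2) (-1) x = 0"
    then have "\<not> \<delta>\<^sup>2 + -1 * (norm x)\<^sup>2 > 0" using bump_pos[of "\<delta>\<^sup>2" "-1" x] by auto
    then show "\<delta> \<le> norm x" using power_strict_mono[of "norm x" \<delta> 2] by force
  next
    assume "\<delta> \<le> norm x" then show "bump (\<delta>\<^sup>2) (-1) x = 0" using \<delta> by (simp add: bump_zero power_mono)
  qed
  \<comment> \<open>Division by |xi|^2: the auxiliary bump is positive exactly for |xi| < delta,
    where the transform of \<open>f\<close> vanishes and the divisor may be 0.\<close>
  obtain v where v: "schwartz v" "\<And>\<xi>. fourier f \<xi> = of_real ((norm \<xi>)\<^sup>2) * v \<xi>" "\<And>\<xi>. fourier f \<xi> = 0 \<Longrightarrow> v \<xi> = 0"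
  proof (rule smooth_cutoff_divide[of "fourier f" R "\<lambda>\<xi>. of_real ((norm \<xi>)\<^sup>2)" "bump (\<delta>\<^sup>2) (-1)"])
    show "bump (\<delta>\<^sup>2) (- 1) x = 0" if "fourier f x \<noteq> 0" for x
      using that Suc.prems(2)[of x] by (force simp: bz)
    show "complex_of_real ((norm x)\<^sup>2) \<noteq> 0" if "bump (\<delta>\<^sup>2) (- 1) x = 0" for x :: 'a
      using that \<delta> by (auto simp: bz)
    show "smooth (\<lambda>\<xi>::'a. complex_of_real ((norm \<xi>)\<^sup>2))" by (rule smooth_norm_square)
    show "smooth (fourier f)" by (rule schwartz_smooth[OF schwartz_fourier[OF Suc.prems(1)]])
  qed (use Suc.prems that in \<open>auto intro: smooth_bump bump_nonneg\<close>)
  obtain W where W: "schwartz W" "\<And>\<xi>. fourier W \<xi> = v \<xi>" using fourier_surj[OF v(1)] by metis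
  \<comment> \<open>\<open>v\<close> is zero wherever the transform of \<open>f\<close> is, so
    \<open>W\<close> satisfies the same vanishing conditions and the induction hypothesis applies to
    it.\<close>
  obtain C M where C: "0 \<le> C" "\<And>a g x. 1 \<le> a \<Longrightarrow> schwartz g \<Longrightarrow>
      cmod (conv (dil a W) g x) \<le> C * schwartz_seminorm M g / (a ^ (2 * N) * (1 + norm x) ^ K)"
    using Suc.IH[of W] Suc.prems W v(3) by metis
  \<comment> \<open>The Laplacian acts on the frequency side as -4 pi^2 |xi|^2, and \<open>c\<close>
    undoes this factor. Dilation turns |xi|^2 into |xi / a|^2, whence the coefficient c / a^2
    below.\<close>
  define c where "c = - 1 / (4 * pi\<^sup>2)"
  show ?case
  proof (intro exI conjI allI impI)
    show "0 \<le> \<bar>c\<bar> * real DIM('a) * C" using C by simp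
    fix a :: real and g :: "'a \<Rightarrow> complex" and x assume a: "1 \<le> a" and g: "schwartz g"
    have sg: "schwartz (pd b (pd b g))" if "b \<in> Basis" for b by (intro schwartz_pd g that)
    have "conv (dil a f) g = conv (dil a W) (\<lambda>x. of_real (c / a\<^sup>2) * (\<Sum>b\<in>Basis. pd b (pd b g) x))"
    proof (rule conv_eqI[OF schwartz_dil[OF Suc.prems(1)] g conv_schwartz_fourier(1)[OF schwartz_dil[OF W(1)]]])
      have ss: "schwartz (\<lambda>x. \<Sum>b\<in>Basis. pd b (pd b g) x)" by (intro schwartz_sum sg)
      show s: "schwartz (\<lambda>x. of_real (c / a\<^sup>2) * (\<Sum>b\<in>Basis. pd b (pd b g) x))" by (intro schwartz_cmult ss)
      fix \<xi>
      have "fourier (pd b (pd b g)) \<xi> = - of_real (4 * pi\<^sup>2) * of_real ((b \<bullet> \<xi>)\<^sup>2) * fourier g \<xi>" if "b \<in> Basis" for b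
        by (simp add: fourier_pd schwartz_pd g that power2_eq_square)
      then have "(\<Sum>b\<in>Basis. fourier (pd b (pd b g)) \<xi>) = (\<Sum>b\<in>Basis. - of_real (4 * pi\<^sup>2) * of_real ((b \<bullet> \<xi>)\<^sup>2) * fourier g \<xi>)"
        by simp
      also have "\<dots> = - of_real (4 * pi\<^sup>2) * of_real (\<Sum>b\<in>Basis. (b \<bullet> \<xi>)\<^sup>2) * fourier g \<xi>"
        by (simp add: sum_distrib_left sum_distrib_right)
      also have "(\<Sum>b\<in>Basis. (b \<bullet> \<xi>)\<^sup>2) = (norm \<xi>)\<^sup>2"
        unfolding power2_norm_eq_inner euclidean_inner[of \<xi> \<xi>] by (simp add: power2_eq_square inner_commute)
      finally have S: "(\<Sum>b\<in>Basis. fourier (pd b (pd b g)) \<xi>) = - of_real (4 * pi\<^sup>2) * of_real ((norm \<xi>)\<^sup>2) * fourier g \<xi>" .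
      have cc: "c * (4 * pi\<^sup>2) = -1" by (simp add: c_def)
      have "fourier (conv (dil a W) (\<lambda>x. of_real (c / a\<^sup>2) * (\<Sum>b\<in>Basis. pd b (pd b g) x))) \<xi>
          = v (\<xi> /\<^sub>R a) * (of_real (c / a\<^sup>2) * (- of_real (4 * pi\<^sup>2) * of_real ((norm \<xi>)\<^sup>2) * fourier g \<xi>))"
        using a by (subst conv_schwartz_fourier(2)[OF schwartz_dil[OF W(1)] s])
          (simp_all only: fourier_cmult[OF ss] fourier_sum[OF sg] S, simp_all add: fourier_dil W)
      also have "\<dots> = v (\<xi> /\<^sub>R a) * (of_real (- (c * (4 * pi\<^sup>2)) / a\<^sup>2 * (norm \<xi>)\<^sup>2) * fourier g \<xi>)"
        by simp
      also have "\<dots> = of_real ((norm (\<xi> /\<^sub>R a))\<^sup>2) * v (\<xi> /\<^sub>R a) * fourier g \<xi>"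
        unfolding cc using a by (simp add: power_mult_distrib field_simps)
      also have "\<dots> = fourier (dil a f) \<xi> * fourier g \<xi>"
        using a Suc.prems(1) by (simp add: fourier_dil v(2))
      finally show "fourier (dil a f) \<xi> * fourier g \<xi> = fourier (conv (dil a W) (\<lambda>x. of_real (c / a\<^sup>2) * (\<Sum>b\<in>Basis. pd b (pd b g) x))) \<xi>" ..
    qed (use a in auto)
    moreover have "conv (dil a W) (\<lambda>x. \<Sum>b\<in>Basis. pd b (pd b g) x) = (\<lambda>x. \<Sum>b\<in>Basis. conv (dil a W) (pd b (pd b g)) x)"
      using a by (intro conv_sum schwartz_dil W sg) auto
    ultimately have "conv (dil a f) g x = of_real (c / a\<^sup>2) * (\<Sum>b\<in>Basis. conv (dil a W) (pd b (pd b g)) x)"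
      by (simp only: conv_cmult)
    then have "cmod (conv (dil a f) g x) \<le> \<bar>c\<bar> / a\<^sup>2 * (\<Sum>b\<in>(Basis::'a set). C * schwartz_seminorm (M + 2) g / (a ^ (2 * N) * (1 + norm x) ^ K))"
    proof -
      have "cmod (conv (dil a W) (pd b (pd b g)) x) \<le> C * schwartz_seminorm (M + 2) g / (a ^ (2 * N) * (1 + norm x) ^ K)"
        if b: "b \<in> Basis" for b
      proof -
        have "schwartz_seminorm M (pd b (pd b g)) \<le> schwartz_seminorm (M + 2) g"
          using seminorm_pd[OF schwartz_pd[OF g b] b, of M] seminorm_pd[OF g b, of "Suc M"] by simp
        then have "C * schwartz_seminorm M (pd b (pd b g)) / (a ^ (2 * N) * (1 + norm x) ^ K) \<le> C * schwartz_seminorm (M + 2) g / (a ^ (2 * N) * (1 + norm x) ^ K)"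
          using C(1) a by (intro divide_right_mono mult_left_mono) auto
        then show ?thesis using C(2)[OF a sg[OF b], of x] by linarith
      qed
      then show ?thesis
        unfolding \<open>conv (dil a f) g x = _\<close> norm_mult
        by (intro mult_mono order_trans[OF norm_sum] sum_mono) (auto intro!: sum_nonneg simp: norm_divide norm_power)
    qed
    also have "\<dots> = \<bar>c\<bar> * real DIM('a) * C * schwartz_seminorm (M + 2) g / (a ^ (2 * Suc N) * (1 + norm x) ^ K)"
      by (simp add: power2_eq_square field_simps)
    finally show "cmod (conv (dil a f) g x) \<le> \<bar>c\<bar> * real DIM('a) * C * schwartz_seminorm (M + 2) g / (a ^ (2 * Suc N) * (1 + norm x) ^ K)" .
  qed
qed

text \<open>The value 1 at frequency 0 means that k has integral 1, so the difference is the
  integral of g(x - y/a) - g(x) against k. The mean value estimate bounds it by a moment of k times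
  1/a.\<close>

lemma conv_dil_approx:
  fixes k :: "'a::euclidean_space \<Rightarrow> complex"
  assumes k: "schwartz k" and k1: "fourier k 0 = 1" and g: "schwartz g"
  obtains C where "\<And>a x. 1 \<le> a \<Longrightarrow> (1 + norm x) ^ M * cmod (conv (dil a k) g x - g x) \<le> C / a"
proof -
  obtain L where L: "0 \<le> L" "\<And>b x. b \<in> Basis \<Longrightarrow> cmod (pd b g x) \<le> L / (1 + norm x) ^ M"
  proof
    show "0 \<le> schwartz_seminorm (Suc M) g" by (rule seminorm_nonneg[OF g])
    fix b x :: 'a assume b: "b \<in> Basis"
    have "schwartz_seminorm M (pd b g) / (1 + norm x) ^ M \<le> schwartz_seminorm (Suc M) g / (1 + norm x) ^ M"
      by (intro divide_right_mono seminorm_pd g b) simp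
    then show "cmod (pd b g x) \<le> schwartz_seminorm (Suc M) g / (1 + norm x) ^ M"
      using seminorm_bound[OF schwartz_pd[OF g b], of x M] by linarith
  qed
  define C where "C = real DIM('a) * L * (\<integral>y. (1 + norm y) ^ Suc M * cmod (k y) \<partial>lborel)"
  have int: "integrable lborel (\<lambda>y. (1 + norm y) ^ Suc M * cmod (k y))"
    by (rule rapid_integrable(1)[OF schwartz_cont schwartz_rapid]; rule k)
  show thesis
  proof (rule that)
    fix a :: real and x :: 'a assume a: "1 \<le> a"
    have le: "cmod (k y * (g (x - y /\<^sub>R a) - g x)) \<le> real DIM('a) * L / a / (1 + norm x) ^ M * ((1 + norm y) ^ Suc M * cmod (k y))" for y
    proof -
      have ny: "norm (y /\<^sub>R a) \<le> norm y" using a by (simp add: mult_left_le_one_le inverse_le_1_iff)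
      have "cmod (g x - g (x - y /\<^sub>R a)) \<le> real DIM('a) * (L * (1 + norm y) ^ M / (1 + norm x) ^ M) * norm (x - (x - y /\<^sub>R a))"
      proof (rule diff_norm_le_partials[OF schwartz_differentiable[OF g]])
        fix b z :: 'a assume b: "b \<in> Basis" and z: "z \<in> closed_segment x (x - y /\<^sub>R a)"
        have "norm (x - z) \<le> norm y" using segment_bound1[OF z] ny by (simp add: norm_minus_commute)
        then have "(1 + norm x) ^ M \<le> (1 + norm z) ^ M * (1 + norm y) ^ M"
          by (rule peetre_le)
        then have "L * (1 + norm x) ^ M \<le> L * ((1 + norm z) ^ M * (1 + norm y) ^ M)" by (intro mult_left_mono L)
        then have "L / (1 + norm z) ^ M \<le> L * (1 + norm y) ^ M / (1 + norm x) ^ M"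
          by (simp add: field_simps add_pos_nonneg)
        then show "cmod (pd b g z) \<le> L * (1 + norm y) ^ M / (1 + norm x) ^ M" using L(2)[OF b, of z] by linarith
      qed
      also have "\<dots> = real DIM('a) * L / a / (1 + norm x) ^ M * ((1 + norm y) ^ M * norm y)" using a by (simp add: field_simps)
      also have "\<dots> \<le> real DIM('a) * L / a / (1 + norm x) ^ M * (1 + norm y) ^ Suc M"
        using a L by (intro mult_left_mono) (auto simp: mult.commute intro!: mult_right_mono)
      finally have "cmod (k y) * cmod (g x - g (x - y /\<^sub>R a)) \<le> cmod (k y) * (real DIM('a) * L / a / (1 + norm x) ^ M * (1 + norm y) ^ Suc M)"
        by (rule mult_left_mono) simp
      then show ?thesis unfolding norm_mult norm_minus_commute[of _ "g x"] by (simp only: mult_ac)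
    qed
    have i2: "integrable lborel (\<lambda>y. real DIM('a) * L / a / (1 + norm x) ^ M * ((1 + norm y) ^ Suc M * cmod (k y)))"
      by (intro integrable_mult_right int)
    have i1: "integrable lborel (\<lambda>y. k y * (g (x - y /\<^sub>R a) - g x))"
    proof (rule Bochner_Integration.integrable_bound[OF i2])
      show "(\<lambda>y. k y * (g (x - y /\<^sub>R a) - g x)) \<in> borel_measurable lborel"
        by (subst measurable_lborel2, intro cont_measurable continuous_intros schwartz_cont k continuous_on_compose2[OF schwartz_cont[OF g]]) auto
    qed (use order_trans[OF le abs_ge_self] in simp)
    have "(\<integral>y. k y \<partial>lborel) = 1" using k1 by (simp add: fourier_lborel schwartz_cont k)
    then have "conv (dil a k) g x - g x = (\<integral>y. k y * g (x - y /\<^sub>R a) \<partial>lborel) - (\<integral>y. k y * g x \<partial>lborel)"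
      using a by (simp add: conv_dil k g)
    also have "\<dots> = (\<integral>y. k y * (g (x - y /\<^sub>R a) - g x) \<partial>lborel)"
    proof -
      have ik: "integrable lborel (\<lambda>y. k y * g x)" by (intro integrable_mult_left schwartz_integrable k)
      have "integrable lborel (\<lambda>y. k y * (g (x - y /\<^sub>R a) - g x) + k y * g x)" by (intro Bochner_Integration.integrable_add i1 ik)
      then have "integrable lborel (\<lambda>y. k y * g (x - y /\<^sub>R a))" by (simp add: right_diff_distrib)
      then show ?thesis using ik by (simp add: right_diff_distrib)
    qed
    also have "cmod \<dots> \<le> (\<integral>y. real DIM('a) * L / a / (1 + norm x) ^ M * ((1 + norm y) ^ Suc M * cmod (k y)) \<partial>lborel)"
      by (rule Bochner_Integration.integral_norm_bound_integral[OF i1 i2 le])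
    also have "\<dots> = C / a / (1 + norm x) ^ M" by (simp only: integral_mult_right_zero C_def) simp
    finally show "(1 + norm x) ^ M * cmod (conv (dil a k) g x - g x) \<le> C / a"
      using a by (simp add: field_simps add_pos_nonneg)
  qed
qed

section \<open>Tempered distributions\<close>

lemma partials_shift:
  assumes "schwartz f" "set bs \<subseteq> Basis"
  shows "partials bs (\<lambda>y. f (y + t)) = (\<lambda>y. partials bs f (y + t))"
  using assms(2)
proof (induction bs)
  case (Cons b bs)
  then have "schwartz (partials bs f)" by (intro schwartz_partials assms) auto
  from pd_affine(1)[OF schwartz_differentiable[OF this], of b t 1] Cons show ?case
    by (simp add: pd_def add.commute)
qed simp

lemma partials_cmult:
  assumes "schwartz f" "set bs \<subseteq> Basis"
  shows "partials bs (\<lambda>y. c * f y) = (\<lambda>y. c * partials bs f y)"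
  using assms(2)
proof (induction bs)
  case (Cons b bs)
  then have "schwartz (partials bs f)" by (intro schwartz_partials assms) auto
  from pd_cmult[OF schwartz_differentiable[OF this], of b c] Cons show ?case by (simp add: pd_def)
qed simp

lemma partials_add:
  assumes "schwartz f" "schwartz g" "set bs \<subseteq> Basis"
  shows "partials bs (\<lambda>y. f y + g y) = (\<lambda>y. partials bs f y + partials bs g y)"
  using assms(3)
proof (induction bs)
  case (Cons b bs)
  then have "schwartz (partials bs f)" "schwartz (partials bs g)" by (auto intro!: schwartz_partials assms)
  from pd_add[OF schwartz_differentiable[OF this(1)] schwartz_differentiable[OF this(2)], of b] Cons show ?case by (simp add: pd_def)
qed simp

lemma partials_diff:
  assumes "schwartz f" "schwartz g" "set bs \<subseteq> Basis"
  shows "partials bs (\<lambda>y. f y - g y) = (\<lambda>y. partials bs f y - partials bs g y)"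
  using partials_add[OF assms(1) schwartz_minus[OF assms(2)] assms(3)] partials_cmult[OF assms(2,3), of "-1"] by simp

lemma partials_zero: "set bs \<subseteq> Basis \<Longrightarrow> partials bs (\<lambda>y. 0) = (\<lambda>y. 0)"
  using partials_cmult[OF schwartz_0, of bs 0] by simp

lemma partials_sum:
  assumes "\<And>i. i \<in> I \<Longrightarrow> schwartz (f i)" "set bs \<subseteq> Basis"
  shows "partials bs (\<lambda>y. \<Sum>i\<in>I. f i y) = (\<lambda>y. \<Sum>i\<in>I. partials bs (f i) y)"
  using assms(1)
proof (induction I rule: infinite_finite_induct)
  case (insert i I)
  then show ?case by (simp add: partials_add assms(2) schwartz_sum)
qed (simp_all add: partials_zero assms(2))

text \<open>Merges the constants of the finitely many derivative lists in a seminorm. The parameter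
  \<open>z\<close> packs several points, and \<open>P\<close> is a side condition such as closeness
  of two of them.\<close>

lemma finite_uniform_bound:
  fixes F :: "'s \<Rightarrow> 'z \<Rightarrow> real"
  assumes "finite S" "\<And>s. s \<in> S \<Longrightarrow> \<exists>C. \<forall>z. P z \<longrightarrow> F s z \<le> C * Q z" "\<And>z. P z \<Longrightarrow> 0 \<le> Q z"
  obtains C where "0 \<le> C" "\<And>s z. s \<in> S \<Longrightarrow> P z \<Longrightarrow> F s z \<le> C * Q z"
proof -
  obtain c where c: "\<And>s z. s \<in> S \<Longrightarrow> P z \<Longrightarrow> F s z \<le> c s * Q z" using assms(2) by metis
  show ?thesis
  proof (rule that[of "\<Sum>s\<in>S. \<bar>c s\<bar>"])
    fix s z assume s: "s \<in> S" and z: "P z"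
    have "c s \<le> (\<Sum>s\<in>S. \<bar>c s\<bar>)"
      using member_le_sum[of s S "\<lambda>s. \<bar>c s\<bar>"] s assms(1) by force
    then show "F s z \<le> (\<Sum>s\<in>S. \<bar>c s\<bar>) * Q z"
      using c[OF s z] mult_right_mono[of "c s" "\<Sum>s\<in>S. \<bar>c s\<bar>" "Q z"] assms(3)[OF z] by linarith
  qed (simp add: sum_nonneg)
qed

section \<open>Estimates for translates of Schwartz functions\<close>

lemma translate_bound:
  fixes g :: "'a::euclidean_space \<Rightarrow> complex"
  assumes g: "schwartz g"
  shows "\<exists>C. \<forall>z. (case z of (x, y) \<Rightarrow> (1 + norm y) ^ M * cmod (g (y - x))) \<le> C * (case z of (x, y) \<Rightarrow> (1 + norm x) ^ M)"
proof -
  obtain B where B: "0 \<le> B" "\<And>x. cmod (g x) \<le> B / (1 + norm x) ^ M" using rapid_bound[OF schwartz_rapid[OF g]] by metis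
  have "(1 + norm y) ^ M * cmod (g (y - x)) \<le> B * (1 + norm x) ^ M" for x y
  proof -
    have "(1 + norm y) ^ M * cmod (g (y - x)) \<le> (1 + norm x) ^ M * (1 + norm (y - x)) ^ M * (B / (1 + norm (y - x)) ^ M)"
      by (intro mult_mono peetre B) auto
    also have "\<dots> = B * (1 + norm x) ^ M" by (simp add: add_nonneg_eq_0_iff)
    finally show ?thesis .
  qed
  then show ?thesis by auto
qed

lemma translate_lipschitz:
  fixes g :: "'a::euclidean_space \<Rightarrow> complex"
  assumes g: "schwartz g"
  shows "\<exists>C. \<forall>z. (case z of (x, x', y) \<Rightarrow> norm (x - x') \<le> 1) \<longrightarrow>
    (case z of (x, x', y) \<Rightarrow> (1 + norm y) ^ M * cmod (g (y - x) - g (y - x')))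
      \<le> C * (case z of (x, x', y) \<Rightarrow> norm (x - x') * (1 + norm x) ^ M)"
proof -
  obtain B where B: "0 \<le> B" "\<And>x y. norm (x - y) \<le> 1 \<Longrightarrow> cmod (g x - g y) \<le> B * norm (x - y) / (1 + norm x) ^ M"
    using schwartz_lipschitz[OF g] by metis
  have "(1 + norm y) ^ M * cmod (g (y - x) - g (y - x')) \<le> B * (norm (x - x') * (1 + norm x) ^ M)"
    if "norm (x - x') \<le> 1" for x x' y
  proof -
    have "cmod (g (y - x) - g (y - x')) \<le> B * norm (x - x') / (1 + norm (y - x)) ^ M"
      using B(2)[of "y - x" "y - x'"] that by (simp add: norm_minus_commute)
    then have "(1 + norm y) ^ M * cmod (g (y - x) - g (y - x')) \<le> (1 + norm x) ^ M * (1 + norm (y - x)) ^ M * (B * norm (x - x') / (1 + norm (y - x)) ^ M)"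
      by (intro mult_mono peetre) auto
    also have "\<dots> = B * (norm (x - x') * (1 + norm x) ^ M)" by (simp add: add_nonneg_eq_0_iff)
    finally show ?thesis .
  qed
  then show ?thesis by auto
qed

text \<open>Inserted into the seminorm bound of a tempered distribution, the first estimate becomes
  polynomial growth of \<open>conv_dist\<close> and the second its continuity.\<close>

lemma translate_bounds:
  fixes \<psi> :: "'a::euclidean_space \<Rightarrow> complex"
  assumes \<psi>: "schwartz \<psi>"
  obtains B where "0 \<le> B"
    "\<And>bs x y. set bs \<subseteq> Basis \<Longrightarrow> length bs \<le> M \<Longrightarrow>
      (1 + norm y) ^ M * cmod (partials bs \<psi> (y - x)) \<le> B * (1 + norm x) ^ M"
    "\<And>bs x x' y. set bs \<subseteq> Basis \<Longrightarrow> length bs \<le> M \<Longrightarrow> norm (x - x') \<le> 1 \<Longrightarrow>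
      (1 + norm y) ^ M * cmod (partials bs \<psi> (y - x) - partials bs \<psi> (y - x')) \<le> B * (norm (x - x') * (1 + norm x) ^ M)"
proof -
  let ?S = "{bs. set bs \<subseteq> (Basis :: 'a set) \<and> length bs \<le> M}"
  obtain B where B: "0 \<le> B" "\<And>bs z. bs \<in> ?S \<Longrightarrow> True \<Longrightarrow>
      (case z of (x, y) \<Rightarrow> (1 + norm y) ^ M * cmod (partials bs \<psi> (y - x))) \<le> B * (case z of (x, y::'a) \<Rightarrow> (1 + norm x) ^ M)"
    by (rule finite_uniform_bound[OF seminorm_set_finite, where P="\<lambda>_. True"
        and F="\<lambda>bs z. case z of (x, y) \<Rightarrow> (1 + norm y) ^ M * cmod (partials bs \<psi> (y - x))" and Q="\<lambda>z. case z of (x, y::'a) \<Rightarrow> (1 + norm x) ^ M"])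
       (use translate_bound[OF schwartz_partials[OF \<psi>]] in \<open>auto split: prod.splits\<close>)
  obtain L where L: "0 \<le> L" "\<And>bs z. bs \<in> ?S \<Longrightarrow> (case z of (x, x', y) \<Rightarrow> norm (x - x') \<le> 1) \<Longrightarrow>
      (case z of (x, x', y) \<Rightarrow> (1 + norm y) ^ M * cmod (partials bs \<psi> (y - x) - partials bs \<psi> (y - x'))) \<le> L * (case z of (x, x', y::'a) \<Rightarrow> norm (x - x') * (1 + norm x) ^ M)"
    by (rule finite_uniform_bound[OF seminorm_set_finite, where P="\<lambda>z. case z of (x, x', y) \<Rightarrow> norm (x - x') \<le> 1"
        and F="\<lambda>bs z. case z of (x, x', y) \<Rightarrow> (1 + norm y) ^ M * cmod (partials bs \<psi> (y - x) - partials bs \<psi> (y - x'))"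
        and Q="\<lambda>z. case z of (x, x', y::'a) \<Rightarrow> norm (x - x') * (1 + norm x) ^ M"])
       (use translate_lipschitz[OF schwartz_partials[OF \<psi>]] in \<open>auto split: prod.splits\<close>)
  show ?thesis
  proof (rule that[of "B + L"])
    show "0 \<le> B + L" using B L by simp
    fix bs and x y :: 'a assume bs: "set bs \<subseteq> (Basis :: 'a set)" "length bs \<le> M"
    show "(1 + norm y) ^ M * cmod (partials bs \<psi> (y - x)) \<le> (B + L) * (1 + norm x) ^ M"
      using B(2)[of bs "(x, y)"] bs mult_nonneg_nonneg[OF L(1), of "(1 + norm x) ^ M"] by (simp add: distrib_right)
    fix x' :: 'a assume "norm (x - x') \<le> 1"
    then show "(1 + norm y) ^ M * cmod (partials bs \<psi> (y - x) - partials bs \<psi> (y - x')) \<le> (B + L) * (norm (x - x') * (1 + norm x) ^ M)"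
      using L(2)[of bs "(x, x', y)"] bs mult_nonneg_nonneg[OF B(1), of "norm (x - x') * (1 + norm x) ^ M"] by (simp add: distrib_right)
  qed
qed

section \<open>Convolution of a tempered distribution with a Schwartz function\<close>

locale tempered_dist =
  fixes T :: "('a::euclidean_space \<Rightarrow> complex) \<Rightarrow> complex"
  assumes tempered: "tempered T"
begin

lemma T_linear: "schwartz f \<Longrightarrow> schwartz g \<Longrightarrow> T (\<lambda>x. a * f x + b * g x) = a * T f + b * T g"
  using tempered unfolding tempered_def by blast

lemma T_bound: obtains C M where "0 \<le> C" "\<And>f. schwartz f \<Longrightarrow> cmod (T f) \<le> C * schwartz_seminorm M f"
proof -
  obtain C M where C: "\<And>f. schwartz f \<Longrightarrow> cmod (T f) \<le> C * schwartz_seminorm M f"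
    using tempered unfolding tempered_def by blast
  have "cmod (T f) \<le> \<bar>C\<bar> * schwartz_seminorm M f" if "schwartz f" for f
    using C[OF that] mult_right_mono[OF abs_ge_self seminorm_nonneg[OF that, of M], of C] by linarith
  then show ?thesis using that[of "\<bar>C\<bar>" M] by simp
qed

lemma T_zero: "T (\<lambda>x. 0) = 0"
  using T_linear[OF schwartz_0 schwartz_0, of 0 0] by simp

lemma T_diff: "schwartz f \<Longrightarrow> schwartz g \<Longrightarrow> T (\<lambda>x. f x - g x) = T f - T g"
  using T_linear[of f g 1 "-1"] by simp

lemma T_sum:
  "finite I \<Longrightarrow> (\<And>i. i \<in> I \<Longrightarrow> schwartz (f i)) \<Longrightarrow> T (\<lambda>x. \<Sum>i\<in>I. c i * f i x) = (\<Sum>i\<in>I. c i * T (f i))"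
proof (induction I rule: finite_induct)
  case (insert i I)
  then have "T (\<lambda>x. c i * f i x + 1 * (\<Sum>i\<in>I. c i * f i x)) = c i * T (f i) + 1 * T (\<lambda>x. \<Sum>i\<in>I. c i * f i x)"
    by (intro T_linear schwartz_sum schwartz_cmult) auto
  then show ?case using insert by simp
qed (simp add: T_zero)

text \<open>C and M depend on T through its seminorm bound. The growth serves qualitatively: for
  integrability, and for the finiteness of a supremum in the growth argument.\<close>

lemma conv_dist_growth:
  assumes \<phi>: "schwartz \<phi>"
  obtains C M where "0 \<le> C" "\<And>x. cmod (conv_dist \<phi> T x) \<le> C * (1 + norm x) ^ M"
    "\<And>x x'. norm (x - x') \<le> 1 \<Longrightarrow> cmod (conv_dist \<phi> T x - conv_dist \<phi> T x') \<le> C * (norm (x - x') * (1 + norm x) ^ M)"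
proof -
  obtain CT M where CT: "0 \<le> CT" "\<And>f. schwartz f \<Longrightarrow> cmod (T f) \<le> CT * schwartz_seminorm M f" using T_bound by metis
  define \<psi> where "\<psi> = (\<lambda>y. \<phi> (- y))"
  have \<psi>: "schwartz \<psi>" unfolding \<psi>_def by (rule schwartz_minus_arg[OF \<phi>])
  have cd: "conv_dist \<phi> T x = T (\<lambda>y. \<psi> (y + - x))" for x by (simp add: conv_dist_def \<psi>_def)
  have sh: "schwartz (\<lambda>y. \<psi> (y + - x))" for x by (rule schwartz_shift[OF \<psi>])
  obtain B where B: "0 \<le> B"
    "\<And>bs x y. set bs \<subseteq> Basis \<Longrightarrow> length bs \<le> M \<Longrightarrow>
      (1 + norm y) ^ M * cmod (partials bs \<psi> (y - x)) \<le> B * (1 + norm x) ^ M"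
    "\<And>bs x x' y. set bs \<subseteq> Basis \<Longrightarrow> length bs \<le> M \<Longrightarrow> norm (x - x') \<le> 1 \<Longrightarrow>
      (1 + norm y) ^ M * cmod (partials bs \<psi> (y - x) - partials bs \<psi> (y - x')) \<le> B * (norm (x - x') * (1 + norm x) ^ M)"
    using translate_bounds[OF \<psi>] by blast
  show ?thesis
  proof (rule that[of "CT * B" M])
    show "0 \<le> CT * B" using CT B by simp
    fix x :: 'a
    have "schwartz_seminorm M (\<lambda>y. \<psi> (y + - x)) \<le> B * (1 + norm x) ^ M"
      using B(2) by (intro seminorm_least) (simp add: partials_shift[OF \<psi>, of _ "-x", simplified])
    then have "CT * schwartz_seminorm M (\<lambda>y. \<psi> (y + - x)) \<le> CT * (B * (1 + norm x) ^ M)" by (intro mult_left_mono CT)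
    then show "cmod (conv_dist \<phi> T x) \<le> CT * B * (1 + norm x) ^ M" using CT(2)[OF sh[of x]] unfolding cd by simp
    fix x' :: 'a assume x': "norm (x - x') \<le> 1"
    have "schwartz_seminorm M (\<lambda>y. \<psi> (y + - x) - \<psi> (y + - x')) \<le> B * (norm (x - x') * (1 + norm x) ^ M)"
      using B(3) x'
      by (intro seminorm_least) (simp add: partials_diff[OF sh sh, simplified] partials_shift[OF \<psi>, of _ "-x", simplified] partials_shift[OF \<psi>, of _ "-x'", simplified])
    then have "CT * schwartz_seminorm M (\<lambda>y. \<psi> (y + - x) - \<psi> (y + - x')) \<le> CT * (B * (norm (x - x') * (1 + norm x) ^ M))"
      by (intro mult_left_mono CT)
    then show "cmod (conv_dist \<phi> T x - conv_dist \<phi> T x') \<le> CT * B * (norm (x - x') * (1 + norm x) ^ M)"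
      using CT(2)[OF schwartz_diff[OF sh[of x] sh[of x']]] unfolding cd T_diff[OF sh sh] by simp
  qed
qed

lemma continuous_conv_dist:
  assumes "schwartz \<phi>" shows "continuous_on UNIV (conv_dist \<phi> T)"
proof -
  obtain C M where C: "0 \<le> C"
    "\<And>x x'. norm (x - x') \<le> 1 \<Longrightarrow> cmod (conv_dist \<phi> T x - conv_dist \<phi> T x') \<le> C * (norm (x - x') * (1 + norm x) ^ M)"
    using conv_dist_growth[OF assms] by metis
  have "isCont (conv_dist \<phi> T) x" for x
    unfolding isCont_def
  proof (rule Lim_null[THEN iffD2], rule Lim_null_comparison)
    show "\<forall>\<^sub>F x' in at x. norm (conv_dist \<phi> T x' - conv_dist \<phi> T x) \<le> C * (norm (x - x') * (1 + norm x) ^ M)"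
      using C(2)[of x] unfolding eventually_at
      by (intro exI[of _ 1]) (auto simp: dist_norm norm_minus_commute)
    show "((\<lambda>x'. C * (norm (x - x') * (1 + norm x) ^ M)) \<longlongrightarrow> 0) (at x)" by (auto intro!: tendsto_eq_intros)
  qed
  then show ?thesis by (simp add: continuous_at_imp_continuous_on)
qed

lemma conv_dist_rapid:
  assumes "schwartz \<phi>" "schwartz h" shows "rapid (\<lambda>x. h x * conv_dist \<phi> T x)"
proof -
  obtain C M where "0 \<le> C" "\<And>x. cmod (conv_dist \<phi> T x) \<le> C * (1 + norm x) ^ M"
    using conv_dist_growth[OF assms(1)] by metis
  then show ?thesis by (intro rapid_mult schwartz_rapid assms)
qed

text \<open>T passes through finite sums only, so the convolution is approximated by Riemann sums.
  As T is bounded by a single seminorm of order M, it suffices that the sums converge in that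
  seminorm; their images under T converge to the integral by dominated convergence.\<close>

lemma T_conv:
  assumes \<phi>: "schwartz \<phi>" and h: "schwartz h"
  shows "T (conv h (\<lambda>y. \<phi> (- y))) = (\<integral>x. h x * conv_dist \<phi> T x \<partial>lborel)"
proof -
  let ?G = "conv_dist \<phi> T" and ?n = "DIM('a) + 2"
  obtain CT M where CT: "0 \<le> CT" "\<And>f. schwartz f \<Longrightarrow> cmod (T f) \<le> CT * schwartz_seminorm M f" using T_bound by metis
  define \<psi> where "\<psi> = (\<lambda>y. \<phi> (- y))"
  have \<psi>: "schwartz \<psi>" unfolding \<psi>_def by (rule schwartz_minus_arg[OF \<phi>])
  have cd: "?G x = T (\<lambda>y. \<psi> (y + - x))" for x by (simp add: conv_dist_def \<psi>_def)
  have sh: "schwartz (\<lambda>y. \<psi> (y + - x))" for x by (rule schwartz_shift[OF \<psi>])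
  \<comment> \<open>Simple functions tending to the identity map: their finitely many values are the
    sample points, their level sets the cells.\<close>
  obtain s where s: "\<And>i. simple_function lborel (s i)" "\<And>x::'a. (\<lambda>i. s i x) \<longlonglongrightarrow> x"
    using borel_measurable_implies_sequence_metric[of "\<lambda>x::'a. x" lborel 0] by auto
  \<comment> \<open>Boundedness gives the cells finite measure, and a distance at most 1 to the
    sample point makes the weights at x and \<open>s i x\<close> comparable. Every x lies in
    \<open>D i\<close> for all large i.\<close>
  define D where "D i = {x. norm (s i x - x) \<le> 1 \<and> norm x \<le> real i}" for i
  have sm[measurable]: "s i \<in> borel_measurable borel" for i
    using borel_measurable_simple_function[OF s(1)[of i]] by simp
  have fr: "finite (range (s i))" for i using simple_functionD(1)[OF s(1)[of i]] by simp
  have Dm[measurable]: "D i \<in> sets borel" for i unfolding D_def by measurable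
  have Dfin: "emeasure lborel (D i \<inter> A) < \<infinity>" for i A
  proof -
    have "D i \<inter> A \<subseteq> cball 0 (real i)" by (auto simp: D_def)
    then have "emeasure lborel (D i \<inter> A) \<le> emeasure lborel (cball 0 (real i) :: 'a set)" by (rule emeasure_mono) simp
    also have "\<dots> < \<infinity>" using emeasure_lborel_cbox_finite emeasure_bounded_finite[of "cball 0 (real i) :: 'a set"] by simp
    finally show ?thesis .
  qed
  define m where "m i z = measure lborel (D i \<inter> s i -` {z})" for i z
  have sum: "(\<integral>x. indicator (D i) x *\<^sub>R u (s i x) \<partial>lborel) = (\<Sum>z\<in>range (s i). of_real (m i z) * u z)"
    "integrable lborel (\<lambda>x. indicator (D i) x *\<^sub>R u (s i x))" for i and u :: "'a \<Rightarrow> complex"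
  proof -
    have e: "indicator (D i) x *\<^sub>R u (s i x) = (\<Sum>z\<in>range (s i). indicator (D i \<inter> s i -` {z}) x *\<^sub>R u z)" for x
    proof -
      have "(\<Sum>z\<in>range (s i). indicator (D i \<inter> s i -` {z}) x *\<^sub>R u z) = (\<Sum>z\<in>range (s i). if z = s i x then indicator (D i) x *\<^sub>R u z else 0)"
        by (intro sum.cong) (auto simp: indicator_def)
      then show ?thesis using fr by simp
    qed
    have meas: "D i \<inter> s i -` {z} \<in> sets borel" for z
    proof -
      have "s i -` {z} \<inter> space borel \<in> sets borel" by (rule measurable_sets[OF sm]) simp
      then show ?thesis using Dm[of i] by auto
    qed
    have int: "integrable lborel (\<lambda>x. indicator (D i \<inter> s i -` {z}) x *\<^sub>R u z)" for z
      using meas Dfin by (intro integrable_scaleR_left integrable_real_indicator) auto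
    show "integrable lborel (\<lambda>x. indicator (D i) x *\<^sub>R u (s i x))"
      unfolding e by (intro Bochner_Integration.integrable_sum int)
    show "(\<integral>x. indicator (D i) x *\<^sub>R u (s i x) \<partial>lborel) = (\<Sum>z\<in>range (s i). of_real (m i z) * u z)"
      unfolding e using meas Dfin
      by (subst Bochner_Integration.integral_sum[OF int]) (auto simp: m_def scaleR_conv_of_real less_top intro!: sum.cong)
  qed
  have ev: "\<forall>\<^sub>F i in sequentially. x \<in> D i" for x
  proof -
    have "(\<lambda>i. norm (s i x - x)) \<longlonglongrightarrow> 0" using s(2)[of x] by (simp add: LIM_zero_iff tendsto_norm_zero_iff)
    then have "\<forall>\<^sub>F i in sequentially. norm (s i x - x) < 1" by (rule order_tendstoD) simp
    moreover have "\<forall>\<^sub>F i in sequentially. norm x \<le> real i" 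
      by (rule eventually_mono[OF eventually_ge_at_top[of "nat \<lceil>norm x\<rceil>"]]) linarith
    ultimately show ?thesis by eventually_elim (simp add: D_def)
  qed
  have near: "(1 + norm x) ^ k \<le> 2 ^ k * (1 + norm (s i x)) ^ k" if "x \<in> D i" for x i k
  proof -
    have "(1 + norm x) ^ k \<le> (1 + norm (s i x)) ^ k * (1 + norm (x - s i x)) ^ k" by (rule peetre)
    also have "\<dots> \<le> (1 + norm (s i x)) ^ k * 2 ^ k"
      using that by (intro mult_left_mono power_mono) (auto simp: D_def norm_minus_commute)
    finally show ?thesis by (simp add: mult.commute)
  qed
  \<comment> \<open>The Riemann sum of the convolution, with the cell measures as weights.\<close>
  define P where "P i = (\<lambda>y. \<Sum>z\<in>range (s i). (of_real (m i z) * h z) * \<psi> (y + - z))" for i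
  have TP: "T (P i) = (\<integral>x. indicator (D i) x *\<^sub>R (h (s i x) * ?G (s i x)) \<partial>lborel)" for i
    unfolding P_def T_sum[OF fr sh] cd[symmetric] sum(1)[of i "\<lambda>z. h z * ?G z"] by (simp add: mult.assoc)
  have sP: "schwartz (P i)" for i unfolding P_def by (intro schwartz_sum schwartz_cmult sh)
  have lim1: "(\<lambda>i. T (P i)) \<longlonglongrightarrow> (\<integral>x. h x * ?G x \<partial>lborel)"
  proof -
    obtain C where C: "0 \<le> C" "\<And>x. cmod (h x * ?G x) \<le> C / (1 + norm x) ^ ?n"
      using rapid_bound[OF conv_dist_rapid[OF \<phi> h]] by metis
    show ?thesis unfolding TP
    proof (rule integral_dominated_convergence[where w="\<lambda>x. C * 2 ^ ?n * (1 / (1 + norm x) ^ ?n)"])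
      show "integrable lborel (\<lambda>x::'a. C * 2 ^ ?n * (1 / (1 + norm x) ^ ?n))" by (intro integrable_mult_right decay_integrable)
      show "(\<lambda>x. h x * ?G x) \<in> borel_measurable lborel"
        by (subst measurable_lborel2, intro cont_measurable continuous_intros schwartz_cont h continuous_conv_dist \<phi>)
      show "(\<lambda>x. indicator (D i) x *\<^sub>R (h (s i x) * ?G (s i x))) \<in> borel_measurable lborel" for i
        using sum(2)[of i "\<lambda>z. h z * ?G z"] by simp
      show "AE x in lborel. (\<lambda>i. indicator (D i) x *\<^sub>R (h (s i x) * ?G (s i x))) \<longlonglongrightarrow> h x * ?G x"
      proof (rule AE_I2)
        fix x
        have "(\<lambda>i. h (s i x) * ?G (s i x)) \<longlonglongrightarrow> h x * ?G x"
          using continuous_on_tendsto_compose[OF schwartz_cont[OF h] s(2)[of x]]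
            continuous_on_tendsto_compose[OF continuous_conv_dist[OF \<phi>] s(2)[of x]] by (intro tendsto_mult) auto
        then show "(\<lambda>i. indicator (D i) x *\<^sub>R (h (s i x) * ?G (s i x))) \<longlonglongrightarrow> h x * ?G x"
          by (rule Lim_transform_eventually) (use ev[of x] in eventually_elim, simp)
      qed
      show "AE x in lborel. norm (indicator (D i) x *\<^sub>R (h (s i x) * ?G (s i x))) \<le> C * 2 ^ ?n * (1 / (1 + norm x) ^ ?n)" for i
      proof (rule AE_I2)
        fix x
        show "norm (indicator (D i) x *\<^sub>R (h (s i x) * ?G (s i x))) \<le> C * 2 ^ ?n * (1 / (1 + norm x) ^ ?n)"
        proof (cases "x \<in> D i")
          case True
          have "C * (1 + norm x) ^ ?n \<le> C * (2 ^ ?n * (1 + norm (s i x)) ^ ?n)"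
            by (rule mult_left_mono[OF near[OF True] C(1)])
          then have "C / (1 + norm (s i x)) ^ ?n \<le> C * 2 ^ ?n * (1 / (1 + norm x) ^ ?n)"
            by (simp add: field_simps add_pos_nonneg del: power_Suc power_add)
          then show ?thesis using True C(2)[of "s i x"] by (simp del: power_Suc)
        qed (use C in simp)
      qed
    qed
  qed
  obtain B where B: "0 \<le> B"
    "\<And>bs x y. set bs \<subseteq> Basis \<Longrightarrow> length bs \<le> M \<Longrightarrow>
      (1 + norm y) ^ M * cmod (partials bs \<psi> (y - x)) \<le> B * (1 + norm x) ^ M"
    "\<And>bs x x' y. set bs \<subseteq> Basis \<Longrightarrow> length bs \<le> M \<Longrightarrow> norm (x - x') \<le> 1 \<Longrightarrow>
      (1 + norm y) ^ M * cmod (partials bs \<psi> (y - x) - partials bs \<psi> (y - x')) \<le> B * (norm (x - x') * (1 + norm x) ^ M)"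
    using translate_bounds[OF \<psi>] by blast
  \<comment> \<open>The extra M powers of decay pay for the growth (1 + |x|)^M of the
    translates.\<close>
  obtain Bh where Bh: "0 \<le> Bh" "\<And>x. cmod (h x) \<le> Bh / (1 + norm x) ^ (M + ?n)"
    using rapid_bound[OF schwartz_rapid[OF h]] by metis
  obtain Lh where Lh: "0 \<le> Lh" "\<And>x y. norm (x - y) \<le> 1 \<Longrightarrow> cmod (h x - h y) \<le> Lh * norm (x - y) / (1 + norm x) ^ (M + ?n)"
    using schwartz_lipschitz[OF h] by metis
  define K where "K = Bh * B + Lh * B * 2 ^ M + Bh * B"
  have K: "Bh * B + Lh * B * 2 ^ M \<le> K" "Bh * B \<le> K" "0 \<le> K" using Bh Lh B by (auto simp: K_def)
  \<comment> \<open>A bound for the pointwise error: proportional to the sampling distance on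
    \<open>D i\<close>, and of the size of the integrand outside, where the step function is 0. It
    tends to 0 pointwise and has an integrable majorant.\<close>
  define e where "e i x = (if x \<in> D i then norm (s i x - x) else 1) * (K / (1 + norm x) ^ ?n)" for i x
  have split: "a / (1 + norm x) ^ (M + ?n) * (b * (1 + norm x) ^ M) = a * b / (1 + norm x) ^ ?n" for a b and x :: 'a
    by (simp only: power_add[of "1 + norm x" M ?n]) (simp add: add_nonneg_eq_0_iff)
  have le: "(1 + norm y) ^ M * cmod (indicator (D i) x *\<^sub>R (h (s i x) * partials bs \<psi> (y - s i x)) - h x * partials bs \<psi> (y - x)) \<le> e i x"
    if bs: "set bs \<subseteq> Basis" "length bs \<le> M" for bs i x y
  proof (cases "x \<in> D i")
    case True
    let ?g = "partials bs \<psi>" and ?d = "norm (s i x - x)"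
    have d: "norm (x - s i x) \<le> 1" using True by (simp add: D_def norm_minus_commute)
    have eq: "h (s i x) * ?g (y - s i x) - h x * ?g (y - x) = - (h x * (?g (y - x) - ?g (y - s i x)) + (h x - h (s i x)) * ?g (y - s i x))"
      by (simp add: algebra_simps)
    have "cmod (h (s i x) * ?g (y - s i x) - h x * ?g (y - x)) \<le> cmod (h x) * cmod (?g (y - x) - ?g (y - s i x)) + cmod (h x - h (s i x)) * cmod (?g (y - s i x))"
      unfolding eq norm_minus_cancel by (rule order_trans[OF norm_triangle_ineq]) (simp add: norm_mult)
    then have "(1 + norm y) ^ M * cmod (h (s i x) * ?g (y - s i x) - h x * ?g (y - x))
       \<le> (1 + norm y) ^ M * (cmod (h x) * cmod (?g (y - x) - ?g (y - s i x)) + cmod (h x - h (s i x)) * cmod (?g (y - s i x)))"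
      by (rule mult_left_mono) simp
    also have "\<dots> = cmod (h x) * ((1 + norm y) ^ M * cmod (?g (y - x) - ?g (y - s i x))) + cmod (h x - h (s i x)) * ((1 + norm y) ^ M * cmod (?g (y - s i x)))"
      by (simp add: algebra_simps)
    also have "\<dots> \<le> Bh / (1 + norm x) ^ (M + ?n) * (B * (norm (x - s i x) * (1 + norm x) ^ M))
        + Lh * norm (x - s i x) / (1 + norm x) ^ (M + ?n) * (B * (2 ^ M * (1 + norm x) ^ M))"
    proof (rule add_mono; rule mult_mono)
      show "(1 + norm y) ^ M * cmod (?g (y - x) - ?g (y - s i x)) \<le> B * (norm (x - s i x) * (1 + norm x) ^ M)"
        by (rule B(3)[OF bs d])
      have "(1 + norm y) ^ M * cmod (?g (y - s i x)) \<le> B * (1 + norm (s i x)) ^ M" by (rule B(2)[OF bs])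
      also have "\<dots> \<le> B * (2 ^ M * (1 + norm x) ^ M)"
      proof (intro mult_left_mono B(1))
        have "(1 + norm (s i x)) ^ M \<le> (1 + norm x) ^ M * (1 + norm (s i x - x)) ^ M" by (rule peetre)
        also have "\<dots> \<le> (1 + norm x) ^ M * 2 ^ M" using True by (intro mult_left_mono power_mono) (auto simp: D_def)
        finally show "(1 + norm (s i x)) ^ M \<le> 2 ^ M * (1 + norm x) ^ M" by (simp add: mult.commute)
      qed
      finally show "(1 + norm y) ^ M * cmod (?g (y - s i x)) \<le> B * (2 ^ M * (1 + norm x) ^ M)" .
    qed (use Bh Lh d in auto)
    also have "\<dots> = ?d * ((Bh * B + Lh * B * 2 ^ M) / (1 + norm x) ^ ?n)"
      using split[of Bh x "B * norm (x - s i x)"] split[of "Lh * norm (x - s i x)" x "B * 2 ^ M"]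
      by (simp add: norm_minus_commute[of x] add_divide_distrib algebra_simps del: power_Suc)
    also have "\<dots> \<le> e i x" using True K by (auto simp: e_def intro!: mult_left_mono divide_right_mono)
    finally show ?thesis using True by simp
  next
    case False
    have "(1 + norm y) ^ M * (cmod (h x) * cmod (partials bs \<psi> (y - x))) = cmod (h x) * ((1 + norm y) ^ M * cmod (partials bs \<psi> (y - x)))" by simp
    also have "\<dots> \<le> Bh / (1 + norm x) ^ (M + ?n) * (B * (1 + norm x) ^ M)"
      by (rule mult_mono[OF Bh(2)]) (use B(2)[OF bs] Bh(1) in auto)
    also have "\<dots> \<le> e i x" unfolding split using False K by (auto simp: e_def intro!: divide_right_mono)
    finally show ?thesis using False by (simp add: norm_mult)
  qed
  have em: "e i \<in> borel_measurable borel" for i unfolding e_def by measurable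
  have e0: "0 \<le> e i x" "e i x \<le> K * (1 / (1 + norm x) ^ ?n)" for i x
  proof -
    have "(if x \<in> D i then norm (s i x - x) else 1) \<le> 1" by (simp add: D_def)
    then have "e i x \<le> 1 * (K / (1 + norm x) ^ ?n)" unfolding e_def using K(3) by (intro mult_right_mono) auto
    then show "e i x \<le> K * (1 / (1 + norm x) ^ ?n)" by simp
    show "0 \<le> e i x" unfolding e_def using K(3) by simp
  qed
  have ie: "integrable lborel (e i)" for i
    by (rule Bochner_Integration.integrable_bound[OF integrable_mult_right[OF decay_integrable, of K]])
       (use em e0 order_trans[OF e0(2) abs_ge_self] in auto)
  have lim2: "(\<lambda>i. \<integral>x. e i x \<partial>lborel) \<longlonglongrightarrow> (\<integral>x. 0 \<partial>(lborel :: 'a measure))"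
  proof (rule integral_dominated_convergence[where w="\<lambda>x. K * (1 / (1 + norm x) ^ ?n)"])
    show "integrable lborel (\<lambda>x::'a. K * (1 / (1 + norm x) ^ ?n))" by (intro integrable_mult_right decay_integrable)
    show "AE x in lborel. norm (e i x) \<le> K * (1 / (1 + norm x) ^ ?n)" for i using e0 by simp
    show "AE x in lborel. (\<lambda>i. e i x) \<longlonglongrightarrow> 0"
    proof (rule AE_I2)
      fix x
      have "(\<lambda>i. norm (s i x - x)) \<longlonglongrightarrow> 0" using s(2)[of x] by (simp add: LIM_zero_iff tendsto_norm_zero_iff)
      then have "(\<lambda>i. norm (s i x - x) * (K / (1 + norm x) ^ ?n)) \<longlonglongrightarrow> 0" by (rule tendsto_mult_left_zero)
      then show "(\<lambda>i. e i x) \<longlonglongrightarrow> 0"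
        by (rule Lim_transform_eventually) (use ev[of x] in eventually_elim, simp add: e_def)
    qed
  qed (use em in auto)
  have sc: "schwartz (conv h \<psi>)" by (rule conv_schwartz_fourier(1)[OF h \<psi>])
  have sem: "schwartz_seminorm M (\<lambda>y. P i y - conv h \<psi> y) \<le> (\<integral>x. e i x \<partial>lborel)" for i
  proof (rule seminorm_least)
    fix y :: 'a and bs assume bs: "set bs \<subseteq> (Basis :: 'a set)" "length bs \<le> M"
    let ?g = "partials bs \<psi>"
    have sg: "schwartz ?g" by (rule schwartz_partials[OF \<psi> bs(1)])
    have ps: "partials bs (\<lambda>x. (of_real (m i z) * h z) * \<psi> (x + - z)) = (\<lambda>x. (of_real (m i z) * h z) * ?g (x + - z))" for z
      by (simp only: partials_cmult[OF sh bs(1)] partials_shift[OF \<psi> bs(1)])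
    have pP: "partials bs (P i) y = (\<integral>x. indicator (D i) x *\<^sub>R (h (s i x) * ?g (y - s i x)) \<partial>lborel)"
      unfolding sum(1)[of i "\<lambda>z. h z * ?g (y - z)"] P_def
      by (subst partials_sum[OF schwartz_cmult[OF sh] bs(1)]) (simp only: ps, simp add: mult.assoc)
    have pc: "partials bs (conv h \<psi>) y = (\<integral>x. h x * ?g (y - x) \<partial>lborel)"
      unfolding partials_conv[OF h \<psi> bs(1)] by (simp add: conv_def)
    have ic: "integrable lborel (\<lambda>x. h x * ?g (y - x))"
      by (rule schwartz_integrable[OF schwartz_mult[OF h schwartz_reflect[OF sg]]])
    have "(1 + norm y) ^ M * cmod (partials bs (\<lambda>y. P i y - conv h \<psi> y) y)
       = cmod (\<integral>x. of_real ((1 + norm y) ^ M) * (indicator (D i) x *\<^sub>R (h (s i x) * ?g (y - s i x)) - h x * ?g (y - x)) \<partial>lborel)"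
      unfolding partials_diff[OF sP sc bs(1)] pP pc
      by (subst Bochner_Integration.integral_diff[symmetric, OF sum(2)[of i "\<lambda>z. h z * ?g (y - z)"] ic])
         (simp add: norm_mult norm_power del: of_real_power)
    also have "\<dots> \<le> (\<integral>x. e i x \<partial>lborel)"
    proof (rule Bochner_Integration.integral_norm_bound_integral)
      show "integrable lborel (\<lambda>x. complex_of_real ((1 + norm y) ^ M) * (indicator (D i) x *\<^sub>R (h (s i x) * ?g (y - s i x)) - h x * ?g (y - x)))"
        by (intro integrable_mult_right Bochner_Integration.integrable_diff sum(2)[of i "\<lambda>z. h z * ?g (y - z)"] ic)
      show "cmod (complex_of_real ((1 + norm y) ^ M) * (indicator (D i) x *\<^sub>R (h (s i x) * ?g (y - s i x)) - h x * ?g (y - x))) \<le> e i x" for x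
        using le[OF bs, of y i x] by (simp add: norm_mult norm_power del: of_real_power)
    qed (rule ie)
    finally show "(1 + norm y) ^ M * cmod (partials bs (\<lambda>y. P i y - conv h \<psi> y) y) \<le> (\<integral>x. e i x \<partial>lborel)" .
  qed
  have "(\<lambda>i. T (P i)) \<longlonglongrightarrow> T (conv h \<psi>)"
  proof (rule Lim_null[THEN iffD2], rule Lim_null_comparison)
    show "\<forall>\<^sub>F i in sequentially. norm (T (P i) - T (conv h \<psi>)) \<le> CT * (\<integral>x. e i x \<partial>lborel)"
    proof (intro always_eventually allI)
      fix i
      have "CT * schwartz_seminorm M (\<lambda>y. P i y - conv h \<psi> y) \<le> CT * (\<integral>x. e i x \<partial>lborel)" by (intro mult_left_mono sem CT)
      then show "norm (T (P i) - T (conv h \<psi>)) \<le> CT * (\<integral>x. e i x \<partial>lborel)"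
        using CT(2)[OF schwartz_diff[OF sP[of i] sc]] unfolding T_diff[OF sP sc] by simp
    qed
    show "(\<lambda>i. CT * (\<integral>x. e i x \<partial>lborel)) \<longlonglongrightarrow> 0" using tendsto_mult_left[OF lim2, of CT] by simp
  qed
  from LIMSEQ_unique[OF this lim1] show ?thesis unfolding \<psi>_def .
qed

end

section \<open>The Schwartz space embeds into the Besov space\<close>

text \<open>The logarithm in the denominator is at least 1, so the local condition already bounds
  the oscillation over the whole space.\<close>

lemma Clog_loc_diff_le:
  assumes "Clog_loc g" obtains c where "0 \<le> c" "\<And>x y. \<bar>g x - g y\<bar> \<le> c"
proof -
  obtain c where c: "\<And>x y. \<bar>g x - g y\<bar> \<le> c / ln (exp 1 + 1 / norm (x - y))"
    using assms unfolding Clog_loc_def by blast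
  \<comment> \<open>At x = y the quotient 1 / 0 is 0, the logarithm is ln (exp 1) = 1, and the
    condition reads 0 <= c.\<close>
  have c0: "0 \<le> c" using c[of 0 0] by simp
  have "\<bar>g x - g y\<bar> \<le> c" for x y
  proof -
    have "ln (exp 1) \<le> ln (exp 1 + 1 / norm (x - y))" by (intro ln_mono) (auto intro: add_pos_nonneg)
    then have "c / ln (exp 1 + 1 / norm (x - y)) \<le> c" using c0 by (simp add: divide_le_eq mult_le_cancel_left1)
    with c[of x y] show ?thesis by simp
  qed
  with c0 that show ?thesis by blast
qed

lemma Clog_loc_bounded:
  assumes "Clog_loc g" obtains B where "0 \<le> B" "\<And>x. \<bar>g x\<bar> \<le> B"
proof -
  obtain c where c: "0 \<le> c" "\<And>x y. \<bar>g x - g y\<bar> \<le> c" using Clog_loc_diff_le[OF assms] by metis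
  have "\<bar>g x\<bar> \<le> \<bar>g 0\<bar> + c" for x using c(2)[of x 0] by linarith
  then show ?thesis using c(1) that[of "\<bar>g 0\<bar> + c"] by simp
qed

text \<open>Boundedness of 1/p gives a lower bound at every point, whereas the essential infimum
  gives one almost everywhere. Adding 1 to B avoids a division by 0.\<close>

lemma P0log_lower_bound:
  assumes "p \<in> P0log" obtains p0 where "0 < p0" "\<And>x. p0 \<le> p x"
proof -
  have pos: "\<And>x. 0 < p x" and cl: "Clog_loc (\<lambda>x. 1 / p x)" using assms by (auto simp: P0log_def P0_def Clog_def)
  obtain B where B: "0 \<le> B" "\<And>x. \<bar>1 / p x\<bar> \<le> B" using Clog_loc_bounded[OF cl] by metis
  have "1 / (B + 1) \<le> p x" for x
    using B(1) B(2)[of x] pos[of x] by (simp add: field_simps)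
  then show ?thesis using B(1) that[of "1 / (B + 1)"] by simp
qed

lemma ess_inf_pos_AE:
  assumes "ess_inf \<tau> > 0" shows "AE x in lebesgue. 0 < \<tau> x"
proof -
  obtain c where c: "AE x in lebesgue. c \<le> ereal (\<tau> x)" "0 < c"
    using assms unfolding ess_inf_def less_Sup_iff by blast
  from c(1) show ?thesis by eventually_elim (use c(2) in \<open>metis less_le_trans ereal_less(2)\<close>)
qed

text \<open>The weights lam = 2^-(v+1) sum to 1, so it is enough to bound each modular by 1. The
  factor 2^(-(v+1)/q0) absorbs lam^(1/q x). The remaining bound eps / (1 + |x|)^K is at most 1, so
  the exponent p x may be lowered to p0, and K and eps are tuned to make the p0-th power integrate
  to at most 1.\<close>

lemma lq_Lp_le:
  fixes p q :: "'a::euclidean_space \<Rightarrow> real"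
  assumes p0: "0 < p0" "\<And>x. p0 \<le> p x" and q0: "0 < q0" "\<And>x. q0 \<le> q x"
    and K: "real (DIM('a) + 2) \<le> real K * p0"
    and \<epsilon>: "0 < \<epsilon>" "\<epsilon> \<le> 1" "\<epsilon> powr p0 * (\<integral>x. 1 / (1 + norm x) ^ (DIM('a) + 2) \<partial>(lborel :: 'a measure)) \<le> 1"
    and A: "0 < A"
    and f: "\<And>v. v0 \<le> v \<Longrightarrow> AE x in lebesgue. \<bar>f v x\<bar> \<le> A * \<epsilon> * 2 powr (- (real v + 1) / q0) / (1 + norm x) ^ K"
  shows "lq_Lp p q v0 f \<le> ennreal A"
proof -
  let ?n = "DIM('a) + 2"
  have inf: "Inf {ennreal lam | lam. lam > 0 \<and> modular p (\<lambda>x. f v x / (A * lam powr (1 / q x))) \<le> 1} \<le> ennreal ((1/2) ^ Suc v)"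
    if v: "v0 \<le> v" for v
  proof (rule Inf_lower)
    let ?l = "(1/2 :: real) ^ Suc v"
    have l: "?l = 2 powr (- (real v + 1))" 
      using powr_realpow[of 2 "Suc v"] by (simp only: powr_minus) (simp add: power_one_over inverse_eq_divide add.commute)
    have pos: "0 < ?l" by simp
    have "modular p (\<lambda>x. f v x / (A * ?l powr (1 / q x))) \<le> (\<integral>\<^sup>+x. ennreal (\<epsilon> powr p0 * (1 / (1 + norm x) ^ ?n)) \<partial>(lebesgue :: 'a measure))"
      unfolding modular_def
    proof (rule nn_integral_mono_AE)
      show "AE x in lebesgue. ennreal (\<bar>f v x / (A * ?l powr (1 / q x))\<bar> powr p x) \<le> ennreal (\<epsilon> powr p0 * (1 / (1 + norm x) ^ ?n))"
        using f[OF v]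
      proof eventually_elim
        fix x assume fx: "\<bar>f v x\<bar> \<le> A * \<epsilon> * 2 powr (- (real v + 1) / q0) / (1 + norm x) ^ K"
        have qx: "0 < q x" using q0 less_le_trans by blast
        have "1 / q x \<le> 1 / q0" using q0 by (intro divide_left_mono mult_pos_pos qx) auto
        then have "(real v + 1) * (1 / q x) \<le> (real v + 1) * (1 / q0)" by (intro mult_left_mono) auto
        then have "- (real v + 1) / q0 \<le> - (real v + 1) * (1 / q x)"
          unfolding divide_inverse mult_minus_left mult_1_left neg_le_iff_le .
        then have low: "2 powr (- (real v + 1) / q0) \<le> ?l powr (1 / q x)" unfolding l powr_powr by (rule powr_mono) simp
        have "\<bar>f v x / (A * ?l powr (1 / q x))\<bar> = \<bar>f v x\<bar> / (A * ?l powr (1 / q x))" using A by (simp add: abs_mult)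
        also have "\<dots> \<le> (A * \<epsilon> * 2 powr (- (real v + 1) / q0) / (1 + norm x) ^ K) / (A * 2 powr (- (real v + 1) / q0))"
          using A low fx \<epsilon> by (intro frac_le mult_left_mono) auto
        also have "\<dots> = \<epsilon> / (1 + norm x) ^ K" using A by simp
        finally have t: "\<bar>f v x / (A * ?l powr (1 / q x))\<bar> \<le> \<epsilon> / (1 + norm x) ^ K" .
        have t1: "\<epsilon> / (1 + norm x) ^ K \<le> 1" using \<epsilon> by (simp add: divide_le_eq add_pos_nonneg order_trans[OF _ one_le_power])
        have t0: "0 < \<epsilon> / (1 + norm x) ^ K" using \<epsilon> by (simp add: add_pos_nonneg)
        have px: "0 < p x" using p0 less_le_trans by blast
        have "\<bar>f v x / (A * ?l powr (1 / q x))\<bar> powr p x \<le> (\<epsilon> / (1 + norm x) ^ K) powr p x"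
          using t px by (intro powr_mono2) auto
        also have "\<dots> \<le> (\<epsilon> / (1 + norm x) ^ K) powr p0" by (rule powr_mono'[OF p0(2)]) (use t0 t1 in auto)
        also have "\<dots> = \<epsilon> powr p0 / (1 + norm x) powr (real K * p0)"
          using \<epsilon> by (simp add: powr_divide powr_realpow[symmetric] add_pos_nonneg powr_powr)
        also have "\<dots> \<le> \<epsilon> powr p0 / (1 + norm x) powr real ?n"
          using K by (intro divide_left_mono powr_mono mult_pos_pos) (auto simp: add_nonneg_eq_0_iff)
        also have "\<dots> = \<epsilon> powr p0 * (1 / (1 + norm x) ^ ?n)" by (subst powr_realpow) (auto simp: add_pos_nonneg)
        finally show "ennreal (\<bar>f v x / (A * ?l powr (1 / q x))\<bar> powr p x) \<le> ennreal (\<epsilon> powr p0 * (1 / (1 + norm x) ^ ?n))"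
          by (rule ennreal_leI)
      qed
    qed
    also have "\<dots> = ennreal (\<integral>x. \<epsilon> powr p0 * (1 / (1 + norm x) ^ ?n) \<partial>(lborel :: 'a measure))"
      unfolding nn_integral_completion
      by (rule nn_integral_eq_integral[OF integrable_mult_right[OF decay_integrable]]) simp
    also have "\<dots> \<le> ennreal 1" unfolding integral_mult_right_zero by (rule ennreal_leI[OF \<epsilon>(3)])
    finally have "modular p (\<lambda>x. f v x / (A * ?l powr (1 / q x))) \<le> 1" by simp
    with pos show "ennreal ?l \<in> {ennreal lam | lam. lam > 0 \<and> modular p (\<lambda>x. f v x / (A * lam powr (1 / q x))) \<le> 1}"
      by blast
  qed
  have "(\<Sum>v. if v0 \<le> v then Inf {ennreal lam | lam. lam > 0 \<and> modular p (\<lambda>x. f v x / (A * lam powr (1 / q x))) \<le> 1} else 0)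
      \<le> (\<Sum>v. ennreal ((1/2) ^ Suc v))"
    by (intro suminf_le) (use inf in auto)
  also have "\<dots> = ennreal (\<Sum>v. (1/2) ^ Suc v)"
    by (rule suminf_ennreal2) (use power_half_series in \<open>auto simp: sums_iff\<close>)
  also have "(\<Sum>v. (1/2 :: real) ^ Suc v) = 1" using power_half_series sums_unique by metis
  finally have "(\<Sum>v. if v0 \<le> v then Inf {ennreal lam | lam. lam > 0 \<and> modular p (\<lambda>x. f v x / (A * lam powr (1 / q x))) \<le> 1} else 0) \<le> 1"
    by simp
  then show ?thesis unfolding lq_Lp_def using A by (intro Inf_lower) blast
qed

section \<open>The family \<open>phi_seq\<close> and distributions given by Schwartz
  functions\<close>

lemma phi_seq_0: "phi_seq \<Phi> \<phi> 0 = \<Phi>"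
  by (simp add: phi_seq_def)

lemma phi_seq_pos: "0 < v \<Longrightarrow> phi_seq \<Phi> \<phi> v = dil (2 ^ v) \<phi>"
  by (auto simp: phi_seq_def dil_def power_mult)

lemma dil_1: "dil 1 f = f"
  by (simp add: dil_def[abs_def])

lemma schwartz_phi_seq: "schwartz \<Phi> \<Longrightarrow> schwartz \<phi> \<Longrightarrow> schwartz (phi_seq \<Phi> \<phi> v)"
  by (cases "v = 0") (simp_all add: phi_seq_0 phi_seq_pos schwartz_dil)

lemma admissible_pairD:
  assumes "admissible_pair \<Phi> \<phi>"
  shows "schwartz \<Phi>" "schwartz \<phi>" "\<And>\<xi>. 2 < norm \<xi> \<Longrightarrow> fourier \<Phi> \<xi> = 0"
    "\<And>\<xi>. 2 < norm \<xi> \<Longrightarrow> fourier \<phi> \<xi> = 0" "\<And>\<xi>. norm \<xi> < 1/2 \<Longrightarrow> fourier \<phi> \<xi> = 0"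
    "\<And>\<xi>. norm \<xi> \<le> 5/3 \<Longrightarrow> fourier \<Phi> \<xi> \<noteq> 0"
    "\<And>\<xi>. 3/5 \<le> norm \<xi> \<Longrightarrow> norm \<xi> \<le> 5/3 \<Longrightarrow> fourier \<phi> \<xi> \<noteq> 0"
proof -
  have 1: "fourier \<Phi> \<xi> \<noteq> 0 \<Longrightarrow> \<xi> \<in> cball 0 2" "fourier \<phi> \<xi> \<noteq> 0 \<Longrightarrow> \<xi> \<in> cball 0 2 - ball 0 (1/2)" for \<xi>
    using assms closure_subset[of "{\<xi>. fourier \<Phi> \<xi> \<noteq> 0}"] closure_subset[of "{\<xi>. fourier \<phi> \<xi> \<noteq> 0}"]
    unfolding admissible_pair_def by (auto simp only: mem_Collect_eq subset_iff)
  show "2 < norm \<xi> \<Longrightarrow> fourier \<Phi> \<xi> = 0" "2 < norm \<xi> \<Longrightarrow> fourier \<phi> \<xi> = 0" "norm \<xi> < 1/2 \<Longrightarrow> fourier \<phi> \<xi> = 0" for \<xi>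
    using 1[of \<xi>] by force+
  show "schwartz \<Phi>" "schwartz \<phi>" using assms by (auto simp: admissible_pair_def)
  obtain c where c: "c > 0" "\<And>\<xi>. norm \<xi> \<le> 5/3 \<Longrightarrow> c \<le> cmod (fourier \<Phi> \<xi>)" using assms by (auto simp: admissible_pair_def)
  show "norm \<xi> \<le> 5/3 \<Longrightarrow> fourier \<Phi> \<xi> \<noteq> 0" for \<xi> using c(1) c(2)[of \<xi>] by auto
  obtain d where d: "d > 0" "\<And>\<xi>. 3/5 \<le> norm \<xi> \<and> norm \<xi> \<le> 5/3 \<Longrightarrow> d \<le> cmod (fourier \<phi> \<xi>)"
    using assms by (auto simp: admissible_pair_def)
  show "3/5 \<le> norm \<xi> \<Longrightarrow> norm \<xi> \<le> 5/3 \<Longrightarrow> fourier \<phi> \<xi> \<noteq> 0" for \<xi> using d(1) d(2)[of \<xi>] by auto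
qed

lemma conv_dist_dist_of:
  assumes "schwartz f" "schwartz \<psi>"
  shows "conv_dist \<psi> (dist_of f) x = conv \<psi> f x"
proof -
  have "conv_dist \<psi> (dist_of f) x = conv f \<psi> x"
    unfolding conv_dist_def dist_of_def conv_def
    by (rule integral_completion)
       (subst measurable_lborel2, intro cont_measurable continuous_intros schwartz_cont assms schwartz_reflect)
  then show ?thesis using conv_commute[OF assms] by simp
qed

lemma dist_of_lborel:
  assumes "schwartz f" "schwartz \<psi>"
  shows "dist_of f \<psi> = (\<integral>x. f x * \<psi> x \<partial>lborel)"
  unfolding dist_of_def
  by (rule integral_completion) (subst measurable_lborel2, intro cont_measurable continuous_intros schwartz_cont assms)

lemma tempered_dist_of:
  fixes f :: "'a::euclidean_space \<Rightarrow> complex"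
  assumes f: "schwartz f" shows "tempered (dist_of f)"
  unfolding tempered_def
proof (intro conjI allI impI exI)
  fix u w :: "'a \<Rightarrow> complex" and a b :: complex assume uw: "schwartz u" "schwartz w"
  have s: "schwartz (\<lambda>x. a * u x + b * w x)" by (intro schwartz_add schwartz_cmult uw)
  have "integrable lborel (\<lambda>x. a * (f x * u x))" "integrable lborel (\<lambda>x. b * (f x * w x))"
    by (intro integrable_mult_right schwartz_integrable schwartz_mult f uw)+
  then show "dist_of f (\<lambda>x. a * u x + b * w x) = a * dist_of f u + b * dist_of f w"
    by (simp add: dist_of_lborel f uw s distrib_left mult.left_commute)
next
  fix \<psi> :: "'a \<Rightarrow> complex" assume \<psi>: "schwartz \<psi>"
  have i: "integrable lborel (\<lambda>x. cmod (f x))" by (intro integrable_norm schwartz_integrable f)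
  have "cmod (dist_of f \<psi>) \<le> (\<integral>x. cmod (f x) * schwartz_seminorm 0 \<psi> \<partial>lborel)"
    unfolding dist_of_lborel[OF f \<psi>]
  proof (rule Bochner_Integration.integral_norm_bound_integral[OF schwartz_integrable[OF schwartz_mult[OF f \<psi>]] integrable_mult_left[OF i]])
    show "cmod (f x * \<psi> x) \<le> cmod (f x) * schwartz_seminorm 0 \<psi>" for x
      using seminorm_bound[OF \<psi>, of x 0] by (simp add: norm_mult mult_left_mono)
  qed
  then show "cmod (dist_of f \<psi>) \<le> (\<integral>x. cmod (f x) \<partial>lborel) * schwartz_seminorm 0 \<psi>" by simp
qed

text \<open>For v = 0 low frequencies are present, but there the factor 2^(-2Nv) is 1 and plain
  decay suffices. The pair is kept general because the estimate also serves the pair of the Calderon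
  formula.\<close>

lemma phi_seq_conv_decay:
  fixes \<Phi> \<phi> :: "'a::euclidean_space \<Rightarrow> complex"
  assumes ad: "schwartz \<Phi>" "schwartz \<phi>" "0 < \<delta>" "\<And>\<xi>. norm \<xi> < \<delta> \<Longrightarrow> fourier \<phi> \<xi> = 0" "\<And>\<xi>. R < norm \<xi> \<Longrightarrow> fourier \<phi> \<xi> = 0"
  obtains C M where "0 \<le> C" "\<And>f v x. schwartz f \<Longrightarrow>
    cmod (conv (phi_seq \<Phi> \<phi> v) f x) \<le> C * schwartz_seminorm M f / (2 ^ v) ^ (2 * N) / (1 + norm x) ^ K"
proof -
  obtain C0 where C0: "0 \<le> C0" "\<And>a f x. 1 \<le> a \<Longrightarrow> schwartz f \<Longrightarrow>
      cmod (conv (dil a \<Phi>) f x) \<le> C0 * schwartz_seminorm K f / (1 + norm x) ^ K"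
    using conv_dil_decay[OF ad(1)] by metis
  have "\<exists>C M. 0 \<le> C \<and> (\<forall>a g x. 1 \<le> a \<longrightarrow> schwartz g \<longrightarrow>
      cmod (conv (dil a \<phi>) g x) \<le> C * schwartz_seminorm M g / (a ^ (2 * N) * (1 + norm x) ^ K))"
    by (rule vanishing_low_freq_decay[OF ad(2-5)])
  then obtain C1 M1 where C1: "0 \<le> C1" "\<And>a f x. 1 \<le> a \<Longrightarrow> schwartz f \<Longrightarrow>
      cmod (conv (dil a \<phi>) f x) \<le> C1 * schwartz_seminorm M1 f / (a ^ (2 * N) * (1 + norm x) ^ K)"
    by blast
  show ?thesis
  proof (rule that[of "C0 + C1" "max K M1"])
    show "0 \<le> C0 + C1" using C0 C1 by simp
    fix f :: "'a \<Rightarrow> complex" and v x assume f: "schwartz f"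
    let ?S = "schwartz_seminorm (max K M1) f"
    show "cmod (conv (phi_seq \<Phi> \<phi> v) f x) \<le> (C0 + C1) * ?S / (2 ^ v) ^ (2 * N) / (1 + norm x) ^ K"
    proof (cases "v = 0")
      case True
      have "C0 * schwartz_seminorm K f \<le> (C0 + C1) * ?S"
        using C0 C1 by (intro mult_mono seminorm_mono seminorm_nonneg f) auto
      then have "C0 * schwartz_seminorm K f / (1 + norm x) ^ K \<le> (C0 + C1) * ?S / (1 + norm x) ^ K" by (intro divide_right_mono) auto
      then show ?thesis using True C0(2)[of 1 f x] f by (simp add: dil_1 phi_seq_0)
    next
      case False
      have "C1 * schwartz_seminorm M1 f \<le> (C0 + C1) * ?S"
        using C0 C1 by (intro mult_mono seminorm_mono seminorm_nonneg f) auto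
      then have "C1 * schwartz_seminorm M1 f / ((2 ^ v) ^ (2 * N) * (1 + norm x) ^ K) \<le> (C0 + C1) * ?S / ((2 ^ v) ^ (2 * N) * (1 + norm x) ^ K)"
        by (intro divide_right_mono) auto
      then show ?thesis using False C1(2)[of "2 ^ v" f x] f by (simp add: phi_seq_pos)
    qed
  qed
qed

lemma schwartz_besov_norm_bound:
  fixes \<alpha> \<tau> p q :: "'a::euclidean_space \<Rightarrow> real" and \<Phi> \<phi> :: "'a \<Rightarrow> complex"
  assumes \<alpha>: "Clog_loc \<alpha>" and \<tau>: "Clog_loc \<tau>" "ess_inf \<tau> > 0"
    and p: "p \<in> P0log" and q: "q \<in> P0log" and ad: "admissible_pair \<Phi> \<phi>"
  obtains C M where "\<And>f. schwartz f \<Longrightarrow>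
    besov_norm \<alpha> \<tau> p q \<Phi> \<phi> (dist_of f) \<le> ennreal (C * schwartz_seminorm M f)"
proof -
  let ?n = "DIM('a)"
  obtain a where a: "0 \<le> a" "\<And>x. \<bar>\<alpha> x\<bar> \<le> a" using Clog_loc_bounded[OF \<alpha>] by metis
  obtain t where t: "0 \<le> t" "\<And>x. \<bar>\<tau> x\<bar> \<le> t" using Clog_loc_bounded[OF \<tau>(1)] by metis
  obtain p0 where p0: "0 < p0" "\<And>x. p0 \<le> p x" using P0log_lower_bound[OF p] by metis
  obtain q0 where q0: "0 < q0" "\<And>x. q0 \<le> q x" using P0log_lower_bound[OF q] by metis
  \<comment> \<open>K p0 >= n + 2 makes the p0-th power of (1 + |x|)^-K integrable.\<close>
  obtain K :: nat where "(?n + 2) / p0 < real K" using reals_Archimedean2 by blast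
  then have K: "real (?n + 2) \<le> real K * p0" using p0(1) by (simp add: field_simps)
  define I where "I = (\<integral>x. 1 / (1 + norm x) ^ (?n + 2) \<partial>(lborel :: 'a measure))"
  have I0: "0 \<le> I" unfolding I_def by (intro Bochner_Integration.integral_nonneg) simp
  \<comment> \<open>With this value eps^p0 = 1 / (I + 1), so eps^p0 I <= 1.\<close>
  define \<epsilon> where "\<epsilon> = (1 / (I + 1)) powr (1 / p0)"
  have \<epsilon>: "0 < \<epsilon>" "\<epsilon> \<le> 1" "\<epsilon> powr p0 * I \<le> 1"
  proof -
    show "0 < \<epsilon>" using I0 by (simp add: \<epsilon>_def)
    show "\<epsilon> \<le> 1" unfolding \<epsilon>_def using I0 p0 by (intro powr_le1) auto
    have "\<epsilon> powr p0 = 1 / (I + 1)" unfolding \<epsilon>_def powr_powr using I0 p0 by simp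
    then show "\<epsilon> powr p0 * I \<le> 1" using I0 by simp
  qed
  \<comment> \<open>The losses per unit of v are a from 2^(v alpha), n t from the cube factor, and
    1/q0 from the weights in \<open>lq_Lp_le\<close>; the decay 2^(-2Nv) beats their sum.\<close>
  obtain N :: nat where N: "a + ?n * t + 1 / q0 < real N" using reals_Archimedean2 by blast
  obtain C M where C: "0 \<le> C" "\<And>f v x. schwartz f \<Longrightarrow>
      cmod (conv (phi_seq \<Phi> \<phi> v) f x) \<le> C * schwartz_seminorm M f / (2 ^ v) ^ (2 * N) / (1 + norm x) ^ K"
    using phi_seq_conv_decay[OF admissible_pairD(1,2)[OF ad] _ admissible_pairD(5,4)[OF ad]] zero_less_divide_1_iff zero_less_numeral by metis
  \<comment> \<open>2^(1/q0) turns 2^(-(v+1)/q0) into 2^(-v/q0), and 1 / eps cancels the eps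
    required by \<open>lq_Lp_le\<close>.\<close>
  define C' where "C' = C * 2 powr (1 / q0) / \<epsilon>"
  have C': "0 \<le> C'" using C \<epsilon> by (simp add: C'_def)
  note sch = admissible_pairD(1,2)[OF ad]
  show ?thesis
  proof (rule that[of C' M])
    fix f :: "'a \<Rightarrow> complex" assume f: "schwartz f"
    let ?S = "schwartz_seminorm M f"
    show "besov_norm \<alpha> \<tau> p q \<Phi> \<phi> (dist_of f) \<le> ennreal (C' * ?S)"
    \<comment> \<open>The seminorm may be 0 whereas \<open>lq_Lp_le\<close> needs a positive A,
      hence the detour through an arbitrary e.\<close>
    proof (rule ennreal_le_epsilon)
      fix e :: real assume e: "0 < e"
      define A where "A = C' * ?S + e"
      have A: "0 < A" "C' * ?S \<le> A" using e C' seminorm_nonneg[OF f, of M] by (auto simp: A_def add_nonneg_pos)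
      have "besov_norm \<alpha> \<tau> p q \<Phi> \<phi> (dist_of f) \<le> ennreal A"
        unfolding besov_norm_def
      proof (rule SUP_least, clarify)
        fix vP :: int and m :: "'a \<Rightarrow> int"
        let ?F = "\<lambda>v x. 2 powr (real v * \<alpha> x) * cmod (conv_dist (phi_seq \<Phi> \<phi> v) (dist_of f) x)
            * (2 powr (- real_of_int vP * real ?n)) powr (- \<tau> x) * indicator (dyadic_cube vP m) x"
        show "lq_Lp p q (nat vP) ?F \<le> ennreal A"
        proof (rule lq_Lp_le[OF p0 q0 K \<epsilon>[unfolded I_def] A(1)])
          fix v assume v: "nat vP \<le> v"
          show "AE x in lebesgue. \<bar>?F v x\<bar>
             \<le> A * \<epsilon> * 2 powr (- (real v + 1) / q0) / (1 + norm x) ^ K"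
            using ess_inf_pos_AE[OF \<tau>(2)]
          proof eventually_elim
            fix x assume tx: "0 < \<tau> x"
            have 1: "2 powr (real v * \<alpha> x) \<le> 2 powr (real v * a)"
              using a(2)[of x] by (intro powr_mono mult_left_mono) auto
            \<comment> \<open>Only scales v >= vP occur, which handles small cubes. For cubes of
              side larger than 1, vP is negative, and the positivity of tau makes the left side
              negative.\<close>
            have "real_of_int vP * (real ?n * \<tau> x) \<le> real v * (real ?n * t)"
            proof -
              have "real_of_int vP * (real ?n * \<tau> x) \<le> real v * (real ?n * \<tau> x)"
                using v tx by (intro mult_right_mono) auto
              also have "\<dots> \<le> real v * (real ?n * t)" using t(2)[of x] by (intro mult_left_mono) auto
              finally show ?thesis .
            qed
            then have 2: "(2 powr (- real_of_int vP * real ?n)) powr (- \<tau> x) \<le> 2 powr (real v * (real ?n * t))"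
              unfolding powr_powr by (intro powr_mono) (auto simp: mult.assoc)
            have 3: "cmod (conv_dist (phi_seq \<Phi> \<phi> v) (dist_of f) x) \<le> C * ?S / (2 ^ v) ^ (2 * N) / (1 + norm x) ^ K"
              using C(2)[OF f] by (simp add: conv_dist_dist_of f schwartz_phi_seq sch)
            have "\<bar>?F v x\<bar>
              \<le> 2 powr (real v * a) * (C * ?S / (2 ^ v) ^ (2 * N) / (1 + norm x) ^ K) * 2 powr (real v * (real ?n * t)) * 1"
              unfolding abs_mult using 1 2 3 C(1) seminorm_nonneg[OF f, of M]
              by (intro mult_mono mult_nonneg_nonneg divide_nonneg_nonneg) (auto simp: indicator_def)
            also have "\<dots> = C * ?S * 2 powr (real v * a + real v * (real ?n * t) - real v * (2 * N)) / (1 + norm x) ^ K"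
              by (simp add: powr_add powr_diff powr_realpow[symmetric] powr_powr field_simps)
            also have "\<dots> \<le> C * ?S * 2 powr (- real v / q0) / (1 + norm x) ^ K"
            proof (intro divide_right_mono mult_left_mono powr_mono)
              have "real v * (a + real ?n * t + 1 / q0) \<le> real v * (2 * real N)" using N by (intro mult_left_mono) auto
              then show "real v * a + real v * (real ?n * t) - real v * (2 * N) \<le> - real v / q0" by (simp add: algebra_simps)
            qed (use C(1) seminorm_nonneg[OF f, of M] in auto)
            also have "C * ?S * 2 powr (- real v / q0) = C' * ?S * \<epsilon> * 2 powr (- (real v + 1) / q0)"
            proof -
              have "2 powr (1 / q0) * 2 powr (- (real v + 1) / q0) = 2 powr (- real v / q0)"
                by (simp add: powr_add[symmetric] diff_divide_distrib)
              then show ?thesis using \<epsilon>(1) by (simp add: C'_def)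
            qed
            also have "C' * ?S * \<epsilon> * 2 powr (- (real v + 1) / q0) / (1 + norm x) ^ K \<le> A * \<epsilon> * 2 powr (- (real v + 1) / q0) / (1 + norm x) ^ K"
              using A(2) \<epsilon>(1) by (intro divide_right_mono mult_right_mono) auto
            finally show "\<bar>?F v x\<bar>
             \<le> A * \<epsilon> * 2 powr (- (real v + 1) / q0) / (1 + norm x) ^ K" .
          qed
        qed
      qed
      also have "ennreal A = ennreal (C' * ?S) + ennreal e"
        unfolding A_def using C' seminorm_nonneg[OF f, of M] e by (intro ennreal_plus) auto
      finally show "besov_norm \<alpha> \<tau> p q \<Phi> \<phi> (dist_of f) \<le> ennreal (C' * ?S) + ennreal e" .
    qed
  qed
qed

section \<open>Sub-mean-value estimates\<close>

lemma unit_cube_eq: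
  "dyadic_cube 0 m = {x. \<forall>i\<in>Basis. of_int (m i) \<le> x \<bullet> i \<and> x \<bullet> i < of_int (m i) + 1}"
  by (simp add: dyadic_cube_def)

text \<open>In terms of floors, lying in the same unit cube is a symmetric and jointly measurable
  relation, as the exchange of integrals below requires.\<close>

lemma floor_cube: "dyadic_cube 0 (\<lambda>b. \<lfloor>y \<bullet> b\<rfloor>) = {z. \<forall>b\<in>Basis. \<lfloor>y \<bullet> b\<rfloor> = \<lfloor>z \<bullet> b\<rfloor>}"
proof -
  have "\<lfloor>y \<bullet> b\<rfloor> = \<lfloor>z \<bullet> b\<rfloor> \<longleftrightarrow> of_int \<lfloor>y \<bullet> b\<rfloor> \<le> z \<bullet> b \<and> z \<bullet> b < of_int \<lfloor>y \<bullet> b\<rfloor> + 1" for z b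
    using floor_eq_iff[of "z \<bullet> b" "\<lfloor>y \<bullet> b\<rfloor>"] by metis
  then show ?thesis unfolding unit_cube_eq by blast
qed

lemma sets_unit_cube [measurable]: "dyadic_cube 0 m \<in> sets borel"
proof -
  have "dyadic_cube 0 m = (\<Inter>i\<in>Basis. {x. of_int (m i) \<le> x \<bullet> i} \<inter> {x. x \<bullet> i < of_int (m i) + 1})"
    unfolding unit_cube_eq by auto
  also have "\<dots> \<in> sets borel"
    by (intro sets.finite_INT sets.Int borel_closed borel_open closed_Collect_le open_Collect_less continuous_intros) auto
  finally show ?thesis .
qed

lemma emeasure_unit_cube: "emeasure lborel (dyadic_cube 0 (m :: 'a::euclidean_space \<Rightarrow> int)) = 1"
proof (rule antisym)
  let ?l = "(\<Sum>i\<in>Basis. of_int (m i) *\<^sub>R i) :: 'a" and ?u = "(\<Sum>i\<in>Basis. (of_int (m i) + 1) *\<^sub>R i) :: 'a"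
  have d: "(\<Prod>b\<in>Basis. (?u - ?l) \<bullet> b) = 1" by (intro prod.neutral) (simp add: inner_diff_left)
  have "emeasure lborel (dyadic_cube 0 m) \<le> emeasure lborel (cbox ?l ?u)"
    by (rule emeasure_mono) (auto simp: unit_cube_eq mem_box less_imp_le)
  also have "\<dots> = 1" using d by (subst emeasure_lborel_cbox) auto
  finally show "emeasure lborel (dyadic_cube 0 m) \<le> 1" .
  have "1 = emeasure lborel (box ?l ?u)" using d by (subst emeasure_lborel_box) auto
  also have "\<dots> \<le> emeasure lborel (dyadic_cube 0 m)"
    by (rule emeasure_mono) (auto simp: unit_cube_eq mem_box less_imp_le)
  finally show "1 \<le> emeasure lborel (dyadic_cube 0 m)" .
qed

lemma same_cube_measurable [measurable]:
  "Measurable.pred (lborel \<Otimes>\<^sub>M lborel) (\<lambda>(y::'a::euclidean_space, z::'a). \<forall>b\<in>Basis. \<lfloor>y \<bullet> b\<rfloor> = \<lfloor>z \<bullet> b\<rfloor>)"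
  unfolding case_prod_unfold by measurable

text \<open>Averaging the weight over the unit cube of y and exchanging the integrals turns uniform
  bounds over cubes into a weighted bound without any summation over cubes.\<close>

lemma uniformly_local_weighted:
  fixes g :: "'a::euclidean_space \<Rightarrow> ennreal"
  assumes g[measurable]: "g \<in> borel_measurable borel"
    and B: "\<And>m. (\<integral>\<^sup>+y. g y * indicator (dyadic_cube 0 m) y \<partial>lborel) \<le> B"
  shows "(\<integral>\<^sup>+y. g y * ennreal (1 / (1 + norm (x - y)) ^ (DIM('a) + 2)) \<partial>lborel)
    \<le> ennreal ((1 + real DIM('a)) ^ (DIM('a) + 2) * (\<integral>z. 1 / (1 + norm z) ^ (DIM('a) + 2) \<partial>(lborel :: 'a measure))) * B"
proof -
  let ?n = "DIM('a) + 2"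
  \<comment> \<open>Points of one unit cube are at distance at most n, so by Peetre's inequality the
    weights at y and z differ by at most this factor.\<close>
  let ?c = "(1 + real DIM('a)) ^ ?n"
  let ?w = "\<lambda>z::'a. ennreal (?c * (1 / (1 + norm (x - z)) ^ ?n))"
  let ?S = "\<lambda>y z::'a. \<forall>b\<in>Basis. \<lfloor>y \<bullet> b\<rfloor> = \<lfloor>z \<bullet> b\<rfloor>"
  have le: "ennreal (1 / (1 + norm (x - y)) ^ ?n) \<le> (\<integral>\<^sup>+z. (if ?S y z then ?w z else 0) \<partial>lborel)" for y
  proof -
    have "ennreal (1 / (1 + norm (x - y)) ^ ?n) = (\<integral>\<^sup>+z. ennreal (1 / (1 + norm (x - y)) ^ ?n) * indicator (dyadic_cube 0 (\<lambda>b. \<lfloor>y \<bullet> b\<rfloor>)) z \<partial>lborel)"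
      by (subst nn_integral_cmult_indicator) (simp_all add: emeasure_unit_cube sets_unit_cube)
    also have "\<dots> \<le> (\<integral>\<^sup>+z. (if ?S y z then ?w z else 0) \<partial>lborel)"
    proof (rule nn_integral_mono)
      fix z
      show "ennreal (1 / (1 + norm (x - y)) ^ ?n) * indicator (dyadic_cube 0 (\<lambda>b. \<lfloor>y \<bullet> b\<rfloor>)) z \<le> (if ?S y z then ?w z else 0)"
      proof (cases "?S y z")
        case True
        have "norm (y - z) \<le> (\<Sum>b\<in>Basis. \<bar>(y - z) \<bullet> b\<bar>)" by (rule norm_le_l1)
        also have "\<dots> \<le> (\<Sum>b\<in>(Basis::'a set). 1)"
        proof (rule sum_mono)
          fix b :: 'a assume "b \<in> Basis"
          then have "\<lfloor>y \<bullet> b\<rfloor> = \<lfloor>z \<bullet> b\<rfloor>" using True by blast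
          then show "\<bar>(y - z) \<bullet> b\<bar> \<le> 1" unfolding inner_diff_left by linarith
        qed
        finally have "norm ((x - z) - (x - y)) \<le> real DIM('a)" by simp
        then have "(1 + norm (x - z)) ^ ?n \<le> (1 + norm (x - y)) ^ ?n * ?c" by (rule peetre_le)
        then have "1 / (1 + norm (x - y)) ^ ?n \<le> ?c * (1 / (1 + norm (x - z)) ^ ?n)"
          by (simp add: field_simps add_pos_nonneg del: power_Suc power_add)
        then show ?thesis using True by (auto simp: floor_cube intro: ennreal_leI)
      next
        case False
        then show ?thesis by (auto simp: floor_cube indicator_def)
      qed
    qed
    finally show ?thesis .
  qed
  have "(\<integral>\<^sup>+y. g y * ennreal (1 / (1 + norm (x - y)) ^ ?n) \<partial>lborel) \<le> (\<integral>\<^sup>+y. (\<integral>\<^sup>+z. (if ?S y z then g y * ?w z else 0) \<partial>lborel) \<partial>lborel)"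
  proof (rule nn_integral_mono)
    fix y
    have "Measurable.pred lborel (\<lambda>z. ?S y z)" by measurable
    then have m: "(\<lambda>z. if ?S y z then ?w z else 0) \<in> borel_measurable lborel" by measurable
    have "g y * ennreal (1 / (1 + norm (x - y)) ^ ?n) \<le> g y * (\<integral>\<^sup>+z. (if ?S y z then ?w z else 0) \<partial>lborel)"
      by (intro mult_left_mono le) auto
    also have "\<dots> = (\<integral>\<^sup>+z. g y * (if ?S y z then ?w z else 0) \<partial>lborel)"
      by (rule nn_integral_cmult[symmetric, OF m])
    also have "\<dots> = (\<integral>\<^sup>+z. (if ?S y z then g y * ?w z else 0) \<partial>lborel)" by (intro nn_integral_cong) simp
    finally show "g y * ennreal (1 / (1 + norm (x - y)) ^ ?n) \<le> (\<integral>\<^sup>+z. (if ?S y z then g y * ?w z else 0) \<partial>lborel)" .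
  qed
  also have "\<dots> = (\<integral>\<^sup>+z. (\<integral>\<^sup>+y. (if ?S y z then g y * ?w z else 0) \<partial>lborel) \<partial>lborel)"
  proof -
    have "(\<lambda>(z, y). if (case (y, z) of (y, z) \<Rightarrow> ?S y z) then g y * ?w z else 0) \<in> borel_measurable (lborel \<Otimes>\<^sub>M lborel)"
      unfolding case_prod_unfold fst_conv snd_conv by measurable
    then show ?thesis by (intro lborel_pair.Fubini') simp
  qed
  also have "\<dots> \<le> (\<integral>\<^sup>+z. ?w z * B \<partial>lborel)"
  proof (rule nn_integral_mono)
    fix z
    have "(\<integral>\<^sup>+y. (if ?S y z then g y * ?w z else 0) \<partial>lborel) = (\<integral>\<^sup>+y. ?w z * (g y * indicator (dyadic_cube 0 (\<lambda>b. \<lfloor>z \<bullet> b\<rfloor>)) y) \<partial>lborel)"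
    proof (rule nn_integral_cong)
      fix y
      have "?S y z \<longleftrightarrow> y \<in> dyadic_cube 0 (\<lambda>b. \<lfloor>z \<bullet> b\<rfloor>)" unfolding floor_cube by auto
      then show "(if ?S y z then g y * ?w z else 0) = ?w z * (g y * indicator (dyadic_cube 0 (\<lambda>b. \<lfloor>z \<bullet> b\<rfloor>)) y)"
        by (simp add: indicator_def mult.commute)
    qed
    also have "\<dots> = ?w z * (\<integral>\<^sup>+y. g y * indicator (dyadic_cube 0 (\<lambda>b. \<lfloor>z \<bullet> b\<rfloor>)) y \<partial>lborel)"
      by (rule nn_integral_cmult) (simp, measurable)
    also have "\<dots> \<le> ?w z * B" by (intro mult_left_mono B) auto
    finally show "(\<integral>\<^sup>+y. (if ?S y z then g y * ?w z else 0) \<partial>lborel) \<le> ?w z * B" .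
  qed
  also have "\<dots> = (\<integral>\<^sup>+z. ?w z \<partial>lborel) * B" by (rule nn_integral_multc) measurable
  also have "(\<integral>\<^sup>+z. ?w z \<partial>lborel) = ennreal (?c * (\<integral>z. 1 / (1 + norm z) ^ ?n \<partial>(lborel :: 'a measure)))"
  proof -
    have i: "integrable lborel (\<lambda>z. ?c * (1 / (1 + norm (x - z)) ^ ?n))"
    proof (intro integrable_mult_right decay_bound_integrable)
      fix z :: 'a
      have "(1 + norm z) ^ ?n \<le> (1 + norm x) ^ ?n * (1 + norm (z - x)) ^ ?n" by (rule peetre)
      then show "norm (1 / (1 + norm (x - z)) ^ ?n) \<le> (1 + norm x) ^ ?n / (1 + norm z) ^ ?n"
        by (simp add: field_simps add_pos_nonneg norm_minus_commute del: power_Suc power_add)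
    qed measurable
    have "(\<integral>z. ?c * (1 / (1 + norm (x - z)) ^ ?n) \<partial>lborel) = ?c * (\<integral>z. 1 / (1 + norm z) ^ ?n \<partial>(lborel :: 'a measure))"
      unfolding integral_mult_right_zero by (rule arg_cong[where f="(*) ?c"], rule integral_reflect) measurable
    then show ?thesis by (subst nn_integral_eq_integral[OF i]) auto
  qed
  finally show ?thesis .
qed

text \<open>What the growth argument takes from a band-limited G: uniform local L^r size over unit
  cubes, and domination by convolution with a dilated kernel. A growth bound on G is kept separate,
  since its order and constant depend on the distribution.\<close>

definition submean :: "('a::euclidean_space \<Rightarrow> complex) \<Rightarrow> real \<Rightarrow> real \<Rightarrow> real \<Rightarrow> ('a \<Rightarrow> complex) \<Rightarrow> bool" where
  "submean k r a B G \<longleftrightarrow> 1 \<le> a \<and> 0 \<le> B \<and> G \<in> borel_measurable borel \<and>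
    (\<forall>m. (\<integral>\<^sup>+y. ennreal (cmod (G y) powr r) * indicator (dyadic_cube 0 m) y \<partial>lborel) \<le> ennreal B) \<and>
    (\<forall>x. ennreal (cmod (G x)) \<le> (\<integral>\<^sup>+y. ennreal (cmod (dil a k (x - y)) * cmod (G y)) \<partial>lborel))"

text \<open>In |G| = |G|^r |G|^(1-r) only the second factor is estimated by the growth bound, so
  kappa becomes kappa (1 - r) and A enters with power 1 - r; the first factor is left to the local
  L^r bound. D depends on the range J of the exponents, not on kappa itself.\<close>

lemma submean_step:
  fixes k :: "'a::euclidean_space \<Rightarrow> complex" and J :: nat
  assumes k: "rapid k" and r: "0 < r" "r < 1"
  obtains D where "0 \<le> D" "\<And>a G A B \<kappa> x. submean k r a B G \<Longrightarrow> 0 < A \<Longrightarrow>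
    0 \<le> \<kappa> \<Longrightarrow> \<kappa> \<le> real J \<Longrightarrow> (\<And>y. cmod (G y) \<le> A * (1 + norm y) powr \<kappa>) \<Longrightarrow>
    cmod (G x) \<le> D * a ^ DIM('a) * A powr (1 - r) * B * (1 + norm x) powr (\<kappa> * (1 - r))"
proof -
  let ?n = "DIM('a) + 2"
  \<comment> \<open>J powers of decay pay for moving the growth from y to x, and n + 2 for the
    weight in \<open>uniformly_local_weighted\<close>.\<close>
  obtain C where C: "0 \<le> C" "\<And>x. cmod (k x) \<le> C / (1 + norm x) ^ (J + ?n)" using rapid_bound[OF k] by metis
  define c where "c = (1 + real DIM('a)) ^ ?n * (\<integral>z. 1 / (1 + norm z) ^ ?n \<partial>(lborel :: 'a measure))"
  have c: "0 \<le> c" unfolding c_def by (intro mult_nonneg_nonneg Bochner_Integration.integral_nonneg) auto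
  show ?thesis
  proof (rule that[of "C * c"])
    show "0 \<le> C * c" using C c by simp
    fix a A B \<kappa> :: real and G :: "'a \<Rightarrow> complex" and x :: 'a
    assume "submean k r a B G" and A: "0 < A"
      and \<kappa>: "0 \<le> \<kappa>" "\<kappa> \<le> real J" and GA: "\<And>y. cmod (G y) \<le> A * (1 + norm y) powr \<kappa>"
    then have a: "1 \<le> a" and G[measurable]: "G \<in> borel_measurable borel" and B: "0 \<le> B"
      and loc: "\<And>m. (\<integral>\<^sup>+y. ennreal (cmod (G y) powr r) * indicator (dyadic_cube 0 m) y \<partial>lborel) \<le> ennreal B"
      and rep: "ennreal (cmod (G x)) \<le> (\<integral>\<^sup>+y. ennreal (cmod (dil a k (x - y)) * cmod (G y)) \<partial>lborel)"
      by (auto simp: submean_def)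
    let ?s = "\<kappa> * (1 - r)"
    define W where "W = a ^ DIM('a) * C * A powr (1 - r) * (1 + norm x) powr ?s"
    have W: "0 \<le> W" unfolding W_def using a C by (intro mult_nonneg_nonneg) auto
    have s: "0 \<le> ?s" "?s \<le> real J" using \<kappa> r mult_left_le[of "1 - r" \<kappa>] by auto
    have le: "cmod (dil a k (x - y)) * cmod (G y) \<le> W * (cmod (G y) powr r * (1 / (1 + norm (x - y)) ^ ?n))" for y
    proof -
      let ?d = "1 + norm (x - y)"
      have d: "?d > 0" "?d \<ge> 1" by (auto simp: add_pos_nonneg)
      \<comment> \<open>Dilation by a >= 1 only improves the decay of the kernel.\<close>
      have "norm (x - y) \<le> a * norm (x - y)" using a by (simp add: mult_le_cancel_right1)
      then have "?d ^ (J + ?n) \<le> (1 + norm (a *\<^sub>R (x - y))) ^ (J + ?n)" using a by (intro power_mono) auto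
      then have "C / (1 + norm (a *\<^sub>R (x - y))) ^ (J + ?n) \<le> C / ?d ^ (J + ?n)"
        using C(1) d by (intro divide_left_mono mult_pos_pos zero_less_power) (auto simp: add_pos_nonneg)
      then have "cmod (k (a *\<^sub>R (x - y))) \<le> C / ?d ^ (J + ?n)"
        by (rule order_trans[OF C(2)])
      then have "a ^ DIM('a) * cmod (k (a *\<^sub>R (x - y))) \<le> a ^ DIM('a) * (C / ?d ^ (J + ?n))"
        using a by (intro mult_left_mono) auto
      moreover have "cmod (dil a k (x - y)) = a ^ DIM('a) * cmod (k (a *\<^sub>R (x - y)))"
        using a by (simp only: dil_def norm_mult norm_of_real) simp
      ultimately have k1: "cmod (dil a k (x - y)) \<le> a ^ DIM('a) * (C / ?d ^ (J + ?n))" by (simp only:)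
      have "cmod (G y) powr (1 - r) \<le> (A * (1 + norm y) powr \<kappa>) powr (1 - r)"
        using GA r by (intro powr_mono2) auto
      also have "\<dots> = A powr (1 - r) * (1 + norm y) powr ?s" using A by (simp add: powr_mult powr_powr)
      also have "\<dots> \<le> A powr (1 - r) * ((1 + norm x) powr ?s * ?d ^ J)"
      proof (intro mult_left_mono)
        have "1 + norm y \<le> (1 + norm x) * (1 + norm (x - y))"
          using peetre[of y 1 x] by (simp add: norm_minus_commute)
        then have "(1 + norm y) powr ?s \<le> ((1 + norm x) * ?d) powr ?s" using s by (intro powr_mono2) auto
        also have "\<dots> = (1 + norm x) powr ?s * ?d powr ?s" by (simp add: powr_mult)
        also have "?d powr ?s \<le> ?d powr real J" using s d by (intro powr_mono) auto
        also have "?d powr real J = ?d ^ J" by (rule powr_realpow[OF d(1)])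
        finally show "(1 + norm y) powr ?s \<le> (1 + norm x) powr ?s * ?d ^ J" by (simp add: mult_left_mono)
      qed auto
      finally have G1: "cmod (G y) powr (1 - r) \<le> A powr (1 - r) * ((1 + norm x) powr ?s * ?d ^ J)" .
      have "cmod (G y) = cmod (G y) powr r * cmod (G y) powr (1 - r)" by (simp add: powr_add[symmetric])
      also have "\<dots> \<le> cmod (G y) powr r * (A powr (1 - r) * ((1 + norm x) powr ?s * ?d ^ J))"
        by (intro mult_left_mono G1) auto
      finally have "cmod (dil a k (x - y)) * cmod (G y) \<le>
          a ^ DIM('a) * (C / ?d ^ (J + ?n)) * (cmod (G y) powr r * (A powr (1 - r) * ((1 + norm x) powr ?s * ?d ^ J)))"
        using a C d by (intro mult_mono k1) (auto intro!: mult_nonneg_nonneg divide_nonneg_nonneg)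
      also have "\<dots> = W * (cmod (G y) powr r * (1 / ?d ^ ?n))"
      proof -
        have "u * (C / (P * Q)) * (g * (w * (z * P))) = u * C * w * z * (g * (1 / Q))" if "P \<noteq> 0" for u w z g P Q :: real
          using that by simp
        moreover have "?d ^ J \<noteq> 0" using zero_less_power[OF d(1), of J] by (rule less_imp_neq[symmetric])
        ultimately show ?thesis unfolding power_add[of ?d J ?n] W_def by blast
      qed
      finally show ?thesis .
    qed
    have "ennreal (cmod (G x)) \<le> (\<integral>\<^sup>+y. ennreal W * (ennreal (cmod (G y) powr r) * ennreal (1 / (1 + norm (x - y)) ^ ?n)) \<partial>lborel)"
    proof (rule order_trans[OF rep nn_integral_mono])
      fix y
      have "ennreal (cmod (dil a k (x - y)) * cmod (G y)) \<le> ennreal (W * (cmod (G y) powr r * (1 / (1 + norm (x - y)) ^ ?n)))"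
        by (rule ennreal_leI[OF le])
      also have "\<dots> = ennreal W * (ennreal (cmod (G y) powr r) * ennreal (1 / (1 + norm (x - y)) ^ ?n))"
      proof -
        have "ennreal (cmod (G y) powr r * (1 / (1 + norm (x - y)) ^ ?n)) = ennreal (cmod (G y) powr r) * ennreal (1 / (1 + norm (x - y)) ^ ?n)"
          by (rule ennreal_mult) auto
        moreover have "0 \<le> cmod (G y) powr r * (1 / (1 + norm (x - y)) ^ ?n)" by simp
        ultimately show ?thesis by (simp only: ennreal_mult[OF W])
      qed
      finally show "ennreal (cmod (dil a k (x - y)) * cmod (G y)) \<le> ennreal W * (ennreal (cmod (G y) powr r) * ennreal (1 / (1 + norm (x - y)) ^ ?n))" .
    qed
    also have "\<dots> = ennreal W * (\<integral>\<^sup>+y. ennreal (cmod (G y) powr r) * ennreal (1 / (1 + norm (x - y)) ^ ?n) \<partial>lborel)"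
      by (rule nn_integral_cmult) measurable
    also have "\<dots> \<le> ennreal W * (ennreal c * ennreal B)"
      unfolding c_def by (intro mult_left_mono uniformly_local_weighted loc) auto
    also have "\<dots> = ennreal (W * (c * B))" using W B c by (simp add: ennreal_mult)
    finally have "cmod (G x) \<le> W * (c * B)" using W B c by (subst (asm) ennreal_le_iff) auto
    then show "cmod (G x) \<le> C * c * a ^ DIM('a) * A powr (1 - r) * B * (1 + norm x) powr ?s"
      by (simp add: W_def mult_ac)
  qed
qed

text \<open>The growth exponent shrinks by the factor 1 - r in each step, so it eventually drops below 1;
  at exponent 1 the optimal constant is absorbed. Only this last step contributes to D, which
  therefore does not depend on the initial growth of G.\<close>

lemma submean_growth:
  fixes k :: "'a::euclidean_space \<Rightarrow> complex"
  assumes k: "rapid k" and r: "0 < r" "r < 1"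
  obtains D where "0 \<le> D" "\<And>a G B A K x. submean k r a B G \<Longrightarrow>
    (\<And>y. cmod (G y) \<le> A * (1 + norm y) ^ K) \<Longrightarrow>
    cmod (G x) \<le> (D * a ^ DIM('a) * B) powr (1 / r) * (1 + norm x)"
proof -
  obtain D where D: "0 \<le> D" "\<And>a G A B \<kappa> x. submean k r a B G \<Longrightarrow> 0 < A \<Longrightarrow>
    0 \<le> \<kappa> \<Longrightarrow> \<kappa> \<le> real 1 \<Longrightarrow> (\<And>y. cmod (G y) \<le> A * (1 + norm y) powr \<kappa>) \<Longrightarrow>
    cmod (G x) \<le> D * a ^ DIM('a) * A powr (1 - r) * B * (1 + norm x) powr (\<kappa> * (1 - r))"
    using submean_step[OF k r, of 1] by blast
  show ?thesis
  proof (rule that[OF D(1)])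
    fix a B A :: real and K :: nat and G :: "'a \<Rightarrow> complex" and x :: 'a
    assume G: "submean k r a B G" and GA: "\<And>y. cmod (G y) \<le> A * (1 + norm y) ^ K"
    then have a: "1 \<le> a" and B: "0 \<le> B" by (auto simp: submean_def)
    obtain D' where D': "0 \<le> D'" "\<And>a G A B \<kappa> x. submean k r a B G \<Longrightarrow> 0 < A \<Longrightarrow>
      0 \<le> \<kappa> \<Longrightarrow> \<kappa> \<le> real K \<Longrightarrow> (\<And>y. cmod (G y) \<le> A * (1 + norm y) powr \<kappa>) \<Longrightarrow>
      cmod (G x) \<le> D' * a ^ DIM('a) * A powr (1 - r) * B * (1 + norm x) powr (\<kappa> * (1 - r))"
      using submean_step[OF k r, of K] by blast
    have iter: "\<exists>A>0. \<forall>y. cmod (G y) \<le> A * (1 + norm y) powr (real K * (1 - r) ^ j)" for j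
    proof (induction j)
      case 0
      have "cmod (G y) \<le> (\<bar>A\<bar> + 1) * (1 + norm y) powr (real K * (1 - r) ^ 0)" for y
      proof -
        have "cmod (G y) \<le> A * (1 + norm y) ^ K" by (rule GA)
        also have "\<dots> \<le> (\<bar>A\<bar> + 1) * (1 + norm y) ^ K" by (intro mult_right_mono) auto
        finally show ?thesis by (simp add: powr_realpow add_pos_nonneg)
      qed
      then show ?case by (intro exI[of _ "\<bar>A\<bar> + 1"]) auto
    next
      case (Suc j)
      then obtain A' where A': "A' > 0" "\<And>y. cmod (G y) \<le> A' * (1 + norm y) powr (real K * (1 - r) ^ j)" by blast
      have kj: "real K * (1 - r) ^ j \<le> real K" using r by (intro mult_left_le power_le_one) auto
      let ?A = "D' * a ^ DIM('a) * A' powr (1 - r) * B"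
      have A0: "0 \<le> ?A" using D' a B by (intro mult_nonneg_nonneg) auto
      have "cmod (G y) \<le> (?A + 1) * (1 + norm y) powr (real K * (1 - r) ^ Suc j)" for y
      proof -
        have "cmod (G y) \<le> ?A * (1 + norm y) powr (real K * (1 - r) ^ j * (1 - r))"
          using r by (intro D'(2)[OF G A'(1) _ kj A'(2)]) auto
        also have "\<dots> \<le> (?A + 1) * (1 + norm y) powr (real K * (1 - r) ^ j * (1 - r))" by (intro mult_right_mono) auto
        finally show ?thesis by (simp add: mult_ac)
      qed
      then show ?case using A0 by (intro exI[of _ "?A + 1"]) auto
    qed
    have "(\<lambda>j. real K * (1 - r) ^ j) \<longlonglongrightarrow> real K * 0" using r by (intro tendsto_mult tendsto_const LIMSEQ_power_zero) auto
    then have "\<forall>\<^sub>F j in sequentially. real K * (1 - r) ^ j < 1" by (intro order_tendstoD) auto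
    then obtain j where j: "real K * (1 - r) ^ j < 1" by (auto simp: eventually_sequentially)
    obtain A1 where A1: "A1 > 0" "\<And>y. cmod (G y) \<le> A1 * (1 + norm y) powr (real K * (1 - r) ^ j)" using iter by blast
    have A1': "cmod (G y) / (1 + norm y) \<le> A1" for y
    proof -
      have "A1 * (1 + norm y) powr (real K * (1 - r) ^ j) \<le> A1 * (1 + norm y) powr 1" using A1 j by (intro mult_left_mono powr_mono) auto
      then show ?thesis using A1(2)[of y] by (simp add: divide_le_eq add_pos_nonneg)
    qed
    \<comment> \<open>The best constant in |G(y)| <= S (1 + |y|), finite because the exponent is now
      below 1. Finiteness and positivity allow cancelling S^(1-r) in S <= E S^(1-r), which leaves
      S^r <= E.\<close>
    define S where "S = (SUP y. cmod (G y) / (1 + norm y))"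
    have S: "cmod (G y) / (1 + norm y) \<le> S" for y
      unfolding S_def by (rule cSUP_upper) (use A1' in \<open>auto simp: bdd_above_def\<close>)
    have Sle: "S \<le> (D * a ^ DIM('a) * B) powr (1 / r)"
    proof (cases "S > 0")
      case True
      let ?E = "D * a ^ DIM('a) * B"
      have E0: "0 \<le> ?E" using D a B by (intro mult_nonneg_nonneg) auto
      have GS: "cmod (G y) \<le> S * (1 + norm y) powr 1" for y
        using S[of y] by (simp add: divide_le_eq add_pos_nonneg)
      have "S \<le> ?E * S powr (1 - r)" unfolding S_def[of]
      proof (rule cSUP_least)
        fix y
        have "cmod (G y) \<le> D * a ^ DIM('a) * S powr (1 - r) * B * (1 + norm y) powr (1 * (1 - r))"
          by (rule D(2)[OF G True _ _ GS]) auto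
        also have "\<dots> \<le> D * a ^ DIM('a) * S powr (1 - r) * B * (1 + norm y) powr 1"
          using D a B r by (intro mult_left_mono powr_mono mult_nonneg_nonneg) auto
        finally show "cmod (G y) / (1 + norm y) \<le> ?E * (SUP y. cmod (G y) / (1 + norm y)) powr (1 - r)"
          unfolding S_def[symmetric] by (simp add: divide_le_eq add_pos_nonneg mult_ac)
      qed simp
      moreover have "S = S powr r * S powr (1 - r)" using True by (simp add: powr_add[symmetric])
      ultimately have "S powr r * S powr (1 - r) \<le> ?E * S powr (1 - r)" by simp
      then have "S powr r \<le> ?E" using True by (simp add: mult_le_cancel_right)
      then have "(S powr r) powr (1 / r) \<le> ?E powr (1 / r)" using r by (intro powr_mono2) auto
      then show ?thesis using r True by (simp add: powr_powr)
    qed (use powr_ge_zero in \<open>meson leI order_trans\<close>)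
    show "cmod (G x) \<le> (D * a ^ DIM('a) * B) powr (1 / r) * (1 + norm x)"
      using order_trans[OF S Sle, of x] by (simp add: divide_le_eq add_pos_nonneg)
  qed
qed

context tempered_dist
begin

text \<open>For h = k(x - .) the convolution in \<open>T_conv\<close> is phi(x - .), because k
  reproduces phi; hence k reproduces phi * T as well.\<close>

lemma conv_dist_reproducing:
  assumes \<phi>: "schwartz \<phi>" and k: "schwartz k" and rep: "conv k \<phi> = \<phi>"
  shows "ennreal (cmod (conv_dist \<phi> T x)) \<le> (\<integral>\<^sup>+y. ennreal (cmod (k (x - y)) * cmod (conv_dist \<phi> T y)) \<partial>lborel)"
proof -
  have h: "schwartz (\<lambda>y. k (x - y))" by (rule schwartz_reflect[OF k])
  have "conv (\<lambda>y. k (x - y)) (\<lambda>y. \<phi> (- y)) = (\<lambda>z. \<phi> (x - z))"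
  proof
    fix z
    have "conv (\<lambda>y. k (x - y)) (\<lambda>y. \<phi> (- y)) z = (\<integral>y. k (x - y) * \<phi> ((x - z) - (x - y)) \<partial>lborel)"
      by (simp add: conv_def)
    also have "\<dots> = conv k \<phi> (x - z)" unfolding conv_def
      by (rule integral_reflect) (intro cont_measurable continuous_intros schwartz_cont k schwartz_reflect \<phi>)
    finally show "conv (\<lambda>y. k (x - y)) (\<lambda>y. \<phi> (- y)) z = \<phi> (x - z)" by (simp add: rep)
  qed
  then have "conv_dist \<phi> T x = (\<integral>y. k (x - y) * conv_dist \<phi> T y \<partial>lborel)"
    using T_conv[OF \<phi> h] by (simp add: conv_dist_def[of \<phi> T x])
  moreover have "integrable lborel (\<lambda>y. k (x - y) * conv_dist \<phi> T y)"
    by (rule rapid_integrable(2)[OF _ conv_dist_rapid[OF \<phi> h]]) (intro continuous_intros schwartz_cont h continuous_conv_dist \<phi>)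
  ultimately show ?thesis
    using integral_norm_bound_ennreal[of lborel "\<lambda>y. k (x - y) * conv_dist \<phi> T y"] by (simp add: norm_mult)
qed

end

text \<open>For unit cubes |P| = 1, so the factor with tau is 1. Each term of the sum is at most 1,
  which supplies for every v some lam < 2 with modular at most 1. On a cube of measure 1 the
  inequality u^r <= 1 + u^p then replaces the variable exponent by r.\<close>

lemma besov_local_bound:
  fixes \<alpha> \<tau> p q :: "'a::euclidean_space \<Rightarrow> real" and \<Phi> \<phi> :: "'a \<Rightarrow> complex"
  assumes \<alpha>: "Clog_loc \<alpha>" and p: "p \<in> P0log" and q: "q \<in> P0log" and sch: "schwartz \<Phi>" "schwartz \<phi>"
  obtains r c a where "0 < r" "r < 1" "0 < c" "0 \<le> a" "\<And>T \<mu> v m. tempered T \<Longrightarrow> 0 < \<mu> \<Longrightarrow>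
    besov_norm \<alpha> \<tau> p q \<Phi> \<phi> T < ennreal \<mu> \<Longrightarrow>
    (\<integral>\<^sup>+y. ennreal (cmod (conv_dist (phi_seq \<Phi> \<phi> v) T y) powr r) * indicator (dyadic_cube 0 m) y \<partial>lborel)
      \<le> ennreal (2 * (\<mu> * c * 2 powr (real v * a)) powr r)"
proof -
  obtain a where a: "0 \<le> a" "\<And>x. \<bar>\<alpha> x\<bar> \<le> a" using Clog_loc_bounded[OF \<alpha>] by metis
  obtain p0 where p0: "0 < p0" "\<And>x. p0 \<le> p x" using P0log_lower_bound[OF p] by metis
  obtain q0 where q0: "0 < q0" "\<And>x. q0 \<le> q x" using P0log_lower_bound[OF q] by metis
  have pm[measurable]: "p \<in> borel_measurable lebesgue" using p by (simp add: P0log_def P0_def)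
  \<comment> \<open>Below 1 for the splitting of |G|, and below p0 for the comparison of
    powers.\<close>
  define r where "r = min p0 1 / 2"
  define c where "c = 2 powr (1 / q0)"
  have r: "0 < r" "r < 1" "r \<le> p0" using p0 by (auto simp: r_def)
  show ?thesis
  proof (rule that[OF r(1,2) _ a(1)])
    show "0 < c" by (simp add: c_def)
    fix T :: "('a \<Rightarrow> complex) \<Rightarrow> complex" and \<mu> :: real and v :: nat and m :: "'a \<Rightarrow> int"
    assume T: "tempered T" and \<mu>: "0 < \<mu>" and bT: "besov_norm \<alpha> \<tau> p q \<Phi> \<phi> T < ennreal \<mu>"
    interpret tempered_dist T by standard (rule T)
    let ?G = "conv_dist (phi_seq \<Phi> \<phi> v) T" and ?Q = "dyadic_cube 0 m"
    let ?f = "\<lambda>v x. 2 powr (real v * \<alpha> x) * cmod (conv_dist (phi_seq \<Phi> \<phi> v) T x)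
         * (2 powr (- real_of_int 0 * real DIM('a))) powr (- \<tau> x) * indicator ?Q x"
    have G: "continuous_on UNIV ?G" by (intro continuous_conv_dist schwartz_phi_seq sch)
    have "lq_Lp p q (nat 0) ?f \<le> besov_norm \<alpha> \<tau> p q \<Phi> \<phi> T"
      unfolding besov_norm_def by (rule SUP_upper2[of "(0, m)"]) auto
    then have "lq_Lp p q 0 ?f < ennreal \<mu>" using bT by simp
    then obtain \<mu>' where \<mu>': "\<mu>' > 0" "ennreal \<mu>' < ennreal \<mu>"
      and sum: "(\<Sum>v. if 0 \<le> v then Inf {ennreal lam | lam. lam > 0 \<and> modular p (\<lambda>x. ?f v x / (\<mu>' * lam powr (1 / q x))) \<le> 1} else 0) \<le> 1"
      unfolding lq_Lp_def Inf_less_iff by blast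
    have "Inf {ennreal lam | lam. lam > 0 \<and> modular p (\<lambda>x. ?f v x / (\<mu>' * lam powr (1 / q x))) \<le> 1} \<le> 1"
    proof -
      have "(\<Sum>i\<in>{v}. if 0 \<le> i then Inf {ennreal lam | lam. lam > 0 \<and> modular p (\<lambda>x. ?f i x / (\<mu>' * lam powr (1 / q x))) \<le> 1} else 0)
        \<le> (\<Sum>v. if 0 \<le> v then Inf {ennreal lam | lam. lam > 0 \<and> modular p (\<lambda>x. ?f v x / (\<mu>' * lam powr (1 / q x))) \<le> 1} else 0)"
        by (rule sum_le_suminf) auto
      from order_trans[OF this sum] show ?thesis by simp
    qed
    \<comment> \<open>The infimum need not be attained, so any bound above 1 is taken; 2 is the
      source of c = 2^(1/q0).\<close>
    also have "(1::ennreal) < ennreal 2" by (simp add: ennreal_less_iff flip: ennreal_1)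
    finally obtain lam where lam: "lam > 0" "ennreal lam < ennreal 2" "modular p (\<lambda>x. ?f v x / (\<mu>' * lam powr (1 / q x))) \<le> 1"
      unfolding Inf_less_iff by blast
    have \<mu>'2: "\<mu>' < \<mu>" and lam2: "lam < 2" using \<mu>' lam by (auto simp: ennreal_less_iff)
    \<comment> \<open>d collects mu, the bound c for lam^(1/q x), and 2^(v a), the worst case of
      2^(-v alpha). Dividing by d puts u below the quotient inside the modular.\<close>
    define d where "d = \<mu> * c * 2 powr (real v * a)"
    have d: "0 < d" using \<mu> by (simp add: d_def c_def)
    define u where "u x = cmod (?G x) / d" for x
    have u0: "0 \<le> u x" for x using d by (simp add: u_def)
    have um[measurable]: "u \<in> borel_measurable borel"
      unfolding u_def[abs_def]
      by (rule borel_measurable_divide[OF cont_measurable[OF continuous_on_norm[OF G]] borel_measurable_const])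
    then have um': "u \<in> borel_measurable lebesgue" by (intro measurable_completion) simp
    have Qm: "?Q \<in> sets lebesgue" by (rule sets_completionI_sets) (simp add: sets_unit_cube)
    have ule: "u x \<le> \<bar>?f v x / (\<mu>' * lam powr (1 / q x))\<bar>" if "x \<in> ?Q" for x
    proof -
      have qx: "0 < q x" using q0 less_le_trans by blast
      have "lam powr (1 / q x) \<le> 2 powr (1 / q x)" using lam(1) lam2 qx by (intro powr_mono2) auto
      also have "\<dots> \<le> c" unfolding c_def using q0 qx by (intro powr_mono divide_left_mono mult_pos_pos) auto
      finally have "\<mu>' * lam powr (1 / q x) \<le> \<mu> * c" using \<mu>' \<mu>'2 by (intro mult_mono) auto
      moreover have "0 < \<mu>' * lam powr (1 / q x)" using \<mu>' lam by simp
      moreover have "2 powr (- (real v * a)) \<le> 2 powr (real v * \<alpha> x)"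
        using a(2)[of x] mult_left_mono[of "- a" "\<alpha> x" "real v"] by (intro powr_mono) auto
      ultimately have "2 powr (- (real v * a)) * cmod (?G x) / (\<mu> * c) \<le> 2 powr (real v * \<alpha> x) * cmod (?G x) / (\<mu>' * lam powr (1 / q x))"
        by (intro frac_le mult_right_mono) auto
      moreover have "u x = 2 powr (- (real v * a)) * cmod (?G x) / (\<mu> * c)"
        unfolding u_def d_def powr_minus by (simp add: divide_inverse)
      moreover have "\<bar>?f v x / (\<mu>' * lam powr (1 / q x))\<bar> = 2 powr (real v * \<alpha> x) * cmod (?G x) / (\<mu>' * lam powr (1 / q x))"
        using that \<mu>'(1) by (simp add: abs_mult)
      ultimately show ?thesis by (simp only:)
    qed
    have "(\<integral>\<^sup>+y. ennreal (u y powr r) * indicator ?Q y \<partial>lebesgue)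
       \<le> (\<integral>\<^sup>+y. (indicator ?Q y + ennreal (u y powr p y) * indicator ?Q y) \<partial>lebesgue)"
    proof (rule nn_integral_mono)
      fix y
      have "u y powr r \<le> 1 + u y powr p y"
      proof (cases "u y \<le> 1")
        case True
        then have "u y powr r \<le> 1" using u0 r by (intro powr_le1) auto
        then show ?thesis by (simp add: add_increasing2)
      next
        case False
        then have "u y powr r \<le> u y powr p y" using r p0(2)[of y] by (intro powr_mono) auto
        then show ?thesis by simp
      qed
      then have "ennreal (u y powr r) \<le> 1 + ennreal (u y powr p y)"
        using ennreal_leI[of "u y powr r" "1 + u y powr p y"] by (simp add: ennreal_plus)
      then show "ennreal (u y powr r) * indicator ?Q y \<le> indicator ?Q y + ennreal (u y powr p y) * indicator ?Q y"
        by (simp add: indicator_def)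
    qed
    also have "\<dots> = (\<integral>\<^sup>+y. indicator ?Q y \<partial>lebesgue) + (\<integral>\<^sup>+y. ennreal (u y powr p y) * indicator ?Q y \<partial>lebesgue)"
      by (rule nn_integral_add) (use um' Qm in measurable)
    also have "\<dots> \<le> 1 + 1"
    proof (rule add_mono)
      show "(\<integral>\<^sup>+y. indicator ?Q y \<partial>lebesgue) \<le> 1"
        unfolding nn_integral_completion by (simp add: emeasure_unit_cube sets_unit_cube)
      have "(\<integral>\<^sup>+y. ennreal (u y powr p y) * indicator ?Q y \<partial>lebesgue) \<le> modular p (\<lambda>x. ?f v x / (\<mu>' * lam powr (1 / q x)))"
        unfolding modular_def
      proof (rule nn_integral_mono)
        fix y
        have "0 < p y" using p0 less_le_trans by blast
        then show "ennreal (u y powr p y) * indicator ?Q y \<le> ennreal (\<bar>?f v y / (\<mu>' * lam powr (1 / q y))\<bar> powr p y)"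
          using ule[of y] u0[of y] by (cases "y \<in> ?Q") (auto intro!: ennreal_leI powr_mono2)
      qed
      then show "(\<integral>\<^sup>+y. ennreal (u y powr p y) * indicator ?Q y \<partial>lebesgue) \<le> 1" using lam(3) by simp
    qed
    finally have main: "(\<integral>\<^sup>+y. ennreal (u y powr r) * indicator ?Q y \<partial>lborel) \<le> 2" unfolding nn_integral_completion by simp
    have "(\<integral>\<^sup>+y. ennreal (cmod (?G y) powr r) * indicator ?Q y \<partial>lborel) = (\<integral>\<^sup>+y. ennreal (d powr r) * (ennreal (u y powr r) * indicator ?Q y) \<partial>lborel)"
    proof (rule nn_integral_cong)
      fix y
      have "cmod (?G y) powr r = d powr r * u y powr r" using d u0[of y] by (simp add: powr_mult[symmetric] u_def)
      then show "ennreal (cmod (?G y) powr r) * indicator ?Q y = ennreal (d powr r) * (ennreal (u y powr r) * indicator ?Q y)"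
        by (simp add: ennreal_mult mult.assoc)
    qed
    also have "\<dots> = ennreal (d powr r) * (\<integral>\<^sup>+y. ennreal (u y powr r) * indicator ?Q y \<partial>lborel)"
      by (rule nn_integral_cmult) (simp add: sets_unit_cube)
    also have "\<dots> \<le> ennreal (d powr r) * 2" by (intro mult_left_mono main) auto
    also have "\<dots> = ennreal (2 * d powr r)" by (simp add: ennreal_mult mult.commute)
    finally show "(\<integral>\<^sup>+y. ennreal (cmod (?G y) powr r) * indicator ?Q y \<partial>lborel) \<le> ennreal (2 * (\<mu> * c * 2 powr (real v * a)) powr r)"
      unfolding d_def .
  qed
qed

section \<open>The Besov space embeds into the tempered distributions\<close>

lemma phi_seq_reflect: "phi_seq (\<lambda>x. \<Phi> (- x)) (\<lambda>x. \<phi> (- x)) v = (\<lambda>x. phi_seq \<Phi> \<phi> v (- x))"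
  by (auto simp: phi_seq_def)

text \<open>Derivatives commute with the convolution, so each derivative list reduces to
  \<open>conv_dil_approx\<close>.\<close>

lemma seminorm_conv_dil_approx:
  fixes k :: "'a::euclidean_space \<Rightarrow> complex"
  assumes k: "schwartz k" and k1: "fourier k 0 = 1" and g: "schwartz g"
  obtains C where "\<And>a. 1 \<le> a \<Longrightarrow> schwartz_seminorm M (\<lambda>x. conv (dil a k) g x - g x) \<le> C / a"
proof -
  let ?S = "{bs. set bs \<subseteq> (Basis :: 'a set) \<and> length bs \<le> M}"
  have sg: "schwartz (partials bs g)" if "bs \<in> ?S" for bs using that by (intro schwartz_partials g) auto
  have "\<exists>C. \<forall>z. 1 \<le> fst z \<longrightarrow> (1 + norm (snd z)) ^ M * cmod (conv (dil (fst z) k) (partials bs g) (snd z) - partials bs g (snd z)) \<le> C * (1 / fst z)"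
    if bs: "bs \<in> ?S" for bs
  proof -
    obtain C where "\<And>a x. 1 \<le> a \<Longrightarrow> (1 + norm x) ^ M * cmod (conv (dil a k) (partials bs g) x - partials bs g x) \<le> C / a"
      using conv_dil_approx[OF k k1 sg[OF bs]] by metis
    then show ?thesis by auto
  qed
  then obtain C where C: "\<And>bs z. bs \<in> ?S \<Longrightarrow> 1 \<le> fst z \<Longrightarrow>
      (1 + norm (snd z)) ^ M * cmod (conv (dil (fst z) k) (partials bs g) (snd z) - partials bs g (snd z)) \<le> C * (1 / fst z)"
    by (rule finite_uniform_bound[OF seminorm_set_finite, where P="\<lambda>z. 1 \<le> fst z" and Q="\<lambda>z. 1 / fst z"]) auto
  show ?thesis
  proof (rule that, rule seminorm_least)
    fix a :: real and x :: 'a and bs assume a: "1 \<le> a" and bs: "set bs \<subseteq> (Basis :: 'a set)" "length bs \<le> M"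
    have sd: "schwartz (dil a k)" using a by (intro schwartz_dil k) auto
    show "(1 + norm x) ^ M * cmod (partials bs (\<lambda>x. conv (dil a k) g x - g x) x) \<le> C / a"
      using C[of bs "(a, x)"] a bs
      by (simp add: partials_diff[OF conv_schwartz_fourier(1)[OF sd g] g bs(1)] partials_conv[OF sd g bs(1)])
  qed
qed

text \<open>With a plateau function \<open>\<eta>\<close>, the function \<open>\<theta>\<close> has Fourier transform \<open>\<eta> \<xi> - \<eta> (2 \<xi>)\<close> divided by
  that of \<open>\<phi> (- \<cdot>)\<close>, which makes the sum telescope.\<close>

lemma calderon:
  fixes \<Phi> \<phi> :: "'a::euclidean_space \<Rightarrow> complex"
  assumes ad: "admissible_pair \<Phi> \<phi>"
  obtains \<Theta> \<theta> k where "schwartz \<Theta>" "schwartz \<theta>" "schwartz k" "fourier k 0 = 1"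
    "\<And>\<xi>. norm \<xi> < 3/5 \<Longrightarrow> fourier \<theta> \<xi> = 0" "\<And>\<xi>. 5/3 < norm \<xi> \<Longrightarrow> fourier \<theta> \<xi> = 0"
    "\<And>\<psi> V. schwartz \<psi> \<Longrightarrow> (\<lambda>x. \<Sum>v\<le>V. conv (conv (phi_seq \<Theta> \<theta> v) \<psi>) (\<lambda>y. phi_seq \<Phi> \<phi> v (- y)) x) = conv (dil (2 ^ V) k) \<psi>"
proof -
  note adm = admissible_pairD[OF ad]
  let ?\<Phi> = "\<lambda>x. \<Phi> (- x)" and ?\<phi> = "\<lambda>x. \<phi> (- x)"
  have s\<Phi>: "schwartz ?\<Phi>" and s\<phi>: "schwartz ?\<phi>" by (intro schwartz_minus_arg adm)+
  have F\<Phi>: "fourier ?\<Phi> \<xi> = fourier \<Phi> (- \<xi>)" "fourier ?\<phi> \<xi> = fourier \<phi> (- \<xi>)" for \<xi>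
    by (intro fourier_reflect adm)+
  \<comment> \<open>Since 6/5 is twice 3/5, eta(xi) - eta(2 xi) vanishes off 3/5 <= |xi| <= 5/3,
    where the transform of phi has no zeros; the one of Phi has none for |xi| <= 5/3, which contains
    the set where eta is nonzero.\<close>
  obtain \<eta> :: "'a \<Rightarrow> complex" where \<eta>: "schwartz \<eta>" "\<And>x. norm x \<le> 6/5 \<Longrightarrow> \<eta> x = 1" "\<And>x. 5/3 \<le> norm x \<Longrightarrow> \<eta> x = 0"
    using plateau_exists[of "6/5" "5/3"] by auto
  define u where "u \<xi> = \<eta> \<xi> - \<eta> (2 *\<^sub>R \<xi>)" for \<xi>
  have su: "schwartz u" unfolding u_def[abs_def] using schwartz_affine[OF \<eta>(1), of 2 0] by (intro schwartz_diff \<eta>) simp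
  have u0: "u \<xi> = 0" if "norm \<xi> \<le> 3/5 \<or> 5/3 \<le> norm \<xi>" for \<xi> using that by (auto simp: u_def \<eta>)
  have sq: "a\<^sup>2 \<le> (norm \<xi>)\<^sup>2 \<longleftrightarrow> a \<le> norm \<xi>" "(norm \<xi>)\<^sup>2 \<le> a\<^sup>2 \<longleftrightarrow> norm \<xi> \<le> a" if "0 \<le> a" for a :: real and \<xi> :: 'a
    using that by (simp_all add: abs_le_square_iff[symmetric])
  have b1: "bump (- ((5/3)\<^sup>2)) 1 \<xi> = 0 \<longleftrightarrow> norm \<xi> \<le> 5/3" for \<xi> :: 'a
    using bump_zero[of "- ((5/3)\<^sup>2)" 1 \<xi>] bump_pos[of "- ((5/3)\<^sup>2)" 1 \<xi>] sq(2)[of "5/3" \<xi>] by fastforce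
  have b2: "bump ((3/5)\<^sup>2) (-1) \<xi> = 0 \<longleftrightarrow> 3/5 \<le> norm \<xi>" for \<xi> :: 'a
    using bump_zero[of "(3/5)\<^sup>2" "-1" \<xi>] bump_pos[of "(3/5)\<^sup>2" "-1" \<xi>] sq(1)[of "3/5" \<xi>] by fastforce
  obtain w0 where w0: "schwartz w0" "\<And>\<xi>. \<eta> \<xi> = fourier ?\<Phi> \<xi> * w0 \<xi>"
  proof (rule smooth_cutoff_divide[of \<eta> "5/3" "fourier ?\<Phi>" "bump (- ((5/3)\<^sup>2)) 1"])
    show "bump (- ((5/3)\<^sup>2)) 1 x = 0" if "\<eta> x \<noteq> 0" for x using that \<eta>(3)[of x] unfolding b1 by (meson linear)
    show "fourier ?\<Phi> x \<noteq> 0" if "bump (- ((5/3)\<^sup>2)) 1 x = 0" for x using that adm(6)[of "- x"] unfolding b1 F\<Phi> by simp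
  qed (use \<eta> that in \<open>auto intro: schwartz_smooth schwartz_fourier s\<Phi> smooth_bump bump_nonneg\<close>)
  \<comment> \<open>Zero exactly on the closed annulus 3/5 <= |xi| <= 5/3, as the auxiliary function
    of \<open>smooth_cutoff_divide\<close> has to be.\<close>
  let ?s = "\<lambda>\<xi>::'a. bump (- ((5/3)\<^sup>2)) 1 \<xi> + bump ((3/5)\<^sup>2) (-1) \<xi>"
  have s0: "?s \<xi> = 0 \<longleftrightarrow> 3/5 \<le> norm \<xi> \<and> norm \<xi> \<le> 5/3" for \<xi> :: 'a
  proof -
    obtain p q where pq: "p \<ge> 0" "q \<ge> 0" "bump (- ((5/3)\<^sup>2)) 1 \<xi> = of_real p" "bump ((3/5)\<^sup>2) (-1) \<xi> = of_real q"
      using bump_nonneg by metis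
    have "?s \<xi> = of_real (p + q)" unfolding pq(3,4) by simp
    then have "?s \<xi> = 0 \<longleftrightarrow> p = 0 \<and> q = 0" using pq(1,2) by (metis add_nonneg_eq_0_iff of_real_eq_0_iff)
    then show ?thesis using b1[of \<xi>] b2[of \<xi>] unfolding pq(3,4) by auto
  qed
  obtain w where w: "schwartz w" "\<And>\<xi>. u \<xi> = fourier ?\<phi> \<xi> * w \<xi>" "\<And>\<xi>. u \<xi> = 0 \<Longrightarrow> w \<xi> = 0"
  proof (rule smooth_cutoff_divide[of u "5/3" "fourier ?\<phi>" ?s])
    show "?s x = 0" if "u x \<noteq> 0" for x using that u0[of x] unfolding s0 by (meson linear)
    show "fourier ?\<phi> x \<noteq> 0" if "?s x = 0" for x using that adm(7)[of "- x"] unfolding s0 F\<Phi> by simp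
    show "\<exists>r\<ge>0. ?s x = of_real r" for x
      using bump_nonneg[of "- ((5/3)\<^sup>2)" 1 x] bump_nonneg[of "(3/5)\<^sup>2" "-1" x] by (metis add_nonneg_nonneg of_real_add)
    show "smooth ?s" by (intro smooth_add smooth_bump)
    show "smooth u" by (rule schwartz_smooth[OF su])
    show "smooth (fourier ?\<phi>)" by (rule schwartz_smooth[OF schwartz_fourier[OF s\<phi>]])
  qed (use u0 that in auto)
  obtain \<Theta> where \<Theta>: "schwartz \<Theta>" "\<And>\<xi>. fourier \<Theta> \<xi> = w0 \<xi>" using fourier_surj[OF w0(1)] by metis
  obtain \<theta> where \<theta>: "schwartz \<theta>" "\<And>\<xi>. fourier \<theta> \<xi> = w \<xi>" using fourier_surj[OF w(1)] by metis
  obtain k where k: "schwartz k" "\<And>\<xi>. fourier k \<xi> = \<eta> \<xi>" using fourier_surj[OF \<eta>(1)] by metis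
  show ?thesis
  proof (rule that[OF \<Theta>(1) \<theta>(1) k(1)])
    show "fourier k 0 = 1" by (simp add: k \<eta>)
    show "fourier \<theta> \<xi> = 0" if "norm \<xi> < 3/5" for \<xi> using that by (simp add: \<theta> w(3) u0)
    show "fourier \<theta> \<xi> = 0" if "5/3 < norm \<xi>" for \<xi> using that by (simp add: \<theta> w(3) u0)
    fix \<psi> :: "'a \<Rightarrow> complex" and V assume \<psi>: "schwartz \<psi>"
    have st: "schwartz (phi_seq \<Theta> \<theta> v)" for v by (rule schwartz_phi_seq[OF \<Theta>(1) \<theta>(1)])
    have sp: "schwartz (\<lambda>y. phi_seq \<Phi> \<phi> v (- y))" for v by (intro schwartz_minus_arg schwartz_phi_seq adm)
    have sc: "schwartz (conv (phi_seq \<Theta> \<theta> v) \<psi>)" for v by (rule conv_schwartz_fourier(1)[OF st \<psi>])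
    have sk: "schwartz (dil (2 ^ v) k)" for v :: nat by (rule schwartz_dil[OF k(1)]) simp
    have trm: "fourier (phi_seq \<Theta> \<theta> v) \<xi> * fourier (\<lambda>y. phi_seq \<Phi> \<phi> v (- y)) \<xi>
        = (if v = 0 then \<eta> \<xi> else \<eta> (\<xi> /\<^sub>R 2 ^ v) - \<eta> (\<xi> /\<^sub>R 2 ^ (v - 1)))" for v \<xi>
    proof (cases v)
      case 0
      then show ?thesis unfolding phi_seq_reflect[symmetric] by (simp add: phi_seq_0 \<Theta> w0 mult.commute)
    next
      case (Suc n)
      have "2 *\<^sub>R (\<xi> /\<^sub>R 2 ^ Suc n) = \<xi> /\<^sub>R 2 ^ n" by (simp add: field_simps)
      then have "u (\<xi> /\<^sub>R 2 ^ v) = \<eta> (\<xi> /\<^sub>R 2 ^ v) - \<eta> (\<xi> /\<^sub>R 2 ^ (v - 1))" using Suc by (simp add: u_def)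
      then show ?thesis using Suc w(2)[of "\<xi> /\<^sub>R 2 ^ v"] unfolding phi_seq_reflect[symmetric]
        by (simp add: phi_seq_pos fourier_dil \<theta> s\<phi> mult.commute)
    qed
    show "(\<lambda>x. \<Sum>v\<le>V. conv (conv (phi_seq \<Theta> \<theta> v) \<psi>) (\<lambda>y. phi_seq \<Phi> \<phi> v (- y)) x) = conv (dil (2 ^ V) k) \<psi>"
    proof (rule fourier_inject)
      show "schwartz (\<lambda>x. \<Sum>v\<le>V. conv (conv (phi_seq \<Theta> \<theta> v) \<psi>) (\<lambda>y. phi_seq \<Phi> \<phi> v (- y)) x)"
        by (intro schwartz_sum conv_schwartz_fourier sc sp)
      show "schwartz (conv (dil (2 ^ V) k) \<psi>)" by (intro conv_schwartz_fourier sk \<psi>)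
      fix \<xi>
      \<comment> \<open>Consecutive terms cancel and leave the last cutoff, which is the transform
        of the dilated \<open>k\<close>.\<close>
      have tel: "(\<Sum>v\<le>V. if v = 0 then \<eta> \<xi> else \<eta> (\<xi> /\<^sub>R 2 ^ v) - \<eta> (\<xi> /\<^sub>R 2 ^ (v - 1))) = \<eta> (\<xi> /\<^sub>R 2 ^ V)" for V
        by (induction V) auto
      have "fourier (\<lambda>x. \<Sum>v\<le>V. conv (conv (phi_seq \<Theta> \<theta> v) \<psi>) (\<lambda>y. phi_seq \<Phi> \<phi> v (- y)) x) \<xi>
          = (\<Sum>v\<le>V. fourier (conv (conv (phi_seq \<Theta> \<theta> v) \<psi>) (\<lambda>y. phi_seq \<Phi> \<phi> v (- y))) \<xi>)"
        by (intro fourier_sum conv_schwartz_fourier sc sp)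
      also have "\<dots> = (\<Sum>v\<le>V. (fourier (phi_seq \<Theta> \<theta> v) \<xi> * fourier (\<lambda>y. phi_seq \<Phi> \<phi> v (- y)) \<xi>) * fourier \<psi> \<xi>)"
        by (simp only: conv_schwartz_fourier(2)[OF sc sp] conv_schwartz_fourier(2)[OF st \<psi>] mult_ac)
      also have "\<dots> = \<eta> (\<xi> /\<^sub>R 2 ^ V) * fourier \<psi> \<xi>" unfolding trm sum_distrib_right[symmetric] tel ..
      also have "\<dots> = fourier (conv (dil (2 ^ V) k) \<psi>) \<xi>"
        by (simp add: conv_schwartz_fourier(2)[OF sk \<psi>] fourier_dil k)
      finally show "fourier (\<lambda>x. \<Sum>v\<le>V. conv (conv (phi_seq \<Theta> \<theta> v) \<psi>) (\<lambda>y. phi_seq \<Phi> \<phi> v (- y)) x) \<xi> = fourier (conv (dil (2 ^ V) k) \<psi>) \<xi>" .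
    qed
  qed
qed

text \<open>The local L^r bound is proportional to mu^r, and the 1/r-th power in
  \<open>submean_growth\<close> makes the result linear in mu, with constants free of T.\<close>

lemma besov_growth:
  fixes \<alpha> \<tau> p q :: "'a::euclidean_space \<Rightarrow> real" and \<Phi> \<phi> :: "'a \<Rightarrow> complex"
  assumes \<alpha>: "Clog_loc \<alpha>" and p: "p \<in> P0log" and q: "q \<in> P0log" and ad: "admissible_pair \<Phi> \<phi>"
  obtains E e where "0 \<le> E" "0 \<le> e" "\<And>T \<mu> v x. tempered T \<Longrightarrow> 0 < \<mu> \<Longrightarrow>
    besov_norm \<alpha> \<tau> p q \<Phi> \<phi> T < ennreal \<mu> \<Longrightarrow>
    cmod (conv_dist (phi_seq \<Phi> \<phi> v) T x) \<le> \<mu> * E * 2 powr (real v * e) * (1 + norm x)"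
proof -
  note adm = admissible_pairD[OF ad]
  obtain r c a where r: "0 < r" "r < 1" and c: "0 < c" and a: "0 \<le> a" and loc: "\<And>T \<mu> v m. tempered T \<Longrightarrow> 0 < \<mu> \<Longrightarrow>
    besov_norm \<alpha> \<tau> p q \<Phi> \<phi> T < ennreal \<mu> \<Longrightarrow>
    (\<integral>\<^sup>+y. ennreal (cmod (conv_dist (phi_seq \<Phi> \<phi> v) T y) powr r) * indicator (dyadic_cube 0 m) y \<partial>lborel)
      \<le> ennreal (2 * (\<mu> * c * 2 powr (real v * a)) powr r)"
    using besov_local_bound[OF \<alpha> p q adm(1,2)] by blast
  \<comment> \<open>Equal to 1 on |xi| <= 2, where the transforms of Phi and phi are supported, so
    the kernel dilated by 2^v reproduces phi_v.\<close>
  obtain \<eta> :: "'a \<Rightarrow> complex" where \<eta>: "schwartz \<eta>" "\<And>x. norm x \<le> 2 \<Longrightarrow> \<eta> x = 1" "\<And>x. 3 \<le> norm x \<Longrightarrow> \<eta> x = 0"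
    using plateau_exists[of 2 3] by auto
  obtain k where k: "schwartz k" "\<And>\<xi>. fourier k \<xi> = \<eta> \<xi>" using fourier_surj[OF \<eta>(1)] by metis
  obtain D where D: "0 \<le> D" "\<And>a G B A K x. submean k r a B G \<Longrightarrow>
    (\<And>y. cmod (G y) \<le> A * (1 + norm y) ^ K) \<Longrightarrow>
    cmod (G x) \<le> (D * a ^ DIM('a) * B) powr (1 / r) * (1 + norm x)"
    using submean_growth[OF schwartz_rapid[OF k(1)] r] by blast
  have rep: "conv (dil (2 ^ v) k) (phi_seq \<Phi> \<phi> v) = phi_seq \<Phi> \<phi> v" for v
  proof (rule conv_eqI)
    fix \<xi> :: 'a
    have 0: "\<eta> \<xi> = 1 \<or> fourier \<Phi> \<xi> = 0" "\<eta> \<xi> = 1 \<or> fourier \<phi> \<xi> = 0" for \<xi>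
      using \<eta>(2)[of \<xi>] adm(3,4)[of \<xi>] by (meson not_le)+
    show "fourier (dil (2 ^ v) k) \<xi> * fourier (phi_seq \<Phi> \<phi> v) \<xi> = fourier (phi_seq \<Phi> \<phi> v) \<xi>"
      using 0(1)[of \<xi>] 0(2)[of "\<xi> /\<^sub>R 2 ^ v"]
      by (cases "v = 0") (auto simp: phi_seq_0 phi_seq_pos fourier_dil k adm(1,2))
  qed (auto intro: schwartz_dil schwartz_phi_seq k adm)
  show ?thesis
  \<comment> \<open>From (D 2^(v n) 2 b^r)^(1/r) with b = mu c 2^(v a): the dilation contributes n /
    r to the exponent and the weight contributes a.\<close>
  proof (rule that[of "(2 * D) powr (1 / r) * c" "DIM('a) / r + a"])
    show "0 \<le> (2 * D) powr (1 / r) * c" using c by simp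
    show "0 \<le> DIM('a) / r + a" using a r by simp
    fix T :: "('a \<Rightarrow> complex) \<Rightarrow> complex" and \<mu> :: real and v x
    assume T: "tempered T" and \<mu>: "0 < \<mu>" and bT: "besov_norm \<alpha> \<tau> p q \<Phi> \<phi> T < ennreal \<mu>"
    interpret tempered_dist T by standard (rule T)
    let ?G = "conv_dist (phi_seq \<Phi> \<phi> v) T"
    have sp: "schwartz (phi_seq \<Phi> \<phi> v)" by (rule schwartz_phi_seq[OF adm(1,2)])
    obtain A K where A: "\<And>y. cmod (?G y) \<le> A * (1 + norm y) ^ K" using conv_dist_growth[OF sp] by metis
    let ?b = "\<mu> * c * 2 powr (real v * a)"
    have b: "0 < ?b" using \<mu> c by simp
    have "cmod (?G x) \<le> (D * (2 ^ v) ^ DIM('a) * (2 * ?b powr r)) powr (1 / r) * (1 + norm x)"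
    proof (rule D(2)[OF _ A], unfold submean_def, intro conjI allI)
      show "ennreal (cmod (?G x)) \<le> (\<integral>\<^sup>+y. ennreal (cmod (dil (2 ^ v) k (x - y)) * cmod (?G y)) \<partial>lborel)" for x
        by (rule conv_dist_reproducing[OF sp schwartz_dil[OF k(1)] rep]) simp
    qed (auto intro!: cont_measurable continuous_conv_dist sp loc T \<mu> bT)
    also have "(D * (2 ^ v) ^ DIM('a) * (2 * ?b powr r)) powr (1 / r) = \<mu> * ((2 * D) powr (1 / r) * c) * 2 powr (real v * (DIM('a) / r + a))"
    proof -
      have "(D * (2 ^ v) ^ DIM('a) * (2 * ?b powr r)) = (2 * D) * (2 powr (real v * DIM('a)) * ?b powr r)"
        by (simp add: powr_realpow[symmetric] powr_powr)
      also have "\<dots> powr (1 / r) = (2 * D) powr (1 / r) * (2 powr (real v * DIM('a) * (1 / r)) * ?b)"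
        using D(1) b r \<mu> c by (simp add: powr_mult powr_powr)
      also have "\<dots> = \<mu> * ((2 * D) powr (1 / r) * c) * 2 powr (real v * (DIM('a) / r + a))"
        by (simp add: powr_add distrib_left)
      finally show ?thesis .
    qed
    finally show "cmod (?G x) \<le> \<mu> * ((2 * D) powr (1 / r) * c) * 2 powr (real v * (DIM('a) / r + a)) * (1 + norm x)" .
  qed
qed

lemma besov_embeds_tempered:
  fixes \<alpha> \<tau> p q :: "'a::euclidean_space \<Rightarrow> real" and \<Phi> \<phi> :: "'a \<Rightarrow> complex"
  assumes \<alpha>: "Clog_loc \<alpha>" and p: "p \<in> P0log" and q: "q \<in> P0log" and ad: "admissible_pair \<Phi> \<phi>"
  obtains C M where "0 \<le> C" "\<And>T \<mu> \<psi>. tempered T \<Longrightarrow> 0 < \<mu> \<Longrightarrow> besov_norm \<alpha> \<tau> p q \<Phi> \<phi> T < ennreal \<mu> \<Longrightarrow>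
    schwartz \<psi> \<Longrightarrow> cmod (T \<psi>) \<le> C * \<mu> * schwartz_seminorm M \<psi>"
proof -
  note adm = admissible_pairD[OF ad]
  let ?n = "DIM('a) + 2"
  obtain E e where E: "0 \<le> E" "0 \<le> e" "\<And>T \<mu> v x. tempered T \<Longrightarrow> 0 < \<mu> \<Longrightarrow>
    besov_norm \<alpha> \<tau> p q \<Phi> \<phi> T < ennreal \<mu> \<Longrightarrow>
    cmod (conv_dist (phi_seq \<Phi> \<phi> v) T x) \<le> \<mu> * E * 2 powr (real v * e) * (1 + norm x)"
    using besov_growth[OF \<alpha> p q ad] by blast
  obtain \<Theta> \<theta> k where \<Theta>: "schwartz \<Theta>" "schwartz \<theta>" and k: "schwartz k" "fourier k 0 = 1"
    and \<theta>0: "\<And>\<xi>. norm \<xi> < 3/5 \<Longrightarrow> fourier \<theta> \<xi> = 0" "\<And>\<xi>. 5/3 < norm \<xi> \<Longrightarrow> fourier \<theta> \<xi> = 0"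
    and cal: "\<And>\<psi> V. schwartz \<psi> \<Longrightarrow> (\<lambda>x. \<Sum>v\<le>V. conv (conv (phi_seq \<Theta> \<theta> v) \<psi>) (\<lambda>y. phi_seq \<Phi> \<phi> v (- y)) x) = conv (dil (2 ^ V) k) \<psi>"
    using calderon[OF ad] by blast
  \<comment> \<open>One unit beyond e leaves a factor 2^-v for the summation.\<close>
  obtain N :: nat where N: "e + 1 < real N" using reals_Archimedean2 by blast
  have d35: "(0::real) < 3/5" by simp
  \<comment> \<open>The additional power in \<open>Suc ?n\<close> pays for the linear growth of
    phi_v * T.\<close>
  obtain C M where C: "0 \<le> C" "\<And>\<psi> v x. schwartz \<psi> \<Longrightarrow>
    cmod (conv (phi_seq \<Theta> \<theta> v) \<psi> x) \<le> C * schwartz_seminorm M \<psi> / (2 ^ v) ^ (2 * N) / (1 + norm x) ^ Suc ?n"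
    using phi_seq_conv_decay[OF \<Theta> d35 \<theta>0, where N=N and K="Suc ?n"] by blast
  define I where "I = (\<integral>x. 1 / (1 + norm x) ^ ?n \<partial>(lborel :: 'a measure))"
  have I: "0 \<le> I" unfolding I_def by (intro Bochner_Integration.integral_nonneg) simp
  show ?thesis
  proof (rule that[of "2 * C * E * I" M])
    show "0 \<le> 2 * C * E * I" using C E I by simp
    fix T :: "('a \<Rightarrow> complex) \<Rightarrow> complex" and \<mu> :: real and \<psi> :: "'a \<Rightarrow> complex"
    assume T: "tempered T" and \<mu>: "0 < \<mu>" and bT: "besov_norm \<alpha> \<tau> p q \<Phi> \<phi> T < ennreal \<mu>" and \<psi>: "schwartz \<psi>"
    interpret tempered_dist T by standard (rule T)
    let ?S = "schwartz_seminorm M \<psi>"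
    let ?h = "\<lambda>v. conv (phi_seq \<Theta> \<theta> v) \<psi>" and ?G = "\<lambda>v. conv_dist (phi_seq \<Phi> \<phi> v) T"
    have S: "0 \<le> ?S" by (rule seminorm_nonneg[OF \<psi>])
    have sp: "schwartz (phi_seq \<Phi> \<phi> v)" for v by (rule schwartz_phi_seq[OF adm(1,2)])
    have sh: "schwartz (?h v)" for v by (intro conv_schwartz_fourier schwartz_phi_seq \<Theta> \<psi>)
    define Z where "Z = C * ?S * \<mu> * E"
    have Z: "0 \<le> Z" using C S \<mu> E by (simp add: Z_def)
    have trm: "cmod (T (conv (?h v) (\<lambda>y. phi_seq \<Phi> \<phi> v (- y)))) \<le> Z * I * (1/2) ^ v" for v
    proof -
      have pt: "cmod (?h v x * ?G v x) \<le> Z * (1/2) ^ v * (1 / (1 + norm x) ^ ?n)" for x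
      proof -
        have "cmod (?h v x * ?G v x) \<le> (C * ?S / (2 ^ v) ^ (2 * N) / (1 + norm x) ^ Suc ?n) * (\<mu> * E * 2 powr (real v * e) * (1 + norm x))"
          unfolding norm_mult by (intro mult_mono C(2)[OF \<psi>] E(3)[OF T \<mu> bT] divide_nonneg_nonneg mult_nonneg_nonneg C S) auto
        also have "\<dots> = Z * (2 powr (real v * e) / (2 ^ v) ^ (2 * N)) * (1 / (1 + norm x) ^ ?n)"
        proof -
          have d: "1 + norm x \<noteq> 0" using norm_ge_zero[of x] by linarith
          show ?thesis unfolding Z_def power_Suc[of "1 + norm x" ?n] using d by simp
        qed
        also have "\<dots> \<le> Z * (1/2) ^ v * (1 / (1 + norm x) ^ ?n)"
        proof (intro mult_right_mono mult_left_mono Z)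
          have "real v * (e + 1) \<le> real v * (2 * real N)" using N by (intro mult_left_mono) auto
          then have "2 powr (real v * e - real v * (2 * real N)) \<le> 2 powr (- real v)" by (intro powr_mono) (auto simp: algebra_simps)
          moreover have "2 powr (real v * e) / (2 ^ v) ^ (2 * N) = 2 powr (real v * e - real v * (2 * real N))"
            by (simp add: powr_diff powr_realpow[symmetric] powr_powr)
          moreover have "2 powr (- real v) = (1/2) ^ v" by (simp add: powr_minus powr_realpow power_one_over inverse_eq_divide)
          ultimately show "2 powr (real v * e) / (2 ^ v) ^ (2 * N) \<le> (1/2) ^ v" by simp
        qed simp
        finally show ?thesis .
      qed
      have "cmod (\<integral>x. ?h v x * ?G v x \<partial>lborel) \<le> (\<integral>x. Z * (1/2) ^ v * (1 / (1 + norm x) ^ ?n) \<partial>(lborel :: 'a measure))"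
      proof (rule Bochner_Integration.integral_norm_bound_integral[OF _ integrable_mult_right[OF decay_integrable] pt])
        show "integrable lborel (\<lambda>x. ?h v x * ?G v x)"
          by (rule rapid_integrable(2)[OF _ conv_dist_rapid[OF sp sh]]) (intro continuous_intros schwartz_cont sh continuous_conv_dist sp)
      qed
      also have "\<dots> = Z * I * (1/2) ^ v" by (simp only: integral_mult_right_zero I_def mult_ac)
      finally show ?thesis unfolding T_conv[OF sp sh] .
    qed
    have part: "cmod (T (conv (dil (2 ^ V) k) \<psi>)) \<le> Z * I * 2" for V
    proof -
      have "T (\<lambda>x. \<Sum>v\<le>V. 1 * conv (?h v) (\<lambda>y. phi_seq \<Phi> \<phi> v (- y)) x) = (\<Sum>v\<le>V. 1 * T (conv (?h v) (\<lambda>y. phi_seq \<Phi> \<phi> v (- y))))"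
        by (intro T_sum conv_schwartz_fourier sh schwartz_minus_arg sp) auto
      then have "T (conv (dil (2 ^ V) k) \<psi>) = (\<Sum>v\<le>V. T (conv (?h v) (\<lambda>y. phi_seq \<Phi> \<phi> v (- y))))"
        using cal[OF \<psi>, of V] by simp
      then have "cmod (T (conv (dil (2 ^ V) k) \<psi>)) \<le> (\<Sum>v\<le>V. Z * I * (1/2) ^ v)"
        using trm by (auto intro!: sum_norm_le)
      also have "\<dots> = Z * I * (\<Sum>v\<le>V. (1/2) ^ v)" by (simp add: sum_distrib_left)
      also have "\<dots> \<le> Z * I * 2"
      proof (intro mult_left_mono)
        have "(\<Sum>v\<le>V. (1/2 :: real) ^ v) \<le> (\<Sum>v. (1/2) ^ v)" by (intro sum_le_suminf) auto
        then show "(\<Sum>v\<le>V. (1/2 :: real) ^ v) \<le> 2" by (simp add: suminf_geometric)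
      qed (use Z I in auto)
      finally show ?thesis .
    qed
    \<comment> \<open>The constants of T itself enter only the limit of the partial sums; the bound
      on these sums is independent of them.\<close>
    obtain CT MT where CT: "0 \<le> CT" "\<And>f. schwartz f \<Longrightarrow> cmod (T f) \<le> CT * schwartz_seminorm MT f" using T_bound by metis
    obtain C1 where C1: "\<And>a. 1 \<le> a \<Longrightarrow> schwartz_seminorm MT (\<lambda>x. conv (dil a k) \<psi> x - \<psi> x) \<le> C1 / a"
      using seminorm_conv_dil_approx[OF k \<psi>] by blast
    have sk: "schwartz (conv (dil (2 ^ V) k) \<psi>)" for V :: nat by (intro conv_schwartz_fourier schwartz_dil k \<psi>) simp
    have "(\<lambda>V. T (conv (dil (2 ^ V) k) \<psi>)) \<longlonglongrightarrow> T \<psi>"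
    proof (rule Lim_null[THEN iffD2], rule Lim_null_comparison)
      show "\<forall>\<^sub>F V in sequentially. norm (T (conv (dil (2 ^ V) k) \<psi>) - T \<psi>) \<le> CT * C1 * (1/2) ^ V"
      proof (intro always_eventually allI)
        fix V :: nat
        have "CT * schwartz_seminorm MT (\<lambda>x. conv (dil (2 ^ V) k) \<psi> x - \<psi> x) \<le> CT * (C1 / 2 ^ V)"
          by (intro mult_left_mono C1 CT) simp
        then show "norm (T (conv (dil (2 ^ V) k) \<psi>) - T \<psi>) \<le> CT * C1 * (1/2) ^ V"
          using CT(2)[OF schwartz_diff[OF sk[of V] \<psi>]] unfolding T_diff[OF sk \<psi>] by (simp add: power_one_over)
      qed
      show "(\<lambda>V. CT * C1 * (1/2) ^ V) \<longlonglongrightarrow> 0"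
        by (intro tendsto_mult_right_zero LIMSEQ_power_zero) simp
    qed
    then have "cmod (T \<psi>) \<le> Z * I * 2"
      by (intro LIMSEQ_le_const2[OF tendsto_norm]) (use part in auto)
    then show "cmod (T \<psi>) \<le> 2 * C * E * I * \<mu> * ?S" by (simp add: Z_def mult_ac)
  qed
qed

text \<open>Continuity is expressed by estimates. In the last one C and the seminorm are common to
  all T, so it bounds T uniformly on bounded sets of test functions: the second inclusion is
  continuous even for the strong topology of the dual.\<close>

theorem theorem4p4:
  fixes \<alpha> \<tau> p q :: "'a::euclidean_space \<Rightarrow> real"
    and \<Phi> \<phi> :: "'a \<Rightarrow> complex"
  assumes "Clog_loc \<alpha>" and "Clog_loc \<tau>" and "ess_inf \<tau> > 0"
    and "p \<in> P0log" and "q \<in> P0log" and "ess_sup q < \<infinity>"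
    and "admissible_pair \<Phi> \<phi>"
  shows "(\<forall>f. schwartz f \<longrightarrow> dist_of f \<in> besov_space \<alpha> \<tau> p q \<Phi> \<phi>) \<and>
         (\<exists>C M. \<forall>f. schwartz f \<longrightarrow>
             besov_norm \<alpha> \<tau> p q \<Phi> \<phi> (dist_of f) \<le> ennreal (C * schwartz_seminorm M f)) \<and>
         besov_space \<alpha> \<tau> p q \<Phi> \<phi> \<subseteq> {T. tempered T} \<and>
         (\<exists>C M. \<forall>T\<in>besov_space \<alpha> \<tau> p q \<Phi> \<phi>. \<forall>\<psi>. schwartz \<psi> \<longrightarrow>
             ennreal (cmod (T \<psi>)) \<le> ennreal C * besov_norm \<alpha> \<tau> p q \<Phi> \<phi> T * ennreal (schwartz_seminorm M \<psi>))"
proof (intro conjI)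
  obtain C M where C: "\<And>f. schwartz f \<Longrightarrow> besov_norm \<alpha> \<tau> p q \<Phi> \<phi> (dist_of f) \<le> ennreal (C * schwartz_seminorm M f)"
    using schwartz_besov_norm_bound[OF assms(1-5,7)] by blast
  then show "\<exists>C M. \<forall>f. schwartz f \<longrightarrow> besov_norm \<alpha> \<tau> p q \<Phi> \<phi> (dist_of f) \<le> ennreal (C * schwartz_seminorm M f)"
    by blast
  show "\<forall>f. schwartz f \<longrightarrow> dist_of f \<in> besov_space \<alpha> \<tau> p q \<Phi> \<phi>"
    using tempered_dist_of le_less_trans[OF C ennreal_less_top] by (auto simp: besov_space_def)
  show "besov_space \<alpha> \<tau> p q \<Phi> \<phi> \<subseteq> {T. tempered T}" by (auto simp: besov_space_def)
  obtain C M where C: "0 \<le> C" "\<And>T \<mu> \<psi>. tempered T \<Longrightarrow> 0 < \<mu> \<Longrightarrow> besov_norm \<alpha> \<tau> p q \<Phi> \<phi> T < ennreal \<mu> \<Longrightarrow>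
    schwartz \<psi> \<Longrightarrow> cmod (T \<psi>) \<le> C * \<mu> * schwartz_seminorm M \<psi>"
    using besov_embeds_tempered[OF assms(1,4,5,7)] by blast
  show "\<exists>C M. \<forall>T\<in>besov_space \<alpha> \<tau> p q \<Phi> \<phi>. \<forall>\<psi>. schwartz \<psi> \<longrightarrow>
      ennreal (cmod (T \<psi>)) \<le> ennreal C * besov_norm \<alpha> \<tau> p q \<Phi> \<phi> T * ennreal (schwartz_seminorm M \<psi>)"
  proof (intro exI ballI allI impI)
    fix T :: "('a \<Rightarrow> complex) \<Rightarrow> complex" and \<psi> :: "'a \<Rightarrow> complex" assume "T \<in> besov_space \<alpha> \<tau> p q \<Phi> \<phi>" and \<psi>: "schwartz \<psi>"
    then have T: "tempered T" "besov_norm \<alpha> \<tau> p q \<Phi> \<phi> T < \<infinity>" by (auto simp: besov_space_def)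
    obtain b where b: "0 \<le> b" "besov_norm \<alpha> \<tau> p q \<Phi> \<phi> T = ennreal b"
      using T(2) by (cases "besov_norm \<alpha> \<tau> p q \<Phi> \<phi> T") auto
    let ?S = "schwartz_seminorm M \<psi>"
    have S: "0 \<le> ?S" by (rule seminorm_nonneg[OF \<psi>])
    have "cmod (T \<psi>) \<le> C * b * ?S"
    \<comment> \<open>The bound needs a positive mu strictly above the norm b, so it is applied with
      b + d; the denominator C S + 1 keeps C S d below e, also when C S = 0.\<close>
    proof (rule field_le_epsilon)
      fix e :: real assume e: "0 < e"
      define d where "d = e / (C * ?S + 1)"
      have CS: "0 < C * ?S + 1" using C S by (simp add: add_nonneg_pos)
      have d: "0 < d" using e CS by (simp add: d_def)
      have "cmod (T \<psi>) \<le> C * (b + d) * ?S"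
        using b d by (intro C(2)[OF T(1) _ _ \<psi>]) (auto simp: ennreal_less_iff)
      also have "\<dots> = C * b * ?S + (C * ?S) * d" by (simp add: algebra_simps)
      also have "(C * ?S) * d \<le> (C * ?S + 1) * d" using d by (intro mult_right_mono) auto
      also have "(C * ?S + 1) * d = e" using CS by (simp add: d_def)
      finally show "cmod (T \<psi>) \<le> C * b * ?S + e" by simp
    qed
    then have "ennreal (cmod (T \<psi>)) \<le> ennreal (C * b * ?S)" by (rule ennreal_leI)
    also have "\<dots> = ennreal C * besov_norm \<alpha> \<tau> p q \<Phi> \<phi> T * ennreal ?S" unfolding b(2) using C b S by (simp add: ennreal_mult)
    finally show "ennreal (cmod (T \<psi>)) \<le> ennreal C * besov_norm \<alpha> \<tau> p q \<Phi> \<phi> T * ennreal ?S" .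
  qed
qed

end
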